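(* Let $(L,T,R)$ be a quantum triad with associated quantales $Q_0=R\otimes_T L$ and $Q_1$, and let $\phi:Q_0\to Q_1$ be the quantale morphism determined by $\phi(r\otimes l)=\big(l'\mapsto (l'r)l,\ r'\mapsto r(lr')\big)$. (1) $\phi$ is strong (i.e. $\phi(1_{Q_0})=1_{Q_1}$) if and only if $(L,T,R)$ is strong. (2) If $(L,T,R)$ is strict, then $\mathcal{L}(Q_0)\cong\mathcal{L}(Q_1)\cong L$ and $\mathcal{R}(Q_0)\cong\mathcal{R}(Q_1)\cong R$ (as modules over any solution $Q$ of the triad), and $\mathcal{T}(Q_0)\cong\mathcal{T}(Q_1)\cong T$ (as quantales). In particular, $T$ is strictly two-sided.
   Context: A sup-lattice is a complete lattice; morphisms of sup-lattices preserve arbitrary joins. A bimorphism $S\times S'\to S''$ preserves arbitrary joins in each variable separately; its values are written as products. A quantale is a sup-lattice with an associative bimorphism $Q\times Q\to Q$; it is unital if it has a two-sided unit $e$, and strictly two-sided if it is unital with $e$ equal to the top element. The top element of a sup-lattice $S$ is denoted $1_S$. A left $Q$-module is a sup-lattice $M$ with a bimorphism $Q\times M\to M$ satisfying $(qq')m=q(q'm)$, and it is unital if $Q$ is unital and $em=m$; right modules are analogous; a $(Q,Q')$-bimodule is a left $Q$-module and right $Q'$-module with $(qm)q'=q(mq')$. Module morphisms are sup-lattice morphisms commuting with the action. For a quantale $Q$ with top $1$: $\mathcal{R}(Q)=\{q: q1\le q\}$ (right-sided elements), $\mathcal{L}(Q)=\{q:1q\le q\}$ (left-sided elements), $\mathcal{T}(Q)=\mathcal{R}(Q)\cap\mathcal{L}(Q)$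 (two-sided elements). A (quantum) triad $(L,T,R)$ consists of a quantale $T$, a right $T$-module $R$, a left $T$-module $L$, and a bimorphism $L\times R\to T$, $(l,r)\mapsto lr$, such that $(tl)r=t(lr)$ and $(lr)t=l(rt)$ for all $l\in L$, $r\in R$, $t\in T$. The triad is: strong if $l\le(l1_R)1_L$ and $r\le 1_R(1_Lr)$ for all $l\in L,r\in R$; unital if $T$ is a unital quantale and $L,R$ are unital $T$-modules; strict if it is strong, unital, and $1_L1_R=e_T$, the unit of $T$. A solution of the triad $(L,T,R)$ is a quantale $Q$ together with a left action $Q\times R\to R$ making $R$ a $(Q,T)$-bimodule, a right action $L\times Q\to L$ making $L$ a $(T,Q)$-bimodule, and a bimorphism $R\times L\to Q$, $(r,l)\mapsto rl$, such that for all $q\in Q$, $t\in T$, $r,r'\in R$, $l,l'\in L$: $(qr)l=q(rl)$, $(rl)q=r(lq)$, $(rt)l=r(tl)$, $(lq)r=l(qr)$, $(rl)r'=r(lr')$, $(lr)l'=l(rl')$. $Q_0=R\otimes_T L$ is the sup-lattice quotient of the sup-lattice tensor product $R\otimes L$ by the congruence generated by $(rt)\otimes l\sim r\otimes(tl)$, with multiplication $(r\otimes l)(r'\otimes l')=(r(lr'))\otimes l'$. $Q_1$ is the set of pairs $(\alpha,\beta)$ with $\alpha:L\to L$ a left $T$-module morphism, $\beta:R\to R$ a right $T$-module morphism and $\alpha(l)r=l\beta(r)$ for all $l\in L,r\in R$, ordered pointwise, with multiplication $(\alpha,\beta)(\alpha',\beta')=(\alpha'\alpha,\beta\beta')$.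 A solution $Q$ acts on $Q_0$ by $q(r\otimes l)=(qr)\otimes l$, $(r\otimes l)q=r\otimes(lq)$, and on $Q_1$ by left and right multiplication by the element $(l\mapsto lq,\ r\mapsto qr)\in Q_1$. With these actions $\mathcal{L}(Q_0),\mathcal{L}(Q_1)$ are right $Q$-modules (like $L$) and $\mathcal{R}(Q_0),\mathcal{R}(Q_1)$ are left $Q$-modules (like $R$). *)

theory Defs
  imports "HOL-Algebra.Complete_Lattice"
begin

section \<open>Sup-lattices and bimorphisms\<close>

text \<open>
  Sup-lattices are the complete lattices of \<^theory>\<open>HOL-Algebra.Complete_Lattice\<close> (order records
  whose equality is \<open>(=)\<close>).  All conditions on maps and operations are relative to carriers.
  The library's \<^const>\<open>sup_pres\<close> says that both sides are complete lattices and that arbitrary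
  joins, including the empty one, are preserved, but not that carriers are mapped to carriers.
\<close>

definition sup_morphism ::
    "('a, 'x) gorder_scheme \<Rightarrow> ('b, 'y) gorder_scheme \<Rightarrow> ('a \<Rightarrow> 'b) \<Rightarrow> bool" where
  "sup_morphism A B f \<longleftrightarrow> f \<in> carrier A \<rightarrow> carrier B \<and> sup_pres A B f"

definition bimorphism ::
    "('a, 'x) gorder_scheme \<Rightarrow> ('b, 'y) gorder_scheme \<Rightarrow> ('c, 'z) gorder_scheme
      \<Rightarrow> ('a \<Rightarrow> 'b \<Rightarrow> 'c) \<Rightarrow> bool" where
  "bimorphism A B C f \<longleftrightarrow>
     complete_lattice A \<and> complete_lattice B \<and> complete_lattice C \<and>
     (\<forall>a\<in>carrier A. sup_morphism B C (\<lambda>b. f a b)) \<and>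
     (\<forall>b\<in>carrier B. sup_morphism A C (\<lambda>a. f a b))"


section \<open>Quantales\<close>

record 'a quantale = "'a gorder" +
  qmult :: "['a, 'a] \<Rightarrow> 'a" (infixl \<open>\<odot>\<index>\<close> 70)

definition quantale :: "('a, 'x) quantale_scheme \<Rightarrow> bool" where
  "quantale Q \<longleftrightarrow>
     complete_lattice Q \<and> bimorphism Q Q Q (qmult Q) \<and>
     (\<forall>x\<in>carrier Q. \<forall>y\<in>carrier Q. \<forall>z\<in>carrier Q.
        (x \<odot>\<^bsub>Q\<^esub> y) \<odot>\<^bsub>Q\<^esub> z = x \<odot>\<^bsub>Q\<^esub> (y \<odot>\<^bsub>Q\<^esub> z))"

definition is_qunit :: "('a, 'x) quantale_scheme \<Rightarrow> 'a \<Rightarrow> bool" where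
  "is_qunit Q e \<longleftrightarrow>
     e \<in> carrier Q \<and> (\<forall>x\<in>carrier Q. e \<odot>\<^bsub>Q\<^esub> x = x \<and> x \<odot>\<^bsub>Q\<^esub> e = x)"

definition qunit :: "('a, 'x) quantale_scheme \<Rightarrow> 'a" where
  "qunit Q = (THE e. is_qunit Q e)"

definition unital_quantale :: "('a, 'x) quantale_scheme \<Rightarrow> bool" where
  "unital_quantale Q \<longleftrightarrow> quantale Q \<and> (\<exists>e. is_qunit Q e)"

definition strictly_two_sided :: "('a, 'x) quantale_scheme \<Rightarrow> bool" where
  "strictly_two_sided Q \<longleftrightarrow> unital_quantale Q \<and> qunit Q = \<top>\<^bsub>Q\<^esub>"

definition quantale_morphism ::
    "('a, 'x) quantale_scheme \<Rightarrow> ('b, 'y) quantale_scheme \<Rightarrow> ('a \<Rightarrow> 'b) \<Rightarrow> bool" where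
  "quantale_morphism Q Q' f \<longleftrightarrow>
     quantale Q \<and> quantale Q' \<and> sup_morphism Q Q' f \<and>
     (\<forall>x\<in>carrier Q. \<forall>y\<in>carrier Q. f (x \<odot>\<^bsub>Q\<^esub> y) = f x \<odot>\<^bsub>Q'\<^esub> f y)"

definition quantale_isomorphic ::
    "('a, 'x) quantale_scheme \<Rightarrow> ('b, 'y) quantale_scheme \<Rightarrow> bool" where
  "quantale_isomorphic Q Q' \<longleftrightarrow>
     (\<exists>f. quantale_morphism Q Q' f \<and> bij_betw f (carrier Q) (carrier Q'))"

text \<open>
  Right-sided, left-sided and two-sided elements, each as the whole structure restricted to the
  subset in question.
\<close>

definition right_sided :: "('a, 'x) quantale_scheme \<Rightarrow> ('a, 'x) quantale_scheme" where
  "right_sided Q = Q\<lparr>carrier := {q \<in> carrier Q. q \<odot>\<^bsub>Q\<^esub> \<top>\<^bsub>Q\<^esub> \<sqsubseteq>\<^bsub>Q\<^esub> q}\<rparr>"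

definition left_sided :: "('a, 'x) quantale_scheme \<Rightarrow> ('a, 'x) quantale_scheme" where
  "left_sided Q = Q\<lparr>carrier := {q \<in> carrier Q. \<top>\<^bsub>Q\<^esub> \<odot>\<^bsub>Q\<^esub> q \<sqsubseteq>\<^bsub>Q\<^esub> q}\<rparr>"

definition two_sided :: "('a, 'x) quantale_scheme \<Rightarrow> ('a, 'x) quantale_scheme" where
  "two_sided Q = Q\<lparr>carrier := carrier (right_sided Q) \<inter> carrier (left_sided Q)\<rparr>"


section \<open>Modules\<close>

definition left_module ::
    "('q, 'x) quantale_scheme \<Rightarrow> ('m, 'y) gorder_scheme \<Rightarrow> ('q \<Rightarrow> 'm \<Rightarrow> 'm) \<Rightarrow> bool" where
  "left_module Q M act \<longleftrightarrow>
     quantale Q \<and> bimorphism Q M M act \<and>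
     (\<forall>q\<in>carrier Q. \<forall>q'\<in>carrier Q. \<forall>m\<in>carrier M.
        act (q \<odot>\<^bsub>Q\<^esub> q') m = act q (act q' m))"

definition right_module ::
    "('q, 'x) quantale_scheme \<Rightarrow> ('m, 'y) gorder_scheme \<Rightarrow> ('m \<Rightarrow> 'q \<Rightarrow> 'm) \<Rightarrow> bool" where
  "right_module Q M act \<longleftrightarrow>
     quantale Q \<and> bimorphism M Q M act \<and>
     (\<forall>q\<in>carrier Q. \<forall>q'\<in>carrier Q. \<forall>m\<in>carrier M.
        act m (q \<odot>\<^bsub>Q\<^esub> q') = act (act m q) q')"

definition unital_left_module ::
    "('q, 'x) quantale_scheme \<Rightarrow> ('m, 'y) gorder_scheme \<Rightarrow> ('q \<Rightarrow> 'm \<Rightarrow> 'm) \<Rightarrow> bool" where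
  "unital_left_module Q M act \<longleftrightarrow>
     left_module Q M act \<and> unital_quantale Q \<and> (\<forall>m\<in>carrier M. act (qunit Q) m = m)"

definition unital_right_module ::
    "('q, 'x) quantale_scheme \<Rightarrow> ('m, 'y) gorder_scheme \<Rightarrow> ('m \<Rightarrow> 'q \<Rightarrow> 'm) \<Rightarrow> bool" where
  "unital_right_module Q M act \<longleftrightarrow>
     right_module Q M act \<and> unital_quantale Q \<and> (\<forall>m\<in>carrier M. act m (qunit Q) = m)"

definition bimodule ::
    "('p, 'x) quantale_scheme \<Rightarrow> ('m, 'y) gorder_scheme \<Rightarrow> ('q, 'z) quantale_scheme
      \<Rightarrow> ('p \<Rightarrow> 'm \<Rightarrow> 'm) \<Rightarrow> ('m \<Rightarrow> 'q \<Rightarrow> 'm) \<Rightarrow> bool" where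
  "bimodule P M Q lact ract \<longleftrightarrow>
     left_module P M lact \<and> right_module Q M ract \<and>
     (\<forall>p\<in>carrier P. \<forall>m\<in>carrier M. \<forall>q\<in>carrier Q. ract (lact p m) q = lact p (ract m q))"

definition left_module_morphism ::
    "('q, 'x) quantale_scheme \<Rightarrow> ('m, 'y) gorder_scheme \<Rightarrow> ('q \<Rightarrow> 'm \<Rightarrow> 'm)
      \<Rightarrow> ('n, 'z) gorder_scheme \<Rightarrow> ('q \<Rightarrow> 'n \<Rightarrow> 'n) \<Rightarrow> ('m \<Rightarrow> 'n) \<Rightarrow> bool" where
  "left_module_morphism Q M act N act' f \<longleftrightarrow>
     left_module Q M act \<and> left_module Q N act' \<and> sup_morphism M N f \<and>
     (\<forall>q\<in>carrier Q. \<forall>m\<in>carrier M. f (act q m) = act' q (f m))"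

definition right_module_morphism ::
    "('q, 'x) quantale_scheme \<Rightarrow> ('m, 'y) gorder_scheme \<Rightarrow> ('m \<Rightarrow> 'q \<Rightarrow> 'm)
      \<Rightarrow> ('n, 'z) gorder_scheme \<Rightarrow> ('n \<Rightarrow> 'q \<Rightarrow> 'n) \<Rightarrow> ('m \<Rightarrow> 'n) \<Rightarrow> bool" where
  "right_module_morphism Q M act N act' f \<longleftrightarrow>
     right_module Q M act \<and> right_module Q N act' \<and> sup_morphism M N f \<and>
     (\<forall>q\<in>carrier Q. \<forall>m\<in>carrier M. f (act m q) = act' (f m) q)"

definition left_module_isomorphic ::
    "('q, 'x) quantale_scheme \<Rightarrow> ('m, 'y) gorder_scheme \<Rightarrow> ('q \<Rightarrow> 'm \<Rightarrow> 'm)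
      \<Rightarrow> ('n, 'z) gorder_scheme \<Rightarrow> ('q \<Rightarrow> 'n \<Rightarrow> 'n) \<Rightarrow> bool" where
  "left_module_isomorphic Q M act N act' \<longleftrightarrow>
     (\<exists>f. left_module_morphism Q M act N act' f \<and> bij_betw f (carrier M) (carrier N))"

definition right_module_isomorphic ::
    "('q, 'x) quantale_scheme \<Rightarrow> ('m, 'y) gorder_scheme \<Rightarrow> ('m \<Rightarrow> 'q \<Rightarrow> 'm)
      \<Rightarrow> ('n, 'z) gorder_scheme \<Rightarrow> ('n \<Rightarrow> 'q \<Rightarrow> 'n) \<Rightarrow> bool" where
  "right_module_isomorphic Q M act N act' \<longleftrightarrow>
     (\<exists>f. right_module_morphism Q M act N act' f \<and> bij_betw f (carrier M) (carrier N))"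


section \<open>Quantum triads and their solutions\<close>

text \<open>
  The operations are named after the juxtapositions they stand for: \<open>TL D t l\<close> is the product $tl$,
  \<open>RT D r t\<close> is $rt$, \<open>LR D l r\<close> is $lr$; for a solution, \<open>QR S q r\<close> is $qr$, \<open>LQ S l q\<close> is $lq$
  and \<open>RL S r l\<close> is $rl$.
\<close>

record ('l, 't, 'r) triad =
  Lm :: "'l gorder"
  Tq :: "'t quantale"
  Rm :: "'r gorder"
  TL :: "'t \<Rightarrow> 'l \<Rightarrow> 'l"
  RT :: "'r \<Rightarrow> 't \<Rightarrow> 'r"
  LR :: "'l \<Rightarrow> 'r \<Rightarrow> 't"

definition triad :: "('l, 't, 'r) triad \<Rightarrow> bool" where
  "triad D \<longleftrightarrow>
     quantale (Tq D) \<and>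
     right_module (Tq D) (Rm D) (RT D) \<and>
     left_module (Tq D) (Lm D) (TL D) \<and>
     bimorphism (Lm D) (Rm D) (Tq D) (LR D) \<and>
     (\<forall>l\<in>carrier (Lm D). \<forall>r\<in>carrier (Rm D). \<forall>t\<in>carrier (Tq D).
        LR D (TL D t l) r = t \<odot>\<^bsub>Tq D\<^esub> LR D l r \<and>
        LR D l r \<odot>\<^bsub>Tq D\<^esub> t = LR D l (RT D r t))"

definition strong_triad :: "('l, 't, 'r) triad \<Rightarrow> bool" where
  "strong_triad D \<longleftrightarrow>
     (\<forall>l\<in>carrier (Lm D). l \<sqsubseteq>\<^bsub>Lm D\<^esub> TL D (LR D l \<top>\<^bsub>Rm D\<^esub>) \<top>\<^bsub>Lm D\<^esub>) \<and>
     (\<forall>r\<in>carrier (Rm D). r \<sqsubseteq>\<^bsub>Rm D\<^esub> RT D \<top>\<^bsub>Rm D\<^esub> (LR D \<top>\<^bsub>Lm D\<^esub> r))"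

definition unital_triad :: "('l, 't, 'r) triad \<Rightarrow> bool" where
  "unital_triad D \<longleftrightarrow>
     unital_quantale (Tq D) \<and>
     unital_left_module (Tq D) (Lm D) (TL D) \<and>
     unital_right_module (Tq D) (Rm D) (RT D)"

definition strict_triad :: "('l, 't, 'r) triad \<Rightarrow> bool" where
  "strict_triad D \<longleftrightarrow>
     strong_triad D \<and> unital_triad D \<and> LR D \<top>\<^bsub>Lm D\<^esub> \<top>\<^bsub>Rm D\<^esub> = qunit (Tq D)"

record ('q, 'l, 'r) solution =
  Sq :: "'q quantale"
  QR :: "'q \<Rightarrow> 'r \<Rightarrow> 'r"
  LQ :: "'l \<Rightarrow> 'q \<Rightarrow> 'l"
  RL :: "'r \<Rightarrow> 'l \<Rightarrow> 'q"

definition solution :: "('l, 't, 'r) triad \<Rightarrow> ('q, 'l, 'r) solution \<Rightarrow> bool" where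
  "solution D S \<longleftrightarrow>
     quantale (Sq S) \<and>
     bimodule (Sq S) (Rm D) (Tq D) (QR S) (RT D) \<and>
     bimodule (Tq D) (Lm D) (Sq S) (TL D) (LQ S) \<and>
     bimorphism (Rm D) (Lm D) (Sq S) (RL S) \<and>
     (\<forall>q\<in>carrier (Sq S). \<forall>r\<in>carrier (Rm D). \<forall>l\<in>carrier (Lm D).
        RL S (QR S q r) l = q \<odot>\<^bsub>Sq S\<^esub> RL S r l \<and>
        RL S r l \<odot>\<^bsub>Sq S\<^esub> q = RL S r (LQ S l q) \<and>
        LR D (LQ S l q) r = LR D l (QR S q r)) \<and>
     (\<forall>r\<in>carrier (Rm D). \<forall>t\<in>carrier (Tq D). \<forall>l\<in>carrier (Lm D).
        RL S (RT D r t) l = RL S r (TL D t l)) \<and>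
     (\<forall>r\<in>carrier (Rm D). \<forall>r'\<in>carrier (Rm D). \<forall>l\<in>carrier (Lm D).
        QR S (RL S r l) r' = RT D r (LR D l r')) \<and>
     (\<forall>l\<in>carrier (Lm D). \<forall>l'\<in>carrier (Lm D). \<forall>r\<in>carrier (Rm D).
        TL D (LR D l r) l' = LQ S l (RL S r l'))"


section \<open>Quotients and tensor products of sup-lattices\<close>

definition sup_congruence :: "('a, 'x) gorder_scheme \<Rightarrow> ('a \<times> 'a) set \<Rightarrow> bool" where
  "sup_congruence A \<theta> \<longleftrightarrow>
     equiv (carrier A) \<theta> \<and> (\<forall>P\<subseteq>\<theta>. (\<Squnion>\<^bsub>A\<^esub>(fst ` P), \<Squnion>\<^bsub>A\<^esub>(snd ` P)) \<in> \<theta>)"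

definition congruence_generated ::
    "('a, 'x) gorder_scheme \<Rightarrow> ('a \<times> 'a) set \<Rightarrow> ('a \<times> 'a) set" where
  "congruence_generated A G = \<Inter>{\<theta>. sup_congruence A \<theta> \<and> G \<subseteq> \<theta>}"

text \<open>
  In the quotient, $[x] \le [y]$ means $[x \vee y] = [y]$; as $x \le x \vee y$, this holds iff some
  representative of the first class lies below some representative of the second.
\<close>

definition sup_quotient :: "('a, 'x) gorder_scheme \<Rightarrow> ('a \<times> 'a) set \<Rightarrow> 'a set gorder" where
  "sup_quotient A \<theta> =
     \<lparr>carrier = carrier A // \<theta>, eq = (=), le = (\<lambda>X Y. \<exists>x\<in>X. \<exists>y\<in>Y. x \<sqsubseteq>\<^bsub>A\<^esub> y)\<rparr>"

text \<open>
  The tensor product is the free sup-lattice on the product of the carriers, i.e. its power set,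
  modulo the congruence making $(a, b) \mapsto a \otimes b$ preserve joins in each variable.
\<close>

definition powerset_lattice :: "'a set \<Rightarrow> 'a set gorder" where
  "powerset_lattice X = \<lparr>carrier = Pow X, eq = (=), le = (\<subseteq>)\<rparr>"

definition tensor_congruence ::
    "('a, 'x) gorder_scheme \<Rightarrow> ('b, 'y) gorder_scheme \<Rightarrow> (('a \<times> 'b) set \<times> ('a \<times> 'b) set) set" where
  "tensor_congruence A B =
     congruence_generated (powerset_lattice (carrier A \<times> carrier B))
       ({({(\<Squnion>\<^bsub>A\<^esub>X, b)}, X \<times> {b}) | X b. X \<subseteq> carrier A \<and> b \<in> carrier B} \<union>
        {({(a, \<Squnion>\<^bsub>B\<^esub>Y)}, {a} \<times> Y) | a Y. a \<in> carrier A \<and> Y \<subseteq> carrier B})"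

definition tensor ::
    "('a, 'x) gorder_scheme \<Rightarrow> ('b, 'y) gorder_scheme \<Rightarrow> ('a \<times> 'b) set set gorder" where
  "tensor A B = sup_quotient (powerset_lattice (carrier A \<times> carrier B)) (tensor_congruence A B)"

definition pure_tensor ::
    "('a, 'x) gorder_scheme \<Rightarrow> ('b, 'y) gorder_scheme \<Rightarrow> 'a \<Rightarrow> 'b \<Rightarrow> ('a \<times> 'b) set set" where
  "pure_tensor A B a b = tensor_congruence A B `` {{(a, b)}}"


section \<open>The quantales $Q_0$ and $Q_1$\<close>

definition balanced_congruence ::
    "('l, 't, 'r) triad \<Rightarrow> (('r \<times> 'l) set set \<times> ('r \<times> 'l) set set) set" where
  "balanced_congruence D =
     congruence_generated (tensor (Rm D) (Lm D))
       {(pure_tensor (Rm D) (Lm D) (RT D r t) l, pure_tensor (Rm D) (Lm D) r (TL D t l)) | r t l.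
          r \<in> carrier (Rm D) \<and> t \<in> carrier (Tq D) \<and> l \<in> carrier (Lm D)}"

definition RtensorL :: "('l, 't, 'r) triad \<Rightarrow> ('r \<times> 'l) set set set gorder" where
  "RtensorL D = sup_quotient (tensor (Rm D) (Lm D)) (balanced_congruence D)"

text \<open>The generator $r \otimes l$ of $R \otimes_T L$.\<close>

definition ten :: "('l, 't, 'r) triad \<Rightarrow> 'r \<Rightarrow> 'l \<Rightarrow> ('r \<times> 'l) set set set" where
  "ten D r l = balanced_congruence D `` {pure_tensor (Rm D) (Lm D) r l}"

text \<open>
  Operations on $R \otimes_T L$ are prescribed on generators and extended by joins.  Every element
  is the join of the generators below it, so a join-preserving extension must have the values
  used here and in the two actions on $Q_0$ further down.
\<close>

definition Q0 :: "('l, 't, 'r) triad \<Rightarrow> ('r \<times> 'l) set set set quantale" where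
  "Q0 D =
     \<lparr>carrier = carrier (RtensorL D), eq = (=), le = le (RtensorL D),
      qmult = (\<lambda>x y. \<Squnion>\<^bsub>RtensorL D\<^esub>
        {ten D (RT D r (LR D l r')) l' | r l r' l'.
           r \<in> carrier (Rm D) \<and> l \<in> carrier (Lm D) \<and> ten D r l \<sqsubseteq>\<^bsub>RtensorL D\<^esub> x \<and>
           r' \<in> carrier (Rm D) \<and> l' \<in> carrier (Lm D) \<and> ten D r' l' \<sqsubseteq>\<^bsub>RtensorL D\<^esub> y})\<rparr>"

text \<open>
  The components of an element of $Q_1$ are functions on the carriers, hence taken to be
  extensional outside them; \<^const>\<open>compose\<close> is composition of such functions.
\<close>

definition Q1 :: "('l, 't, 'r) triad \<Rightarrow> (('l \<Rightarrow> 'l) \<times> ('r \<Rightarrow> 'r)) quantale" where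
  "Q1 D =
     \<lparr>carrier = {(\<alpha>, \<beta>).
        \<alpha> \<in> extensional (carrier (Lm D)) \<and> \<beta> \<in> extensional (carrier (Rm D)) \<and>
        left_module_morphism (Tq D) (Lm D) (TL D) (Lm D) (TL D) \<alpha> \<and>
        right_module_morphism (Tq D) (Rm D) (RT D) (Rm D) (RT D) \<beta> \<and>
        (\<forall>l\<in>carrier (Lm D). \<forall>r\<in>carrier (Rm D). LR D (\<alpha> l) r = LR D l (\<beta> r))},
      eq = (=),
      le = (\<lambda>(\<alpha>, \<beta>) (\<alpha>', \<beta>').
        (\<forall>l\<in>carrier (Lm D). \<alpha> l \<sqsubseteq>\<^bsub>Lm D\<^esub> \<alpha>' l) \<and> (\<forall>r\<in>carrier (Rm D). \<beta> r \<sqsubseteq>\<^bsub>Rm D\<^esub> \<beta>' r)),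
      qmult = (\<lambda>(\<alpha>, \<beta>) (\<alpha>', \<beta>').
        (compose (carrier (Lm D)) \<alpha>' \<alpha>, compose (carrier (Rm D)) \<beta> \<beta>'))\<rparr>"

text \<open>
  Being the quantale morphism $Q_0 \to Q_1$ determined by
  $r \otimes l \mapsto (l' \mapsto (l'r)l,\ r' \mapsto r(lr'))$.
\<close>

definition canonical_morphism ::
    "('l, 't, 'r) triad \<Rightarrow> (('r \<times> 'l) set set set \<Rightarrow> ('l \<Rightarrow> 'l) \<times> ('r \<Rightarrow> 'r)) \<Rightarrow> bool" where
  "canonical_morphism D \<phi> \<longleftrightarrow>
     \<phi> \<in> extensional (carrier (Q0 D)) \<and> quantale_morphism (Q0 D) (Q1 D) \<phi> \<and>
     (\<forall>r\<in>carrier (Rm D). \<forall>l\<in>carrier (Lm D).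
        \<phi> (ten D r l) =
          (\<lambda>l'\<in>carrier (Lm D). TL D (LR D l' r) l, \<lambda>r'\<in>carrier (Rm D). RT D r (LR D l r')))"

definition strong_morphism ::
    "('a, 'x) quantale_scheme \<Rightarrow> ('b, 'y) quantale_scheme \<Rightarrow> ('a \<Rightarrow> 'b) \<Rightarrow> bool" where
  "strong_morphism Q Q' f \<longleftrightarrow> quantale_morphism Q Q' f \<and> f \<top>\<^bsub>Q\<^esub> = \<top>\<^bsub>Q'\<^esub>"


section \<open>Actions of a solution on $Q_0$ and $Q_1$\<close>

definition Q0_lact :: "('l, 't, 'r) triad \<Rightarrow> ('q, 'l, 'r) solution
      \<Rightarrow> 'q \<Rightarrow> ('r \<times> 'l) set set set \<Rightarrow> ('r \<times> 'l) set set set" where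
  "Q0_lact D S q x = \<Squnion>\<^bsub>Q0 D\<^esub>
     {ten D (QR S q r) l | r l.
        r \<in> carrier (Rm D) \<and> l \<in> carrier (Lm D) \<and> ten D r l \<sqsubseteq>\<^bsub>Q0 D\<^esub> x}"

definition Q0_ract :: "('l, 't, 'r) triad \<Rightarrow> ('q, 'l, 'r) solution
      \<Rightarrow> ('r \<times> 'l) set set set \<Rightarrow> 'q \<Rightarrow> ('r \<times> 'l) set set set" where
  "Q0_ract D S x q = \<Squnion>\<^bsub>Q0 D\<^esub>
     {ten D r (LQ S l q) | r l.
        r \<in> carrier (Rm D) \<and> l \<in> carrier (Lm D) \<and> ten D r l \<sqsubseteq>\<^bsub>Q0 D\<^esub> x}"

definition Q1_elem ::
    "('l, 't, 'r) triad \<Rightarrow> ('q, 'l, 'r) solution \<Rightarrow> 'q \<Rightarrow> ('l \<Rightarrow> 'l) \<times> ('r \<Rightarrow> 'r)" where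
  "Q1_elem D S q = (\<lambda>l\<in>carrier (Lm D). LQ S l q, \<lambda>r\<in>carrier (Rm D). QR S q r)"

definition Q1_lact :: "('l, 't, 'r) triad \<Rightarrow> ('q, 'l, 'r) solution
      \<Rightarrow> 'q \<Rightarrow> ('l \<Rightarrow> 'l) \<times> ('r \<Rightarrow> 'r) \<Rightarrow> ('l \<Rightarrow> 'l) \<times> ('r \<Rightarrow> 'r)" where
  "Q1_lact D S q x = Q1_elem D S q \<odot>\<^bsub>Q1 D\<^esub> x"

definition Q1_ract :: "('l, 't, 'r) triad \<Rightarrow> ('q, 'l, 'r) solution
      \<Rightarrow> ('l \<Rightarrow> 'l) \<times> ('r \<Rightarrow> 'r) \<Rightarrow> 'q \<Rightarrow> ('l \<Rightarrow> 'l) \<times> ('r \<Rightarrow> 'r)" where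
  "Q1_ract D S x q = x \<odot>\<^bsub>Q1 D\<^esub> Q1_elem D S q"

end

theory Submission
  imports Defs
begin

text \<open>
  The top element of $Q_0$ is $1_R \otimes 1_L$.  In a strong triad its image under $\phi$ dominates
  every $(\alpha, \beta) \in Q_1$, because
  $\alpha(l) \le \alpha((l1_R)1_L) = (l1_R)\alpha(1_L) \le (l1_R)1_L$ and dually for $\beta$; conversely,
  if that image is the top, it dominates the identity of $Q_1$, which is exactly strongness.

  In a strict triad, left-sidedness of $x$ means $1x = x$.  Since
  $(1_R \otimes 1_L)(r \otimes l) = 1_R \otimes (1_Lr)l$, the left-sided elements of $Q_0$ are the
  $1_R \otimes l$; likewise $1(\alpha, \beta) = \phi(1_R \otimes \alpha(1_L))$ in $Q_1$.  The element $l$ is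
  recovered by evaluating the first component at $1_L$, as $(1_L1_R)l = l$, so $L$ is order-isomorphic
  to both.  The right-sided case is dual, and the two-sided elements are the $1_Rt \otimes 1_L$.
  These order isomorphisms carry the actions and products of one side to those of the other.
\<close>

section \<open>Sup-lattices\<close>

text \<open>The obstacle is that \<open>Q0 D\<close> is a quotient of a quotient of a power set,
  while its product and the actions on it are explicit joins over the generators below an element.
  Neither preservation of joins nor the value on a generator can be read off such a join. Both come
  from uniqueness: a balanced bimorphism induces some join-preserving map by the universal property,
  and any such map must be given by the explicit join, because every element is the join of the
  generators below it. For the same reason identities in \<open>Q0 D\<close> are checked on
  generators, one variable at a time. The order of \<open>Q0 D\<close> is equally opaque, since an
  inequality between classes only speaks of some representatives; it is reflected by passing to
  \<open>Q1 D\<close> along \<open>phi\<close> and evaluating there. That the sided elements form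
  complete lattices, that the actions stay inside them, and that the module and quantale axioms hold
  there are never checked directly: all of it is transported from $L$, $R$ and $T$ along order
  isomorphisms.\<close>

lemma sup_eqI:
  assumes "complete_lattice A" "X \<subseteq> carrier A" "s \<in> carrier A"
    and "\<And>x. x \<in> X \<Longrightarrow> x \<sqsubseteq>\<^bsub>A\<^esub> s"
    and "\<And>u. \<lbrakk>u \<in> carrier A; \<And>x. x \<in> X \<Longrightarrow> x \<sqsubseteq>\<^bsub>A\<^esub> u\<rbrakk> \<Longrightarrow> s \<sqsubseteq>\<^bsub>A\<^esub> u"
  shows "\<Squnion>\<^bsub>A\<^esub>X = s"
proof -
  interpret complete_lattice A by fact
  show ?thesis
  proof (rule le_antisym)
    show "s \<sqsubseteq>\<^bsub>A\<^esub> \<Squnion>\<^bsub>A\<^esub>X"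
      using assms by (simp add: sup_upper)
  qed (use assms in \<open>auto intro: sup_least\<close>)
qed

text \<open>Meets come from joins: the infimum of a set is the supremum of its lower bounds, so a
  construction of joins is all that has to be supplied.\<close>

lemma complete_latticeI_sups:
  assumes eq: "eq A = (=)"
    and refl: "\<And>x. x \<in> carrier A \<Longrightarrow> x \<sqsubseteq>\<^bsub>A\<^esub> x"
    and antisym: "\<And>x y. \<lbrakk>x \<in> carrier A; y \<in> carrier A; x \<sqsubseteq>\<^bsub>A\<^esub> y; y \<sqsubseteq>\<^bsub>A\<^esub> x\<rbrakk> \<Longrightarrow> x = y"
    and trans: "\<And>x y z. \<lbrakk>x \<in> carrier A; y \<in> carrier A; z \<in> carrier A; x \<sqsubseteq>\<^bsub>A\<^esub> y; y \<sqsubseteq>\<^bsub>A\<^esub> z\<rbrakk>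
      \<Longrightarrow> x \<sqsubseteq>\<^bsub>A\<^esub> z"
    and sups: "\<And>X. X \<subseteq> carrier A \<Longrightarrow> \<exists>s\<in>carrier A. (\<forall>x\<in>X. x \<sqsubseteq>\<^bsub>A\<^esub> s) \<and>
      (\<forall>u\<in>carrier A. (\<forall>x\<in>X. x \<sqsubseteq>\<^bsub>A\<^esub> u) \<longrightarrow> s \<sqsubseteq>\<^bsub>A\<^esub> u)"
  shows "complete_lattice A"
proof -
  interpret partial_order A
    by unfold_locales (auto simp: eq intro: refl antisym trans)
  show ?thesis
  proof (rule complete_latticeI)
    fix X assume X: "X \<subseteq> carrier A"
    from sups[OF X] show "\<exists>s. least A s (Upper A X)"
      using X by (auto simp: least_def Upper_def subset_iff)
    have "Lower A X \<subseteq> carrier A" by auto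
    from sups[OF this] obtain s where s: "s \<in> carrier A" "\<forall>x\<in>Lower A X. x \<sqsubseteq>\<^bsub>A\<^esub> s"
      "\<forall>u\<in>carrier A. (\<forall>x\<in>Lower A X. x \<sqsubseteq>\<^bsub>A\<^esub> u) \<longrightarrow> s \<sqsubseteq>\<^bsub>A\<^esub> u"
      by auto
    then have "greatest A s (Lower A X)"
      using X by (auto simp: greatest_def Lower_def)
    then show "\<exists>i. greatest A i (Lower A X)" ..
  qed
qed

lemma sup_morphismD:
  assumes "sup_morphism A B f"
  shows "complete_lattice A" "complete_lattice B" "\<And>x. x \<in> carrier A \<Longrightarrow> f x \<in> carrier B"
    "\<And>X. X \<subseteq> carrier A \<Longrightarrow> f (\<Squnion>\<^bsub>A\<^esub>X) = \<Squnion>\<^bsub>B\<^esub>(f ` X)"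
  using assms by (auto simp: sup_morphism_def sup_pres_def)

lemma sup_morphismI:
  assumes "complete_lattice A" "complete_lattice B" "\<And>x. x \<in> carrier A \<Longrightarrow> f x \<in> carrier B"
    "\<And>X. X \<subseteq> carrier A \<Longrightarrow> f (\<Squnion>\<^bsub>A\<^esub>X) = \<Squnion>\<^bsub>B\<^esub>(f ` X)"
  shows "sup_morphism A B f"
  using assms by (auto simp: sup_morphism_def sup_pres_def)

lemma sup_morphism_mono:
  assumes f: "sup_morphism A B f" and xy: "x \<in> carrier A" "y \<in> carrier A" "x \<sqsubseteq>\<^bsub>A\<^esub> y"
  shows "f x \<sqsubseteq>\<^bsub>B\<^esub> f y"
proof -
  note f' = sup_morphismD[OF f]
  interpret A: complete_lattice A by (rule f')
  interpret B: complete_lattice B by (rule f')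
  have "\<Squnion>\<^bsub>A\<^esub>{x, y} = y"
    using xy by (intro sup_eqI f'(1)) auto
  then have "f y = \<Squnion>\<^bsub>B\<^esub>{f x, f y}"
    using f'(4)[of "{x, y}"] xy by simp
  then show ?thesis
    using B.sup_upper[of "{f x, f y}" "f x"] f'(3) xy by simp
qed

lemma sup_morphism_id: "complete_lattice A \<Longrightarrow> sup_morphism A A (\<lambda>x. x)"
  by (simp add: sup_morphismI)

lemma sup_morphism_comp:
  assumes f: "sup_morphism A B f" and g: "sup_morphism B C g"
  shows "sup_morphism A C (\<lambda>x. g (f x))"
proof (rule sup_morphismI)
  fix X assume X: "X \<subseteq> carrier A"
  then have "f ` X \<subseteq> carrier B" using sup_morphismD[OF f] by auto
  then show "g (f (\<Squnion>\<^bsub>A\<^esub>X)) = \<Squnion>\<^bsub>C\<^esub>((\<lambda>x. g (f x)) ` X)"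
    using sup_morphismD(4)[OF f X] sup_morphismD(4)[OF g] by (simp add: image_image)
qed (use sup_morphismD[OF f] sup_morphismD[OF g] in auto)

text \<open>Serves maps given by a formula that is valid on the carrier only, such as the
  extensional components of elements of \<open>Q1 D\<close>.\<close>

lemma sup_morphism_cong:
  assumes f: "sup_morphism A B f" and eq: "\<And>x. x \<in> carrier A \<Longrightarrow> f x = g x"
  shows "sup_morphism A B g"
proof (rule sup_morphismI)
  note f' = sup_morphismD[OF f]
  interpret A: complete_lattice A by (rule f')
  fix X assume X: "X \<subseteq> carrier A"
  then have "f ` X = g ` X" using eq by (auto intro!: image_cong)
  then show "g (\<Squnion>\<^bsub>A\<^esub>X) = \<Squnion>\<^bsub>B\<^esub>(g ` X)"
    using f'(4)[OF X] X eq[of "\<Squnion>\<^bsub>A\<^esub>X"] by simp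
qed (use sup_morphismD[OF f] eq in auto)

lemma sup_swap:
  assumes B: "complete_lattice B" and F: "\<And>i j. \<lbrakk>i \<in> I; j \<in> J\<rbrakk> \<Longrightarrow> F i j \<in> carrier B"
  shows "\<Squnion>\<^bsub>B\<^esub>((\<lambda>i. \<Squnion>\<^bsub>B\<^esub>(F i ` J)) ` I) = \<Squnion>\<^bsub>B\<^esub>((\<lambda>j. \<Squnion>\<^bsub>B\<^esub>((\<lambda>i. F i j) ` I)) ` J)"
proof -
  interpret complete_lattice B by fact
  \<comment> \<open>One inequality for arbitrary families is enough: the other is its instance with
    the two index sets exchanged.\<close>
  have le: "\<Squnion>\<^bsub>B\<^esub>((\<lambda>i. \<Squnion>\<^bsub>B\<^esub>(G i ` J)) ` I) \<sqsubseteq>\<^bsub>B\<^esub> \<Squnion>\<^bsub>B\<^esub>((\<lambda>j. \<Squnion>\<^bsub>B\<^esub>((\<lambda>i. G i j) ` I)) ` J)"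
    if G: "\<And>i j. \<lbrakk>i \<in> I; j \<in> J\<rbrakk> \<Longrightarrow> G i j \<in> carrier B" for G :: "'x \<Rightarrow> 'y \<Rightarrow> 'a" and I J
  proof -
    let ?S = "\<Squnion>\<^bsub>B\<^esub>((\<lambda>j. \<Squnion>\<^bsub>B\<^esub>((\<lambda>i. G i j) ` I)) ` J)"
    have c1: "\<Squnion>\<^bsub>B\<^esub>((\<lambda>i. G i j) ` I) \<in> carrier B" if "j \<in> J" for j
      using G that by (intro sup_closed) auto
    have c2: "\<Squnion>\<^bsub>B\<^esub>(G i ` J) \<in> carrier B" if "i \<in> I" for i
      using G that by (intro sup_closed) auto
    have c3: "?S \<in> carrier B" using c1 by (intro sup_closed) auto
    have "G i j \<sqsubseteq>\<^bsub>B\<^esub> ?S" if "i \<in> I" "j \<in> J" for i j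
    proof (rule le_trans)
      show "G i j \<sqsubseteq>\<^bsub>B\<^esub> \<Squnion>\<^bsub>B\<^esub>((\<lambda>i. G i j) ` I)"
        using that G by (intro sup_upper) auto
      show "\<Squnion>\<^bsub>B\<^esub>((\<lambda>i. G i j) ` I) \<sqsubseteq>\<^bsub>B\<^esub> ?S"
        using that c1 by (intro sup_upper) auto
    qed (use that G c1 c3 in auto)
    then show ?thesis
      using c2 c3 G by (intro sup_least) (auto intro!: sup_least)
  qed
  have "\<Squnion>\<^bsub>B\<^esub>(F i ` J) \<in> carrier B" if "i \<in> I" for i
    using F that by (intro sup_closed) auto
  moreover have "\<Squnion>\<^bsub>B\<^esub>((\<lambda>i. F i j) ` I) \<in> carrier B" if "j \<in> J" for j
    using F that by (intro sup_closed) auto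
  ultimately show ?thesis
    using le[of I J F] le[of J I "\<lambda>j i. F i j"] F
    by (intro le_antisym sup_closed) auto
qed

text \<open>With it, sending a set to the join of the \<open>f\<close>-values over it preserves
  unions; this is the freeness of the power set used in \<open>tensor_universal\<close>.\<close>

lemma sup_image_Union:
  assumes B: "complete_lattice B" and f: "\<And>x. x \<in> \<Union>\<U> \<Longrightarrow> f x \<in> carrier B"
  shows "\<Squnion>\<^bsub>B\<^esub>(f ` \<Union>\<U>) = \<Squnion>\<^bsub>B\<^esub>((\<lambda>U. \<Squnion>\<^bsub>B\<^esub>(f ` U)) ` \<U>)"
proof -
  interpret complete_lattice B by fact
  have c: "\<Squnion>\<^bsub>B\<^esub>(f ` U) \<in> carrier B" if "U \<in> \<U>" for U
    using f that by (intro sup_closed) auto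
  then have c': "(\<lambda>U. \<Squnion>\<^bsub>B\<^esub>(f ` U)) ` \<U> \<subseteq> carrier B" by auto
  show ?thesis
  proof (rule sup_eqI[OF B])
    fix y assume "y \<in> f ` \<Union>\<U>"
    then obtain x U where U: "U \<in> \<U>" "x \<in> U" "y = f x" by auto
    then have "f x \<sqsubseteq>\<^bsub>B\<^esub> \<Squnion>\<^bsub>B\<^esub>(f ` U)"
      using f by (intro sup_upper) auto
    moreover have "\<Squnion>\<^bsub>B\<^esub>(f ` U) \<sqsubseteq>\<^bsub>B\<^esub> \<Squnion>\<^bsub>B\<^esub>((\<lambda>U. \<Squnion>\<^bsub>B\<^esub>(f ` U)) ` \<U>)"
      using U c' by (intro sup_upper) auto
    ultimately show "y \<sqsubseteq>\<^bsub>B\<^esub> \<Squnion>\<^bsub>B\<^esub>((\<lambda>U. \<Squnion>\<^bsub>B\<^esub>(f ` U)) ` \<U>)"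
      unfolding U(3) by (rule le_trans) (use U f c sup_closed[OF c'] in blast)+
  next
    fix u assume u: "u \<in> carrier B" "\<And>y. y \<in> f ` \<Union>\<U> \<Longrightarrow> y \<sqsubseteq>\<^bsub>B\<^esub> u"
    then have "\<Squnion>\<^bsub>B\<^esub>(f ` U) \<sqsubseteq>\<^bsub>B\<^esub> u" if "U \<in> \<U>" for U
      using that f by (intro sup_least) blast+
    then show "\<Squnion>\<^bsub>B\<^esub>((\<lambda>U. \<Squnion>\<^bsub>B\<^esub>(f ` U)) ` \<U>) \<sqsubseteq>\<^bsub>B\<^esub> u"
      using u c' by (intro sup_least) auto
  qed (use f c' in auto)
qed

lemma sup_image_Times:
  assumes B: "complete_lattice B" and f: "\<And>i j. \<lbrakk>i \<in> I; j \<in> J\<rbrakk> \<Longrightarrow> f i j \<in> carrier B"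
  shows "\<Squnion>\<^bsub>B\<^esub>((\<lambda>(i, j). f i j) ` (I \<times> J)) = \<Squnion>\<^bsub>B\<^esub>((\<lambda>i. \<Squnion>\<^bsub>B\<^esub>(f i ` J)) ` I)"
proof -
  have "I \<times> J = \<Union>((\<lambda>i. {i} \<times> J) ` I)" by auto
  moreover have "(\<lambda>(i, j). f i j) ` ({i} \<times> J) = f i ` J" for i by force
  ultimately show ?thesis
    using sup_image_Union[OF B, of "(\<lambda>i. {i} \<times> J) ` I" "\<lambda>(i, j). f i j"] f
    by (auto simp: image_image)
qed

text \<open>Joins commute with joins, as in \<open>sup_swap\<close>; hence pointwise joins inherit
  preservation of joins.\<close>

lemma sup_morphism_pointwise_sup:
  assumes A: "complete_lattice A" and B: "complete_lattice B"
    and F: "\<And>i. i \<in> I \<Longrightarrow> sup_morphism A B (F i)"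
  shows "sup_morphism A B (\<lambda>a. \<Squnion>\<^bsub>B\<^esub>((\<lambda>i. F i a) ` I))"
proof (rule sup_morphismI[OF A B])
  interpret A: complete_lattice A by fact
  interpret B: complete_lattice B by fact
  show "\<Squnion>\<^bsub>B\<^esub>((\<lambda>i. F i x) ` I) \<in> carrier B" if "x \<in> carrier A" for x
    using sup_morphismD(3)[OF F that] by (intro B.sup_closed) auto
  fix X assume X: "X \<subseteq> carrier A"
  have "(\<lambda>i. F i (\<Squnion>\<^bsub>A\<^esub>X)) ` I = (\<lambda>i. \<Squnion>\<^bsub>B\<^esub>(F i ` X)) ` I"
    using sup_morphismD(4)[OF F X] by (intro image_cong) auto
  moreover have "\<Squnion>\<^bsub>B\<^esub>((\<lambda>i. \<Squnion>\<^bsub>B\<^esub>(F i ` X)) ` I) = \<Squnion>\<^bsub>B\<^esub>((\<lambda>a. \<Squnion>\<^bsub>B\<^esub>((\<lambda>i. F i a) ` I)) ` X)"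
    by (rule sup_swap[OF B, of I X F], rule sup_morphismD(3)[OF F]) (use X in auto)
  ultimately show "\<Squnion>\<^bsub>B\<^esub>((\<lambda>i. F i (\<Squnion>\<^bsub>A\<^esub>X)) ` I) = \<Squnion>\<^bsub>B\<^esub>((\<lambda>a. \<Squnion>\<^bsub>B\<^esub>((\<lambda>i. F i a) ` I)) ` X)"
    by simp
qed

text \<open>Least upper bounds are determined by the order alone, so a bijection that preserves and
  reflects it carries them over. Completeness of \<open>B\<close> is a conclusion here: in the main
  applications \<open>B\<close> consists of sided elements, about which only the order is
  known.\<close>

lemma order_iso_complete_lattice:
  assumes A: "complete_lattice A" and eq: "eq B = (=)"
    and bij: "bij_betw f (carrier A) (carrier B)"
    and le: "\<And>x y. \<lbrakk>x \<in> carrier A; y \<in> carrier A\<rbrakk> \<Longrightarrow> f x \<sqsubseteq>\<^bsub>B\<^esub> f y \<longleftrightarrow> x \<sqsubseteq>\<^bsub>A\<^esub> y"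
  shows "complete_lattice B" "sup_morphism A B f"
proof -
  interpret A: complete_lattice A by fact
  have im: "carrier B = f ` carrier A" using bij by (simp add: bij_betw_def)
  have lub: "f (\<Squnion>\<^bsub>A\<^esub>X) \<in> carrier B \<and> (\<forall>x\<in>f ` X. x \<sqsubseteq>\<^bsub>B\<^esub> f (\<Squnion>\<^bsub>A\<^esub>X)) \<and>
      (\<forall>u\<in>carrier B. (\<forall>x\<in>f ` X. x \<sqsubseteq>\<^bsub>B\<^esub> u) \<longrightarrow> f (\<Squnion>\<^bsub>A\<^esub>X) \<sqsubseteq>\<^bsub>B\<^esub> u)" if "X \<subseteq> carrier A" for X
    using that by (auto simp: im le subset_iff intro!: A.sup_upper A.sup_least)
  show B: "complete_lattice B"
  proof (rule complete_latticeI_sups)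
    fix Y assume "Y \<subseteq> carrier B"
    then obtain X where "X \<subseteq> carrier A" "Y = f ` X"
      unfolding im by (auto simp: subset_image_iff)
    then show "\<exists>s\<in>carrier B. (\<forall>x\<in>Y. x \<sqsubseteq>\<^bsub>B\<^esub> s) \<and> (\<forall>u\<in>carrier B. (\<forall>x\<in>Y. x \<sqsubseteq>\<^bsub>B\<^esub> u) \<longrightarrow> s \<sqsubseteq>\<^bsub>B\<^esub> u)"
      using lub[of X] by (intro bexI[of _ "f (\<Squnion>\<^bsub>A\<^esub>X)"]) simp_all
  next
    show "x = y" if "x \<in> carrier B" "y \<in> carrier B" "x \<sqsubseteq>\<^bsub>B\<^esub> y" "y \<sqsubseteq>\<^bsub>B\<^esub> x" for x y
      using that A.le_antisym by (auto simp: im le intro!: arg_cong[of _ _ f])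
    show "x \<sqsubseteq>\<^bsub>B\<^esub> z" if "x \<in> carrier B" "y \<in> carrier B" "z \<in> carrier B" "x \<sqsubseteq>\<^bsub>B\<^esub> y" "y \<sqsubseteq>\<^bsub>B\<^esub> z" for x y z
      using that by (auto simp: im le dest: A.le_trans)
  qed (auto simp: im le eq)
  show "sup_morphism A B f"
  proof (rule sup_morphismI[OF A B])
    fix X assume X: "X \<subseteq> carrier A"
    show "f (\<Squnion>\<^bsub>A\<^esub>X) = \<Squnion>\<^bsub>B\<^esub>(f ` X)"
      using lub[OF X] X by (intro sup_eqI[OF B, symmetric]) (auto simp: im)
  qed (auto simp: im)
qed

text \<open>A join-preserving left inverse is monotone, so applying it to $f(x) \<le> f(y)$ gives
  back $x \<le> y$.\<close>

lemma order_embedding_of_retraction: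
  assumes f: "sup_morphism A B f" and g: "sup_morphism B A g"
    and gf: "\<And>x. x \<in> carrier A \<Longrightarrow> g (f x) = x"
  shows "inj_on f (carrier A)"
    and "\<And>x y. \<lbrakk>x \<in> carrier A; y \<in> carrier A\<rbrakk> \<Longrightarrow> f x \<sqsubseteq>\<^bsub>B\<^esub> f y \<longleftrightarrow> x \<sqsubseteq>\<^bsub>A\<^esub> y"
proof -
  show "inj_on f (carrier A)" using gf by (rule inj_on_inverseI)
  fix x y assume c: "x \<in> carrier A" "y \<in> carrier A"
  have "x \<sqsubseteq>\<^bsub>A\<^esub> y" if "f x \<sqsubseteq>\<^bsub>B\<^esub> f y"
    using sup_morphism_mono[OF g _ _ that] c gf sup_morphismD(3)[OF f] by simp
  then show "f x \<sqsubseteq>\<^bsub>B\<^esub> f y \<longleftrightarrow> x \<sqsubseteq>\<^bsub>A\<^esub> y"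
    using sup_morphism_mono[OF f c] by blast
qed

lemma sup_morphism_inv_into:
  assumes f: "sup_morphism A B f" and bij: "bij_betw f (carrier A) (carrier B)"
  shows "sup_morphism B A (inv_into (carrier A) f)"
proof (rule sup_morphismI)
  note f' = sup_morphismD[OF f]
  interpret A: complete_lattice A by (rule f')
  let ?g = "inv_into (carrier A) f"
  show "complete_lattice A" "complete_lattice B" by (rule f')+
  show "?g x \<in> carrier A" if "x \<in> carrier B" for x
    using that bij by (auto simp: bij_betw_def intro: inv_into_into)
  fix Y assume "Y \<subseteq> carrier B"
  then obtain X where X: "X \<subseteq> carrier A" "Y = f ` X"
    using bij by (metis bij_betw_imp_surj_on subset_imageE)
  have inv: "?g (f x) = x" if "x \<in> carrier A" for x
    using that bij by (auto simp: bij_betw_def)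
  have "?g ` Y = X" using X bij by (simp add: bij_betw_def inv_into_image_cancel)
  moreover have "?g (\<Squnion>\<^bsub>B\<^esub>Y) = \<Squnion>\<^bsub>A\<^esub>X"
    using f'(4)[OF X(1)] X inv[of "\<Squnion>\<^bsub>A\<^esub>X"] by simp
  ultimately show "?g (\<Squnion>\<^bsub>B\<^esub>Y) = \<Squnion>\<^bsub>A\<^esub>(?g ` Y)" by simp
qed

section \<open>Bimorphisms\<close>

lemma bimorphismD:
  assumes "bimorphism A B C f"
  shows "complete_lattice A" "complete_lattice B" "complete_lattice C"
    "\<And>a. a \<in> carrier A \<Longrightarrow> sup_morphism B C (f a)"
    "\<And>b. b \<in> carrier B \<Longrightarrow> sup_morphism A C (\<lambda>a. f a b)"
    "\<And>a b. \<lbrakk>a \<in> carrier A; b \<in> carrier B\<rbrakk> \<Longrightarrow> f a b \<in> carrier C"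
  using assms by (auto simp: bimorphism_def dest: sup_morphismD(3))

lemma bimorphism_mono:
  assumes f: "bimorphism A B C f"
    and a: "a \<in> carrier A" "a' \<in> carrier A" "a \<sqsubseteq>\<^bsub>A\<^esub> a'"
    and b: "b \<in> carrier B" "b' \<in> carrier B" "b \<sqsubseteq>\<^bsub>B\<^esub> b'"
  shows "f a b \<sqsubseteq>\<^bsub>C\<^esub> f a' b'"
proof -
  interpret complete_lattice C by (rule bimorphismD[OF f])
  show ?thesis
    using sup_morphism_mono[OF bimorphismD(4)[OF f a(1)] b]
      sup_morphism_mono[OF bimorphismD(5)[OF f b(2)] a] a b bimorphismD(6)[OF f]
    by (meson le_trans)
qed

text \<open>Covers two uses at once: conjugation by an isomorphism, with its inverse in the
  arguments and the isomorphism itself as \<open>c\<close>, and composition with a quotient map,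
  with identities as \<open>a\<close> and \<open>b\<close>.\<close>

lemma bimorphism_transport:
  assumes f: "bimorphism A B C f"
    and a: "sup_morphism A' A a" and b: "sup_morphism B' B b" and c: "sup_morphism C C' c"
    and g: "\<And>x y. \<lbrakk>x \<in> carrier A'; y \<in> carrier B'\<rbrakk> \<Longrightarrow> g x y = c (f (a x) (b y))"
  shows "bimorphism A' B' C' g"
  unfolding bimorphism_def
proof (intro conjI ballI)
  fix x assume x: "x \<in> carrier A'"
  show "sup_morphism B' C' (g x)"
    by (rule sup_morphism_cong[OF sup_morphism_comp[OF sup_morphism_comp[OF b
            bimorphismD(4)[OF f sup_morphismD(3)[OF a x]]] c]]) (simp add: g x)
next
  fix y assume y: "y \<in> carrier B'"
  show "sup_morphism A' C' (\<lambda>x. g x y)"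
    by (rule sup_morphism_cong[OF sup_morphism_comp[OF sup_morphism_comp[OF a
            bimorphismD(5)[OF f sup_morphismD(3)[OF b y]]] c]]) (simp add: g y)
qed (use sup_morphismD[OF a] sup_morphismD[OF b] sup_morphismD[OF c] in auto)

lemma quantale_mult_closed:
  "\<lbrakk>quantale Q; x \<in> carrier Q; y \<in> carrier Q\<rbrakk> \<Longrightarrow> x \<odot>\<^bsub>Q\<^esub> y \<in> carrier Q"
  by (auto simp: quantale_def dest: bimorphismD(6))

section \<open>Transport of structure along isomorphisms\<close>

text \<open>The action on \<open>N\<close> is the conjugate by \<open>f\<close> of the action on
  \<open>M\<close>. Hence completeness of \<open>N\<close>, closure under the action, join
  preservation and the module law are all inherited and none of them is assumed.\<close>

lemma left_module_isomorphic_transport: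
  assumes M: "left_module Q M act" and eq: "eq N = (=)"
    and bij: "bij_betw f (carrier M) (carrier N)"
    and le: "\<And>x y. \<lbrakk>x \<in> carrier M; y \<in> carrier M\<rbrakk> \<Longrightarrow> f x \<sqsubseteq>\<^bsub>N\<^esub> f y \<longleftrightarrow> x \<sqsubseteq>\<^bsub>M\<^esub> y"
    and act: "\<And>q x. \<lbrakk>q \<in> carrier Q; x \<in> carrier M\<rbrakk> \<Longrightarrow> act' q (f x) = f (act q x)"
  shows "left_module_isomorphic Q M act N act'"
proof -
  have bi: "bimorphism Q M M act" using M by (simp add: left_module_def)
  note bi' = bimorphismD[OF bi]
  have f: "sup_morphism M N f" by (rule order_iso_complete_lattice[OF bi'(2) eq bij le])
  have im: "carrier N = f ` carrier M" using bij by (simp add: bij_betw_def)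
  have inv: "inv_into (carrier M) f (f x) = x" if "x \<in> carrier M" for x
    using that bij by (auto simp: bij_betw_def)
  have "bimorphism Q N N act'"
    by (rule bimorphism_transport[OF bi sup_morphism_id[OF bi'(1)] sup_morphism_inv_into[OF f bij] f])
      (auto simp: im act inv)
  then have "left_module Q N act'"
    using M bi'(6) by (simp add: left_module_def im act quantale_mult_closed)
  then show ?thesis
    using M f bij by (auto simp: left_module_isomorphic_def left_module_morphism_def act)
qed

lemma right_module_isomorphic_transport:
  assumes M: "right_module Q M act" and eq: "eq N = (=)"
    and bij: "bij_betw f (carrier M) (carrier N)"
    and le: "\<And>x y. \<lbrakk>x \<in> carrier M; y \<in> carrier M\<rbrakk> \<Longrightarrow> f x \<sqsubseteq>\<^bsub>N\<^esub> f y \<longleftrightarrow> x \<sqsubseteq>\<^bsub>M\<^esub> y"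
    and act: "\<And>q x. \<lbrakk>q \<in> carrier Q; x \<in> carrier M\<rbrakk> \<Longrightarrow> act' (f x) q = f (act x q)"
  shows "right_module_isomorphic Q M act N act'"
proof -
  have bi: "bimorphism M Q M act" using M by (simp add: right_module_def)
  note bi' = bimorphismD[OF bi]
  have f: "sup_morphism M N f" by (rule order_iso_complete_lattice[OF bi'(1) eq bij le])
  have im: "carrier N = f ` carrier M" using bij by (simp add: bij_betw_def)
  have inv: "inv_into (carrier M) f (f x) = x" if "x \<in> carrier M" for x
    using that bij by (auto simp: bij_betw_def)
  have "bimorphism N Q N act'"
    by (rule bimorphism_transport[OF bi sup_morphism_inv_into[OF f bij] sup_morphism_id[OF bi'(2)] f])
      (auto simp: im act inv)
  then have "right_module Q N act'"
    using M bi'(6) by (simp add: right_module_def im act quantale_mult_closed)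
  then show ?thesis
    using M f bij by (auto simp: right_module_isomorphic_def right_module_morphism_def act)
qed

lemma quantale_isomorphic_transport:
  assumes Q: "quantale Q" and eq: "eq Q' = (=)"
    and bij: "bij_betw f (carrier Q) (carrier Q')"
    and le: "\<And>x y. \<lbrakk>x \<in> carrier Q; y \<in> carrier Q\<rbrakk> \<Longrightarrow> f x \<sqsubseteq>\<^bsub>Q'\<^esub> f y \<longleftrightarrow> x \<sqsubseteq>\<^bsub>Q\<^esub> y"
    and mult: "\<And>x y. \<lbrakk>x \<in> carrier Q; y \<in> carrier Q\<rbrakk> \<Longrightarrow> f x \<odot>\<^bsub>Q'\<^esub> f y = f (x \<odot>\<^bsub>Q\<^esub> y)"
  shows "quantale_isomorphic Q Q'"
proof -
  have bi: "bimorphism Q Q Q (qmult Q)" using Q by (simp add: quantale_def)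
  note bi' = bimorphismD[OF bi]
  have f: "sup_morphism Q Q' f" by (rule order_iso_complete_lattice[OF bi'(1) eq bij le])
  have im: "carrier Q' = f ` carrier Q" using bij by (simp add: bij_betw_def)
  have inv: "inv_into (carrier Q) f (f x) = x" if "x \<in> carrier Q" for x
    using that bij by (auto simp: bij_betw_def)
  have "bimorphism Q' Q' Q' (qmult Q')"
    by (rule bimorphism_transport[OF bi sup_morphism_inv_into[OF f bij]
          sup_morphism_inv_into[OF f bij] f]) (auto simp: im mult inv)
  then have "quantale Q'"
    using Q bi'(6) sup_morphismD(2)[OF f] by (auto simp: quantale_def im mult)
  then show ?thesis
    using Q f bij by (auto simp: quantale_isomorphic_def quantale_morphism_def mult)
qed

text \<open>The transport lemmas produce isomorphisms out of $L$, $R$ and $T$; symmetry and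
  transitivity turn two of these into the chain from $Q_0$ through $Q_1$ to the given module or
  quantale.\<close>

lemma left_module_isomorphic_sym:
  assumes "left_module_isomorphic Q M act N act'"
  shows "left_module_isomorphic Q N act' M act"
proof -
  from assms obtain f where f: "left_module_morphism Q M act N act' f"
    and bij: "bij_betw f (carrier M) (carrier N)"
    by (auto simp: left_module_isomorphic_def)
  let ?g = "inv_into (carrier M) f"
  have inv: "?g (f x) = x" if "x \<in> carrier M" for x
    using that bij by (auto simp: bij_betw_def)
  have im: "carrier N = f ` carrier M" using bij by (simp add: bij_betw_def)
  have M: "left_module Q M act" and N: "left_module Q N act'" and f1: "sup_morphism M N f"
    and f2: "\<And>q m. \<lbrakk>q \<in> carrier Q; m \<in> carrier M\<rbrakk> \<Longrightarrow> f (act q m) = act' q (f m)"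
    using f by (auto simp: left_module_morphism_def)
  have "act q m \<in> carrier M" if "q \<in> carrier Q" "m \<in> carrier M" for q m
    using M that bimorphismD(6) by (fastforce simp: left_module_def)
  then have "left_module_morphism Q N act' M act ?g"
    using M N sup_morphism_inv_into[OF f1 bij]
    by (auto simp: left_module_morphism_def im inv f2[symmetric])
  then show ?thesis
    using bij_betw_inv_into[OF bij] by (auto simp: left_module_isomorphic_def)
qed

lemma right_module_isomorphic_sym:
  assumes "right_module_isomorphic Q M act N act'"
  shows "right_module_isomorphic Q N act' M act"
proof -
  from assms obtain f where f: "right_module_morphism Q M act N act' f"
    and bij: "bij_betw f (carrier M) (carrier N)"
    by (auto simp: right_module_isomorphic_def)
  let ?g = "inv_into (carrier M) f"
  have inv: "?g (f x) = x" if "x \<in> carrier M" for x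
    using that bij by (auto simp: bij_betw_def)
  have im: "carrier N = f ` carrier M" using bij by (simp add: bij_betw_def)
  have M: "right_module Q M act" and N: "right_module Q N act'" and f1: "sup_morphism M N f"
    and f2: "\<And>q m. \<lbrakk>q \<in> carrier Q; m \<in> carrier M\<rbrakk> \<Longrightarrow> f (act m q) = act' (f m) q"
    using f by (auto simp: right_module_morphism_def)
  have "act m q \<in> carrier M" if "q \<in> carrier Q" "m \<in> carrier M" for q m
    using M that bimorphismD(6) by (fastforce simp: right_module_def)
  then have "right_module_morphism Q N act' M act ?g"
    using M N sup_morphism_inv_into[OF f1 bij]
    by (auto simp: right_module_morphism_def im inv f2[symmetric])
  then show ?thesis
    using bij_betw_inv_into[OF bij] by (auto simp: right_module_isomorphic_def)
qed

lemma quantale_isomorphic_sym: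
  assumes "quantale_isomorphic Q Q'"
  shows "quantale_isomorphic Q' Q"
proof -
  from assms obtain f where f: "quantale_morphism Q Q' f"
    and bij: "bij_betw f (carrier Q) (carrier Q')"
    by (auto simp: quantale_isomorphic_def)
  let ?g = "inv_into (carrier Q) f"
  have inv: "?g (f x) = x" if "x \<in> carrier Q" for x
    using that bij by (auto simp: bij_betw_def)
  have im: "carrier Q' = f ` carrier Q" using bij by (simp add: bij_betw_def)
  have Q: "quantale Q" and Q': "quantale Q'" and f1: "sup_morphism Q Q' f"
    and f2: "\<And>x y. \<lbrakk>x \<in> carrier Q; y \<in> carrier Q\<rbrakk> \<Longrightarrow> f (x \<odot>\<^bsub>Q\<^esub> y) = f x \<odot>\<^bsub>Q'\<^esub> f y"
    using f by (auto simp: quantale_morphism_def)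
  have "quantale_morphism Q' Q ?g"
    using Q Q' sup_morphism_inv_into[OF f1 bij]
    by (auto simp: quantale_morphism_def im inv f2[symmetric] quantale_mult_closed)
  then show ?thesis
    using bij_betw_inv_into[OF bij] by (auto simp: quantale_isomorphic_def)
qed

lemma left_module_isomorphic_trans:
  assumes "left_module_isomorphic Q M act N act'" "left_module_isomorphic Q N act' P act''"
  shows "left_module_isomorphic Q M act P act''"
proof -
  from assms obtain f g where
    f: "left_module_morphism Q M act N act' f" "bij_betw f (carrier M) (carrier N)" and
    g: "left_module_morphism Q N act' P act'' g" "bij_betw g (carrier N) (carrier P)"
    by (auto simp: left_module_isomorphic_def)
  have "left_module_morphism Q M act P act'' (\<lambda>x. g (f x))"
    using f(1) g(1) sup_morphismD(3)[of M N f]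
    by (auto simp: left_module_morphism_def intro: sup_morphism_comp)
  then show ?thesis
    using bij_betw_trans[OF f(2) g(2)] by (auto simp: left_module_isomorphic_def comp_def)
qed

lemma right_module_isomorphic_trans:
  assumes "right_module_isomorphic Q M act N act'" "right_module_isomorphic Q N act' P act''"
  shows "right_module_isomorphic Q M act P act''"
proof -
  from assms obtain f g where
    f: "right_module_morphism Q M act N act' f" "bij_betw f (carrier M) (carrier N)" and
    g: "right_module_morphism Q N act' P act'' g" "bij_betw g (carrier N) (carrier P)"
    by (auto simp: right_module_isomorphic_def)
  have "right_module_morphism Q M act P act'' (\<lambda>x. g (f x))"
    using f(1) g(1) sup_morphismD(3)[of M N f]
    by (auto simp: right_module_morphism_def intro: sup_morphism_comp)
  then show ?thesis
    using bij_betw_trans[OF f(2) g(2)] by (auto simp: right_module_isomorphic_def comp_def)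
qed

lemma quantale_isomorphic_trans:
  assumes "quantale_isomorphic Q Q'" "quantale_isomorphic Q' Q''"
  shows "quantale_isomorphic Q Q''"
proof -
  from assms obtain f g where
    f: "quantale_morphism Q Q' f" "bij_betw f (carrier Q) (carrier Q')" and
    g: "quantale_morphism Q' Q'' g" "bij_betw g (carrier Q') (carrier Q'')"
    by (auto simp: quantale_isomorphic_def)
  have "quantale_morphism Q Q'' (\<lambda>x. g (f x))"
    using f(1) g(1) sup_morphismD(3)[of Q Q' f]
    by (auto simp: quantale_morphism_def intro: sup_morphism_comp)
  then show ?thesis
    using bij_betw_trans[OF f(2) g(2)] by (auto simp: quantale_isomorphic_def comp_def)
qed

section \<open>Quotients and tensor products\<close>

lemma sup_congruenceD:
  assumes "sup_congruence A \<theta>"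
  shows "equiv (carrier A) \<theta>" "\<And>x y. (x, y) \<in> \<theta> \<Longrightarrow> x \<in> carrier A \<and> y \<in> carrier A"
    "\<And>P. P \<subseteq> \<theta> \<Longrightarrow> (\<Squnion>\<^bsub>A\<^esub>(fst ` P), \<Squnion>\<^bsub>A\<^esub>(snd ` P)) \<in> \<theta>"
  using assms by (auto simp: sup_congruence_def dest: equiv_type)

text \<open>The representative on the left can be kept fixed: if \<open>a\<close> is congruent to
  \<open>x\<close>, \<open>b\<close> to \<open>y\<close>, and $x \<le> y$, then joining with
  \<open>y\<close> makes $a \<or> y$ congruent to $x \<or> y = y$, so $c = a \<or> y$ works.\<close>

lemma sup_quotient_le_iff:
  assumes A: "complete_lattice A" and \<theta>: "sup_congruence A \<theta>"
    and ab: "a \<in> carrier A" "b \<in> carrier A"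
  shows "\<theta> `` {a} \<sqsubseteq>\<^bsub>sup_quotient A \<theta>\<^esub> \<theta> `` {b} \<longleftrightarrow> (\<exists>c. (b, c) \<in> \<theta> \<and> a \<sqsubseteq>\<^bsub>A\<^esub> c)"
proof
  interpret complete_lattice A by fact
  note \<theta>' = sup_congruenceD[OF \<theta>]
  note eq = equivE[OF \<theta>'(1)]
  assume "\<theta> `` {a} \<sqsubseteq>\<^bsub>sup_quotient A \<theta>\<^esub> \<theta> `` {b}"
  then obtain x y where xy: "(a, x) \<in> \<theta>" "(b, y) \<in> \<theta>" "x \<sqsubseteq>\<^bsub>A\<^esub> y"
    by (auto simp: sup_quotient_def)
  then have c: "x \<in> carrier A" "y \<in> carrier A" using \<theta>'(2) by blast+
  have "(y, y) \<in> \<theta>" using c \<theta>'(1) by (simp add: equiv_def refl_on_def)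
  then have "(\<Squnion>\<^bsub>A\<^esub>{a, y}, \<Squnion>\<^bsub>A\<^esub>{x, y}) \<in> \<theta>"
    using \<theta>'(3)[of "{(a, x), (y, y)}"] xy by simp
  moreover have "\<Squnion>\<^bsub>A\<^esub>{x, y} = y"
    using xy c by (intro sup_eqI A) auto
  ultimately have "(b, \<Squnion>\<^bsub>A\<^esub>{a, y}) \<in> \<theta>"
    using xy(2) \<theta>'(1) by (metis equiv_def symE transE)
  then show "\<exists>c. (b, c) \<in> \<theta> \<and> a \<sqsubseteq>\<^bsub>A\<^esub> c"
    using ab c sup_upper[of "{a, y}" a] by auto
next
  assume "\<exists>c. (b, c) \<in> \<theta> \<and> a \<sqsubseteq>\<^bsub>A\<^esub> c"
  then show "\<theta> `` {a} \<sqsubseteq>\<^bsub>sup_quotient A \<theta>\<^esub> \<theta> `` {b}"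
    using ab equiv_class_self[OF sup_congruenceD(1)[OF \<theta>]] by (auto simp: sup_quotient_def)
qed

lemma sup_quotient_lub:
  assumes A: "complete_lattice A" and \<theta>: "sup_congruence A \<theta>" and X: "X \<subseteq> carrier A"
  shows "x \<in> X \<Longrightarrow> \<theta> `` {x} \<sqsubseteq>\<^bsub>sup_quotient A \<theta>\<^esub> \<theta> `` {\<Squnion>\<^bsub>A\<^esub>X}"
    and "\<lbrakk>u \<in> carrier A; \<And>x. x \<in> X \<Longrightarrow> \<theta> `` {x} \<sqsubseteq>\<^bsub>sup_quotient A \<theta>\<^esub> \<theta> `` {u}\<rbrakk>
      \<Longrightarrow> \<theta> `` {\<Squnion>\<^bsub>A\<^esub>X} \<sqsubseteq>\<^bsub>sup_quotient A \<theta>\<^esub> \<theta> `` {u}"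
proof -
  interpret complete_lattice A by fact
  note \<theta>' = sup_congruenceD[OF \<theta>]
  have s: "\<Squnion>\<^bsub>A\<^esub>X \<in> carrier A" using X by simp
  have refl: "(y, y) \<in> \<theta>" if "y \<in> carrier A" for y
    using that \<theta>'(1) by (simp add: equiv_def refl_on_def)
  show "\<theta> `` {x} \<sqsubseteq>\<^bsub>sup_quotient A \<theta>\<^esub> \<theta> `` {\<Squnion>\<^bsub>A\<^esub>X}" if "x \<in> X"
    using that X s refl[OF s] sup_upper[OF _ that]
    by (auto simp: sup_quotient_le_iff[OF A \<theta>] subset_iff)
  show "\<theta> `` {\<Squnion>\<^bsub>A\<^esub>X} \<sqsubseteq>\<^bsub>sup_quotient A \<theta>\<^esub> \<theta> `` {u}"
    if u: "u \<in> carrier A" and ub: "\<And>x. x \<in> X \<Longrightarrow> \<theta> `` {x} \<sqsubseteq>\<^bsub>sup_quotient A \<theta>\<^esub> \<theta> `` {u}"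
  proof -
    have "\<forall>x\<in>X. \<exists>c. (u, c) \<in> \<theta> \<and> x \<sqsubseteq>\<^bsub>A\<^esub> c"
      using ub X u by (auto simp: sup_quotient_le_iff[OF A \<theta>] subset_iff)
    then obtain c where c: "\<And>x. x \<in> X \<Longrightarrow> (u, c x) \<in> \<theta>" "\<And>x. x \<in> X \<Longrightarrow> x \<sqsubseteq>\<^bsub>A\<^esub> c x"
      by metis
    have cc: "c x \<in> carrier A" if "x \<in> X" for x using c(1)[OF that] \<theta>'(2) by auto
    \<comment> \<open>A join of representatives of the class of \<open>u\<close> is again one,
      provided the family is nonempty. Including \<open>u\<close> itself secures this when
      \<open>X\<close> is empty, where the join of the \<open>c x\<close> would be the bottom
      element.\<close>
    define s' where "s' = \<Squnion>\<^bsub>A\<^esub>(insert u (c ` X))"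
    have in': "insert u (c ` X) \<subseteq> carrier A" using cc u by auto
    have "(\<lambda>x. (u, x)) ` insert u (c ` X) \<subseteq> \<theta>"
      using c refl[OF u] by auto
    from \<theta>'(3)[OF this] have "(\<Squnion>\<^bsub>A\<^esub>{u}, s') \<in> \<theta>"
      by (simp add: image_image s'_def image_constant_conv split: if_splits)
    moreover have "\<Squnion>\<^bsub>A\<^esub>{u} = u" using u by simp
    moreover have "x \<sqsubseteq>\<^bsub>A\<^esub> s'" if "x \<in> X" for x
      unfolding s'_def
      by (rule le_trans[OF c(2)[OF that] sup_upper]) (use that in' X cc in auto)
    then have "\<Squnion>\<^bsub>A\<^esub>X \<sqsubseteq>\<^bsub>A\<^esub> s'"
      using in' X by (intro sup_least) (auto simp: s'_def)
    ultimately show ?thesis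
      using u s by (auto simp: sup_quotient_le_iff[OF A \<theta>])
  qed
qed

lemma complete_lattice_sup_quotient:
  assumes A: "complete_lattice A" and \<theta>: "sup_congruence A \<theta>"
  shows "complete_lattice (sup_quotient A \<theta>)"
proof (rule complete_latticeI_sups)
  interpret complete_lattice A by fact
  note \<theta>' = sup_congruenceD[OF \<theta>]
  have car: "carrier (sup_quotient A \<theta>) = (\<lambda>a. \<theta> `` {a}) ` carrier A"
    by (auto simp: sup_quotient_def quotient_def)
  note le = sup_quotient_le_iff[OF A \<theta>]
  have refl: "(y, y) \<in> \<theta>" if "y \<in> carrier A" for y
    using that \<theta>'(1) by (simp add: equiv_def refl_on_def)
  have sym: "(y, x) \<in> \<theta>" if "(x, y) \<in> \<theta>" for x y
    using that \<theta>'(1) by (meson equiv_def symE)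
  have trans: "(x, z) \<in> \<theta>" if "(x, y) \<in> \<theta>" "(y, z) \<in> \<theta>" for x y z
    using that \<theta>'(1) by (meson equiv_def transE)
  have cls: "\<theta> `` {x} = \<theta> `` {y}" if "(x, y) \<in> \<theta>" for x y
    using that \<theta>'(1) by (rule equiv_class_eq[rotated])
  show "eq (sup_quotient A \<theta>) = (=)" by (simp add: sup_quotient_def)
  show "x \<sqsubseteq>\<^bsub>sup_quotient A \<theta>\<^esub> x" if "x \<in> carrier (sup_quotient A \<theta>)" for x
    using that refl by (fastforce simp: car le)
  show "x = y" if c: "x \<in> carrier (sup_quotient A \<theta>)" "y \<in> carrier (sup_quotient A \<theta>)"
    and xy: "x \<sqsubseteq>\<^bsub>sup_quotient A \<theta>\<^esub> y" "y \<sqsubseteq>\<^bsub>sup_quotient A \<theta>\<^esub> x" for x y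
  proof -
    obtain a b where ab: "a \<in> carrier A" "b \<in> carrier A" "x = \<theta> `` {a}" "y = \<theta> `` {b}"
      using c by (auto simp: car)
    obtain b' where b': "(b, b') \<in> \<theta>" "a \<sqsubseteq>\<^bsub>A\<^esub> b'" using xy(1) ab by (auto simp: le)
    have c': "b' \<in> carrier A" using b' \<theta>'(2) by blast
    have "\<theta> `` {b'} \<sqsubseteq>\<^bsub>sup_quotient A \<theta>\<^esub> \<theta> `` {a}" using xy(2) ab cls[OF b'(1)] by simp
    then obtain a' where a': "(a, a') \<in> \<theta>" "b' \<sqsubseteq>\<^bsub>A\<^esub> a'" using ab c' by (auto simp: le)
    have c'': "a' \<in> carrier A" using a' \<theta>'(2) by blast
    \<comment> \<open>Here $a \<le> b' \<le> a'$ with \<open>a\<close> congruent to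
      \<open>a'\<close>. Joining that congruence with \<open>b'\<close> makes \<open>b'\<close>
      congruent to \<open>a'\<close>, so all four representatives lie in one class.\<close>
    have "(\<Squnion>\<^bsub>A\<^esub>{a, b'}, \<Squnion>\<^bsub>A\<^esub>{a', b'}) \<in> \<theta>"
      using \<theta>'(3)[of "{(a, a'), (b', b')}"] a' refl[OF c'] by simp
    moreover have "\<Squnion>\<^bsub>A\<^esub>{a, b'} = b'"
      using b' c' ab by (intro sup_eqI[OF A]) auto
    moreover have "\<Squnion>\<^bsub>A\<^esub>{a', b'} = a'"
      using a' c' c'' by (intro sup_eqI[OF A]) auto
    ultimately show ?thesis
      using ab cls a' b' by metis
  qed
  show "x \<sqsubseteq>\<^bsub>sup_quotient A \<theta>\<^esub> z" if c: "x \<in> carrier (sup_quotient A \<theta>)"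
    "y \<in> carrier (sup_quotient A \<theta>)" "z \<in> carrier (sup_quotient A \<theta>)"
    and xy: "x \<sqsubseteq>\<^bsub>sup_quotient A \<theta>\<^esub> y" "y \<sqsubseteq>\<^bsub>sup_quotient A \<theta>\<^esub> z" for x y z
  proof -
    obtain a b d where ab: "a \<in> carrier A" "b \<in> carrier A" "d \<in> carrier A"
      "x = \<theta> `` {a}" "y = \<theta> `` {b}" "z = \<theta> `` {d}"
      using c by (auto simp: car)
    obtain b' where b': "(b, b') \<in> \<theta>" "a \<sqsubseteq>\<^bsub>A\<^esub> b'" using xy(1) ab by (auto simp: le)
    have c': "b' \<in> carrier A" using b' \<theta>'(2) by blast
    have "\<theta> `` {b'} \<sqsubseteq>\<^bsub>sup_quotient A \<theta>\<^esub> \<theta> `` {d}" using xy(2) ab cls[OF b'(1)] by simp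
    then obtain d' where d': "(d, d') \<in> \<theta>" "b' \<sqsubseteq>\<^bsub>A\<^esub> d'" using ab c' by (auto simp: le)
    have c'': "d' \<in> carrier A" using d' \<theta>'(2) by blast
    have "a \<sqsubseteq>\<^bsub>A\<^esub> d'" using le_trans b'(2) d'(2) ab(1) c' c'' by blast
    then show ?thesis using ab d' by (auto simp: le)
  qed
  fix Y assume "Y \<subseteq> carrier (sup_quotient A \<theta>)"
  then obtain X where X: "X \<subseteq> carrier A" "Y = (\<lambda>a. \<theta> `` {a}) ` X"
    unfolding car by (auto simp: subset_image_iff)
  show "\<exists>s\<in>carrier (sup_quotient A \<theta>). (\<forall>x\<in>Y. x \<sqsubseteq>\<^bsub>sup_quotient A \<theta>\<^esub> s) \<and>
      (\<forall>u\<in>carrier (sup_quotient A \<theta>). (\<forall>x\<in>Y. x \<sqsubseteq>\<^bsub>sup_quotient A \<theta>\<^esub> u) \<longrightarrow>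
        s \<sqsubseteq>\<^bsub>sup_quotient A \<theta>\<^esub> u)"
    using sup_quotient_lub[OF A \<theta> X(1)] X
    by (intro bexI[of _ "\<theta> `` {\<Squnion>\<^bsub>A\<^esub>X}"]) (auto simp: car)
qed

lemma sup_morphism_quotient:
  assumes A: "complete_lattice A" and \<theta>: "sup_congruence A \<theta>"
  shows "sup_morphism A (sup_quotient A \<theta>) (\<lambda>a. \<theta> `` {a})"
proof (rule sup_morphismI[OF A complete_lattice_sup_quotient[OF A \<theta>]])
  interpret complete_lattice A by fact
  have car: "carrier (sup_quotient A \<theta>) = (\<lambda>a. \<theta> `` {a}) ` carrier A"
    by (auto simp: sup_quotient_def quotient_def)
  show "\<theta> `` {a} \<in> carrier (sup_quotient A \<theta>)" if "a \<in> carrier A" for a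
    using that by (simp add: car)
  fix X assume X: "X \<subseteq> carrier A"
  show "\<theta> `` {\<Squnion>\<^bsub>A\<^esub>X} = \<Squnion>\<^bsub>sup_quotient A \<theta>\<^esub>((\<lambda>a. \<theta> `` {a}) ` X)"
    using X sup_quotient_lub[OF A \<theta> X]
    by (intro sup_eqI[OF complete_lattice_sup_quotient[OF A \<theta>], symmetric]) (auto simp: car)
qed

lemma sup_quotient_factor:
  assumes A: "complete_lattice A" and \<theta>: "sup_congruence A \<theta>" and f: "sup_morphism A B f"
    and ker: "\<And>x y. (x, y) \<in> \<theta> \<Longrightarrow> f x = f y"
  obtains h where "sup_morphism (sup_quotient A \<theta>) B h" "\<And>a. a \<in> carrier A \<Longrightarrow> h (\<theta> `` {a}) = f a"
proof -
  interpret complete_lattice A by fact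
  note f' = sup_morphismD[OF f]
  have car: "carrier (sup_quotient A \<theta>) = (\<lambda>a. \<theta> `` {a}) ` carrier A"
    by (auto simp: sup_quotient_def quotient_def)
  \<comment> \<open>The hypothesis \<open>ker\<close> makes the choice of the representative
    immaterial.\<close>
  define h where "h X = f (SOME a. a \<in> X)" for X
  have h: "h (\<theta> `` {a}) = f a" if "a \<in> carrier A" for a
  proof -
    have "a \<in> \<theta> `` {a}" by (rule equiv_class_self[OF sup_congruenceD(1)[OF \<theta>] that])
    then have "(SOME x. x \<in> \<theta> `` {a}) \<in> \<theta> `` {a}" by (rule someI)
    then show ?thesis using ker by (auto simp: h_def)
  qed
  have "sup_morphism (sup_quotient A \<theta>) B h"
  proof (rule sup_morphismI[OF complete_lattice_sup_quotient[OF A \<theta>] f'(2)])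
    show "h x \<in> carrier B" if "x \<in> carrier (sup_quotient A \<theta>)" for x
      using that f'(3) by (auto simp: car h)
    fix Y assume "Y \<subseteq> carrier (sup_quotient A \<theta>)"
    then obtain X where X: "X \<subseteq> carrier A" "Y = (\<lambda>a. \<theta> `` {a}) ` X"
      unfolding car by (auto simp: subset_image_iff)
    have "\<Squnion>\<^bsub>sup_quotient A \<theta>\<^esub>Y = \<theta> `` {\<Squnion>\<^bsub>A\<^esub>X}"
      using sup_morphismD(4)[OF sup_morphism_quotient[OF A \<theta>] X(1)] X(2) by simp
    moreover have "h ` Y = f ` X"
      using X h by (auto simp: image_image subset_iff intro!: image_cong)
    ultimately show "h (\<Squnion>\<^bsub>sup_quotient A \<theta>\<^esub>Y) = \<Squnion>\<^bsub>B\<^esub>(h ` Y)"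
      using X f'(4) by (simp add: h)
  qed
  with h that show ?thesis by blast
qed

lemma sup_congruence_kernel:
  assumes f: "sup_morphism A B f"
  shows "sup_congruence A {(x, y). x \<in> carrier A \<and> y \<in> carrier A \<and> f x = f y}"
    (is "sup_congruence A ?K")
proof -
  note f' = sup_morphismD[OF f]
  interpret complete_lattice A by (rule f')
  have "equiv (carrier A) ?K"
    by (auto simp: equiv_def refl_on_def sym_def trans_def)
  moreover have "(\<Squnion>\<^bsub>A\<^esub>(fst ` P), \<Squnion>\<^bsub>A\<^esub>(snd ` P)) \<in> ?K" if P: "P \<subseteq> ?K" for P
  proof -
    have c: "fst ` P \<subseteq> carrier A" "snd ` P \<subseteq> carrier A" using P by auto
    have "f ` fst ` P = f ` snd ` P"
      unfolding image_image by (rule image_cong) (use P in auto)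
    then show ?thesis using c by (simp add: f'(4))
  qed
  ultimately show ?thesis by (simp add: sup_congruence_def)
qed

lemma sup_congruence_generated:
  assumes A: "complete_lattice A" and G: "G \<subseteq> carrier A \<times> carrier A"
  shows "sup_congruence A (congruence_generated A G)"
proof -
  interpret complete_lattice A by fact
  \<comment> \<open>The total relation is a congruence containing \<open>G\<close>. It keeps the
    family nonempty, so that the intersection stays inside the square of the carrier.\<close>
  have top: "sup_congruence A (carrier A \<times> carrier A)"
    unfolding sup_congruence_def
  proof (intro conjI allI impI)
    fix P assume "P \<subseteq> carrier A \<times> carrier A"
    then have "fst ` P \<subseteq> carrier A" "snd ` P \<subseteq> carrier A" by auto
    then show "(\<Squnion>\<^bsub>A\<^esub>(fst ` P), \<Squnion>\<^bsub>A\<^esub>(snd ` P)) \<in> carrier A \<times> carrier A" by simp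
  qed (auto simp: equiv_def refl_on_def sym_def trans_def)
  let ?C = "{\<theta>. sup_congruence A \<theta> \<and> G \<subseteq> \<theta>}"
  have equiv: "equiv (carrier A) \<theta>" if "\<theta> \<in> ?C" for \<theta>
    using that by (auto simp: sup_congruence_def)
  have "equiv (carrier A) (\<Inter>?C)"
    unfolding equiv_def
  proof (intro conjI)
    show "\<Inter>?C \<subseteq> carrier A \<times> carrier A" using top G by blast
    show "refl_on (carrier A) (\<Inter>?C)"
      using equiv by (auto simp: equiv_def refl_on_def)
    show "sym (\<Inter>?C)"
      using equiv unfolding equiv_def sym_def by blast
    show "trans (\<Inter>?C)"
      using equiv unfolding equiv_def trans_def by blast
  qed
  moreover have "(\<Squnion>\<^bsub>A\<^esub>(fst ` P), \<Squnion>\<^bsub>A\<^esub>(snd ` P)) \<in> \<Inter>?C" if "P \<subseteq> \<Inter>?C" for P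
    using that by (auto intro!: sup_congruenceD(3))
  ultimately show ?thesis
    by (simp add: sup_congruence_def congruence_generated_def)
qed

lemma congruence_generated_base: "x \<in> G \<Longrightarrow> x \<in> congruence_generated A G"
  by (auto simp: congruence_generated_def)

text \<open>The kernel of \<open>f\<close> is itself one of the congruences whose intersection is
  the generated one.\<close>

lemma congruence_generated_le_kernel:
  assumes f: "sup_morphism A B f" and G: "G \<subseteq> carrier A \<times> carrier A"
    and eq: "\<And>x y. (x, y) \<in> G \<Longrightarrow> f x = f y" and xy: "(x, y) \<in> congruence_generated A G"
  shows "f x = f y"
proof -
  have "G \<subseteq> {(x, y). x \<in> carrier A \<and> y \<in> carrier A \<and> f x = f y}"
    using G eq by auto
  with sup_congruence_kernel[OF f] xy show ?thesis
    unfolding congruence_generated_def by blast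
qed

lemma powerset_lattice: "complete_lattice (powerset_lattice X)"
  and powerset_lattice_sup: "\<U> \<subseteq> Pow X \<Longrightarrow> \<Squnion>\<^bsub>powerset_lattice X\<^esub>\<U> = \<Union>\<U>"
proof -
  show 1: "complete_lattice (powerset_lattice X)"
  proof (rule complete_latticeI_sups)
    fix \<U> assume "\<U> \<subseteq> carrier (powerset_lattice X)"
    then show "\<exists>s\<in>carrier (powerset_lattice X). (\<forall>x\<in>\<U>. x \<sqsubseteq>\<^bsub>powerset_lattice X\<^esub> s) \<and>
      (\<forall>u\<in>carrier (powerset_lattice X). (\<forall>x\<in>\<U>. x \<sqsubseteq>\<^bsub>powerset_lattice X\<^esub> u) \<longrightarrow>
        s \<sqsubseteq>\<^bsub>powerset_lattice X\<^esub> u)"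
      by (intro bexI[of _ "\<Union>\<U>"]) (auto simp: powerset_lattice_def)
  qed (auto simp: powerset_lattice_def)
  show "\<Squnion>\<^bsub>powerset_lattice X\<^esub>\<U> = \<Union>\<U>" if "\<U> \<subseteq> Pow X"
    using that by (intro sup_eqI[OF 1]) (fastforce simp: powerset_lattice_def)+
qed

section \<open>The tensor product of two sup-lattices and its universal property\<close>

locale sup_lattice_pair =
  fixes A :: "('a, 'x) gorder_scheme" and B :: "('b, 'y) gorder_scheme"
  assumes A: "complete_lattice A" and B: "complete_lattice B"
begin

interpretation A: complete_lattice A by (rule A)
interpretation B: complete_lattice B by (rule B)

abbreviation "P \<equiv> powerset_lattice (carrier A \<times> carrier B)"

definition tensor_relations where
  "tensor_relations = {({(\<Squnion>\<^bsub>A\<^esub>X, b)}, X \<times> {b}) | X b. X \<subseteq> carrier A \<and> b \<in> carrier B} \<union>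
    {({(a, \<Squnion>\<^bsub>B\<^esub>Y)}, {a} \<times> Y) | a Y. a \<in> carrier A \<and> Y \<subseteq> carrier B}"

lemma tensor_congruence_eq: "tensor_congruence A B = congruence_generated P tensor_relations"
  by (simp add: tensor_congruence_def tensor_relations_def)

lemma tensor_relations_subset: "tensor_relations \<subseteq> carrier P \<times> carrier P"
  unfolding tensor_relations_def by (auto simp: powerset_lattice_def)

lemma sup_congruence_tensor: "sup_congruence P (tensor_congruence A B)"
  unfolding tensor_congruence_eq by (rule sup_congruence_generated[OF powerset_lattice tensor_relations_subset])

lemma complete_lattice_tensor: "complete_lattice (tensor A B)"
  unfolding tensor_def
  by (rule complete_lattice_sup_quotient[OF powerset_lattice sup_congruence_tensor])

text \<open>A set is the union of its singletons, whose classes are the pure tensors, and the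
  quotient map preserves joins.\<close>

lemma class_eq_sup_pure:
  assumes U: "U \<subseteq> carrier A \<times> carrier B"
  shows "tensor_congruence A B `` {U} = \<Squnion>\<^bsub>tensor A B\<^esub>((\<lambda>(a, b). pure_tensor A B a b) ` U)"
proof -
  have "(\<lambda>x. {x}) ` U \<subseteq> Pow (carrier A \<times> carrier B)" using U by auto
  then have "U = \<Squnion>\<^bsub>P\<^esub>((\<lambda>x. {x}) ` U)" "(\<lambda>x. {x}) ` U \<subseteq> carrier P"
    by (auto simp: powerset_lattice_sup) (auto simp: powerset_lattice_def)
  then show ?thesis
    using sup_morphismD(4)[OF sup_morphism_quotient[OF powerset_lattice sup_congruence_tensor],
        of "(\<lambda>x. {x}) ` U"]
    by (simp add: image_image tensor_def pure_tensor_def case_prod_beta)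
qed

lemma pure_tensor_closed:
  "\<lbrakk>a \<in> carrier A; b \<in> carrier B\<rbrakk> \<Longrightarrow> pure_tensor A B a b \<in> carrier (tensor A B)"
  by (auto simp: tensor_def sup_quotient_def pure_tensor_def powerset_lattice_def intro: quotientI)

text \<open>Each generating relation identifies a singleton with a product set, and
  \<open>class_eq_sup_pure\<close> turns the class of that product set into the join of pure tensors
  required for preservation of joins in one variable.\<close>

lemma bimorphism_pure_tensor: "bimorphism A B (tensor A B) (pure_tensor A B)"
proof -
  have cls: "tensor_congruence A B `` {U} = tensor_congruence A B `` {V}" if "(U, V) \<in> tensor_relations" for U V
    using that congruence_generated_base[of "(U, V)" tensor_relations P]
    by (intro equiv_class_eq[OF sup_congruenceD(1)[OF sup_congruence_tensor]])
      (simp add: tensor_congruence_eq)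
  have 1: "pure_tensor A B a (\<Squnion>\<^bsub>B\<^esub>Y) = \<Squnion>\<^bsub>tensor A B\<^esub>(pure_tensor A B a ` Y)"
    if "a \<in> carrier A" "Y \<subseteq> carrier B" for a Y
  proof -
    have "pure_tensor A B a (\<Squnion>\<^bsub>B\<^esub>Y) = tensor_congruence A B `` {{a} \<times> Y}"
      unfolding pure_tensor_def by (rule cls) (use that in \<open>auto simp: tensor_relations_def\<close>)
    moreover have "(\<lambda>(a, b). pure_tensor A B a b) ` ({a} \<times> Y) = pure_tensor A B a ` Y" by force
    moreover have "{a} \<times> Y \<subseteq> carrier A \<times> carrier B" using that by auto
    ultimately show ?thesis
      using class_eq_sup_pure by simp
  qed
  have 2: "pure_tensor A B (\<Squnion>\<^bsub>A\<^esub>X) b = \<Squnion>\<^bsub>tensor A B\<^esub>((\<lambda>a. pure_tensor A B a b) ` X)"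
    if "b \<in> carrier B" "X \<subseteq> carrier A" for b X
  proof -
    have "pure_tensor A B (\<Squnion>\<^bsub>A\<^esub>X) b = tensor_congruence A B `` {X \<times> {b}}"
      unfolding pure_tensor_def by (rule cls) (use that in \<open>auto simp: tensor_relations_def\<close>)
    moreover have "(\<lambda>(a, b). pure_tensor A B a b) ` (X \<times> {b}) = (\<lambda>a. pure_tensor A B a b) ` X"
      by force
    moreover have "X \<times> {b} \<subseteq> carrier A \<times> carrier B" using that by auto
    ultimately show ?thesis
      using class_eq_sup_pure by simp
  qed
  show ?thesis
    unfolding bimorphism_def
    by (intro conjI ballI sup_morphismI A B complete_lattice_tensor pure_tensor_closed 1 2)
qed

lemma tensor_cases:
  assumes "x \<in> carrier (tensor A B)"
  obtains U where "U \<subseteq> carrier A \<times> carrier B"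
    "x = \<Squnion>\<^bsub>tensor A B\<^esub>((\<lambda>(a, b). pure_tensor A B a b) ` U)"
proof -
  from assms obtain U where "U \<subseteq> carrier A \<times> carrier B" "x = tensor_congruence A B `` {U}"
    by (auto simp: tensor_def sup_quotient_def quotient_def powerset_lattice_def)
  with class_eq_sup_pure that show ?thesis by auto
qed

text \<open>The map \<open>F\<close> is the join-preserving extension of \<open>f\<close> to the
  power set. The two families of generating relations lie in its kernel because \<open>f\<close>
  preserves joins in its first and in its second variable, so \<open>F\<close> factors through the
  quotient.\<close>

lemma tensor_universal:
  assumes f: "bimorphism A B C f"
  obtains h where "sup_morphism (tensor A B) C h"
    "\<And>a b. \<lbrakk>a \<in> carrier A; b \<in> carrier B\<rbrakk> \<Longrightarrow> h (pure_tensor A B a b) = f a b"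
proof -
  note f' = bimorphismD[OF f]
  interpret C: complete_lattice C by (rule f')
  define F where "F U = \<Squnion>\<^bsub>C\<^esub>((\<lambda>(a, b). f a b) ` U)" for U
  have F: "sup_morphism P C F"
  proof (rule sup_morphismI[OF powerset_lattice f'(3)])
    show "F U \<in> carrier C" if "U \<in> carrier P" for U
      using that f'(6) unfolding F_def by (intro C.sup_closed) (auto simp: powerset_lattice_def)
    fix \<U> assume U: "\<U> \<subseteq> carrier P"
    then have "\<U> \<subseteq> Pow (carrier A \<times> carrier B)" by (simp add: powerset_lattice_def)
    then have "\<Union>\<U> \<subseteq> carrier A \<times> carrier B" by auto
    then have "x \<in> carrier A \<times> carrier B" if "x \<in> \<Union>\<U>" for x
      using that by (rule subsetD)
    then have "(\<lambda>(a, b). f a b) x \<in> carrier C" if "x \<in> \<Union>\<U>" for x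
      using that f'(6) by (simp add: mem_Times_iff case_prod_beta)
    then show "F (\<Squnion>\<^bsub>P\<^esub>\<U>) = \<Squnion>\<^bsub>C\<^esub>(F ` \<U>)"
      using \<open>\<U> \<subseteq> Pow _\<close> sup_image_Union[OF f'(3), of \<U> "\<lambda>(a, b). f a b"]
      unfolding F_def by (simp add: powerset_lattice_sup)
  qed
  have F1: "F {(a, b)} = f a b" if "a \<in> carrier A" "b \<in> carrier B" for a b
    using f'(6)[OF that] by (simp add: F_def)
  have ker: "F U = F V" if "(U, V) \<in> tensor_relations" for U V
    using that unfolding tensor_relations_def
  proof (elim UnE CollectE exE conjE)
    fix X b assume X: "(U, V) = ({(\<Squnion>\<^bsub>A\<^esub>X, b)}, X \<times> {b})" "X \<subseteq> carrier A" "b \<in> carrier B"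
    have "(\<lambda>(a, b). f a b) ` (X \<times> {b}) = (\<lambda>a. f a b) ` X" by force
    then have "F V = \<Squnion>\<^bsub>C\<^esub>((\<lambda>a. f a b) ` X)" using X(1) by (simp add: F_def)
    moreover have "F U = f (\<Squnion>\<^bsub>A\<^esub>X) b" using X F1[of "\<Squnion>\<^bsub>A\<^esub>X" b] by simp
    ultimately show ?thesis using sup_morphismD(4)[OF f'(5)[OF X(3)] X(2)] by simp
  next
    fix a Y assume Y: "(U, V) = ({(a, \<Squnion>\<^bsub>B\<^esub>Y)}, {a} \<times> Y)" "a \<in> carrier A" "Y \<subseteq> carrier B"
    have "(\<lambda>(a, b). f a b) ` ({a} \<times> Y) = f a ` Y" by force
    then have "F V = \<Squnion>\<^bsub>C\<^esub>(f a ` Y)" using Y(1) by (simp add: F_def)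
    moreover have "F U = f a (\<Squnion>\<^bsub>B\<^esub>Y)" using Y F1[of a "\<Squnion>\<^bsub>B\<^esub>Y"] by simp
    ultimately show ?thesis using sup_morphismD(4)[OF f'(4)[OF Y(2)] Y(3)] by simp
  qed
  have "F U = F V" if "(U, V) \<in> tensor_congruence A B" for U V
    using congruence_generated_le_kernel[OF F tensor_relations_subset ker] that
    unfolding tensor_congruence_eq by blast
  then obtain h where h: "sup_morphism (tensor A B) C h"
    "\<And>U. U \<in> carrier P \<Longrightarrow> h (tensor_congruence A B `` {U}) = F U"
    using sup_quotient_factor[OF powerset_lattice sup_congruence_tensor F]
    unfolding tensor_def by metis
  have "h (pure_tensor A B a b) = f a b" if "a \<in> carrier A" "b \<in> carrier B" for a b
    using that h(2)[of "{(a, b)}"] F1 by (simp add: pure_tensor_def powerset_lattice_def)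
  with h(1) that show ?thesis by blast
qed

end

section \<open>The tensor product over the quantale of a triad\<close>

locale quantum_triad =
  fixes D :: "('l, 't, 'r) triad"
  assumes triad: "triad D"
begin

abbreviation "L \<equiv> Lm D"
abbreviation "T \<equiv> Tq D"
abbreviation "R \<equiv> Rm D"

lemma quantale_T: "quantale T"
  and bimorphism_TL: "bimorphism T L L (TL D)"
  and bimorphism_RT: "bimorphism R T R (RT D)"
  and bimorphism_LR: "bimorphism L R T (LR D)"
  using triad by (auto simp: triad_def left_module_def right_module_def)

sublocale L: complete_lattice L by (rule bimorphismD(2)[OF bimorphism_TL])
sublocale T: complete_lattice T by (rule bimorphismD(1)[OF bimorphism_TL])
sublocale R: complete_lattice R by (rule bimorphismD(1)[OF bimorphism_RT])

lemma triad_closed [simp]: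
  "\<lbrakk>t \<in> carrier T; l \<in> carrier L\<rbrakk> \<Longrightarrow> TL D t l \<in> carrier L"
  "\<lbrakk>r \<in> carrier R; t \<in> carrier T\<rbrakk> \<Longrightarrow> RT D r t \<in> carrier R"
  "\<lbrakk>l \<in> carrier L; r \<in> carrier R\<rbrakk> \<Longrightarrow> LR D l r \<in> carrier T"
  "\<lbrakk>t \<in> carrier T; t' \<in> carrier T\<rbrakk> \<Longrightarrow> t \<odot>\<^bsub>T\<^esub> t' \<in> carrier T"
  using bimorphismD(6)[OF bimorphism_TL] bimorphismD(6)[OF bimorphism_RT]
    bimorphismD(6)[OF bimorphism_LR] quantale_mult_closed[OF quantale_T] by auto

lemma TL_mult:
  "\<lbrakk>t \<in> carrier T; t' \<in> carrier T; l \<in> carrier L\<rbrakk> \<Longrightarrow> TL D (t \<odot>\<^bsub>T\<^esub> t') l = TL D t (TL D t' l)"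
  using triad by (auto simp: triad_def left_module_def)

lemma RT_mult:
  "\<lbrakk>t \<in> carrier T; t' \<in> carrier T; r \<in> carrier R\<rbrakk> \<Longrightarrow> RT D r (t \<odot>\<^bsub>T\<^esub> t') = RT D (RT D r t) t'"
  using triad by (auto simp: triad_def right_module_def)

lemma LR_TL:
  "\<lbrakk>l \<in> carrier L; r \<in> carrier R; t \<in> carrier T\<rbrakk> \<Longrightarrow> LR D (TL D t l) r = t \<odot>\<^bsub>T\<^esub> LR D l r"
  using triad by (auto simp: triad_def)

lemma LR_RT:
  "\<lbrakk>l \<in> carrier L; r \<in> carrier R; t \<in> carrier T\<rbrakk> \<Longrightarrow> LR D l (RT D r t) = LR D l r \<odot>\<^bsub>T\<^esub> t"
  using triad by (auto simp: triad_def)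

text \<open>These are the bimorphisms that factor through $R \<otimes>_T L$.\<close>

definition balanced :: "('c, 'z) gorder_scheme \<Rightarrow> ('r \<Rightarrow> 'l \<Rightarrow> 'c) \<Rightarrow> bool" where
  "balanced B f \<longleftrightarrow> bimorphism R L B f \<and>
    (\<forall>r\<in>carrier R. \<forall>t\<in>carrier T. \<forall>l\<in>carrier L. f (RT D r t) l = f r (TL D t l))"

lemma balancedD:
  assumes "balanced B f"
  shows "bimorphism R L B f" "complete_lattice B"
    "\<And>r t l. \<lbrakk>r \<in> carrier R; t \<in> carrier T; l \<in> carrier L\<rbrakk> \<Longrightarrow> f (RT D r t) l = f r (TL D t l)"
    "\<And>r l. \<lbrakk>r \<in> carrier R; l \<in> carrier L\<rbrakk> \<Longrightarrow> f r l \<in> carrier B"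
  using assms by (auto simp: balanced_def dest: bimorphismD)

sublocale RL: sup_lattice_pair R L
  by unfold_locales

definition balance_relations where
  "balance_relations = {(pure_tensor R L (RT D r t) l, pure_tensor R L r (TL D t l)) | r t l.
    r \<in> carrier R \<and> t \<in> carrier T \<and> l \<in> carrier L}"

lemma balanced_congruence_eq:
  "balanced_congruence D = congruence_generated (tensor R L) balance_relations"
  by (simp add: balanced_congruence_def balance_relations_def)

lemma balance_relations_subset: "balance_relations \<subseteq> carrier (tensor R L) \<times> carrier (tensor R L)"
  by (auto simp: balance_relations_def intro!: RL.pure_tensor_closed)

lemma sup_congruence_balanced: "sup_congruence (tensor R L) (balanced_congruence D)"
  unfolding balanced_congruence_eq
  by (rule sup_congruence_generated[OF RL.complete_lattice_tensor balance_relations_subset])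

lemma sup_morphism_RtensorL:
  "sup_morphism (tensor R L) (RtensorL D) (\<lambda>a. balanced_congruence D `` {a})"
  unfolding RtensorL_def
  by (rule sup_morphism_quotient[OF RL.complete_lattice_tensor sup_congruence_balanced])

lemma balanced_ten_RtensorL: "balanced (RtensorL D) (ten D)"
  unfolding balanced_def
proof (intro conjI ballI)
  show "bimorphism R L (RtensorL D) (ten D)"
    by (rule bimorphism_transport[OF RL.bimorphism_pure_tensor
          sup_morphism_id[OF R.complete_lattice_axioms] sup_morphism_id[OF L.complete_lattice_axioms]
          sup_morphism_RtensorL]) (simp add: ten_def)
  fix r t l assume "r \<in> carrier R" "t \<in> carrier T" "l \<in> carrier L"
  then have "(pure_tensor R L (RT D r t) l, pure_tensor R L r (TL D t l)) \<in> balanced_congruence D"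
    unfolding balanced_congruence_eq
    by (intro congruence_generated_base) (auto simp: balance_relations_def)
  then show "ten D (RT D r t) l = ten D r (TL D t l)"
    unfolding ten_def by (rule equiv_class_eq[OF sup_congruenceD(1)[OF sup_congruence_balanced]])
qed

lemma Q0_fields: "carrier (Q0 D) = carrier (RtensorL D)" "eq (Q0 D) = (=)" "le (Q0 D) = le (RtensorL D)"
  by (simp_all add: Q0_def)

text \<open>Joins depend only on the carrier and the order, the fields that \<open>Q0 D\<close>
  shares with \<open>RtensorL D\<close>. This lets facts about the quotient pass to the record that
  also carries the product.\<close>

lemma sup_Q0: "\<Squnion>\<^bsub>Q0 D\<^esub>X = \<Squnion>\<^bsub>RtensorL D\<^esub>X"
  by (simp add: Q0_def sup_def least_def Upper_def)

lemma complete_lattice_Q0: "complete_lattice (Q0 D)"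
  using order_iso_complete_lattice(1)[OF sup_morphismD(2)[OF sup_morphism_RtensorL] Q0_fields(2), of "\<lambda>x. x"]
  by (simp add: Q0_fields bij_betw_def)

sublocale Q0: complete_lattice "Q0 D" by (rule complete_lattice_Q0)

lemma sup_morphism_Q0_iff: "sup_morphism (Q0 D) B h \<longleftrightarrow> sup_morphism (RtensorL D) B h"
  using complete_lattice_Q0 sup_morphismD(2)[OF sup_morphism_RtensorL]
  by (simp add: sup_morphism_def sup_pres_def Q0_fields sup_Q0)

lemma balanced_ten: "balanced (Q0 D) (ten D)"
  using balanced_ten_RtensorL complete_lattice_Q0
  by (simp add: balanced_def bimorphism_def sup_morphism_def sup_pres_def Q0_fields sup_Q0)

lemma ten_closed [simp]: "\<lbrakk>r \<in> carrier R; l \<in> carrier L\<rbrakk> \<Longrightarrow> ten D r l \<in> carrier (Q0 D)"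
  by (rule balancedD(4)[OF balanced_ten])

lemma ten_balanced:
  "\<lbrakk>r \<in> carrier R; t \<in> carrier T; l \<in> carrier L\<rbrakk> \<Longrightarrow> ten D (RT D r t) l = ten D r (TL D t l)"
  by (rule balancedD(3)[OF balanced_ten])

section \<open>Elements of \<open>Q0 D\<close> as joins of generators\<close>

lemma Q0_cases:
  assumes "x \<in> carrier (Q0 D)"
  obtains U where "U \<subseteq> carrier R \<times> carrier L" "x = \<Squnion>\<^bsub>Q0 D\<^esub>((\<lambda>(r, l). ten D r l) ` U)"
proof -
  from assms obtain a where a: "a \<in> carrier (tensor R L)" "x = balanced_congruence D `` {a}"
    by (auto simp: Q0_fields RtensorL_def sup_quotient_def quotient_def)
  from RL.tensor_cases[OF a(1)] obtain U where U: "U \<subseteq> carrier R \<times> carrier L"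
    "a = \<Squnion>\<^bsub>tensor R L\<^esub>((\<lambda>(r, l). pure_tensor R L r l) ` U)"
    by auto
  have "(\<lambda>(r, l). pure_tensor R L r l) ` U \<subseteq> carrier (tensor R L)"
    using U RL.pure_tensor_closed by auto
  from sup_morphismD(4)[OF sup_morphism_RtensorL this] U a(2) that show ?thesis
    by (simp add: sup_Q0 image_image ten_def case_prod_beta)
qed

text \<open>The index set of the joins that define the product of \<open>Q0 D\<close> and the
  actions \<open>Q0_lact\<close> and \<open>Q0_ract\<close>.\<close>

definition below where
  "below x = {(r, l). r \<in> carrier R \<and> l \<in> carrier L \<and> ten D r l \<sqsubseteq>\<^bsub>Q0 D\<^esub> x}"

lemma below_subset: "below x \<subseteq> carrier R \<times> carrier L"
  by (auto simp: below_def)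

text \<open>Some set \<open>U\<close> of generators has join \<open>x\<close>. It lies inside
  \<open>below x\<close>, and enlarging it to all of \<open>below x\<close> only adds generators
  that are below \<open>x\<close> anyway.\<close>

lemma sup_below:
  assumes x: "x \<in> carrier (Q0 D)"
  shows "\<Squnion>\<^bsub>Q0 D\<^esub>((\<lambda>(r, l). ten D r l) ` below x) = x"
proof -
  from Q0_cases[OF x] obtain U where U: "U \<subseteq> carrier R \<times> carrier L"
    "x = \<Squnion>\<^bsub>Q0 D\<^esub>((\<lambda>(r, l). ten D r l) ` U)" .
  have tens: "(\<lambda>(r, l). ten D r l) ` V \<subseteq> carrier (Q0 D)" if "V \<subseteq> carrier R \<times> carrier L" for V
    using that by auto
  have "U \<subseteq> below x"
    using U tens[OF U(1)] by (auto simp: below_def intro!: Q0.sup_upper)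
  show ?thesis
  proof (rule sup_eqI[OF complete_lattice_Q0 tens[OF below_subset] x])
    fix u assume u: "u \<in> carrier (Q0 D)" "\<And>y. y \<in> (\<lambda>(r, l). ten D r l) ` below x \<Longrightarrow> y \<sqsubseteq>\<^bsub>Q0 D\<^esub> u"
    have "y \<sqsubseteq>\<^bsub>Q0 D\<^esub> u" if "y \<in> (\<lambda>(r, l). ten D r l) ` U" for y
      by (rule u(2), rule subsetD[OF image_mono[OF \<open>U \<subseteq> below x\<close>] that])
    then have "\<Squnion>\<^bsub>Q0 D\<^esub>((\<lambda>(r, l). ten D r l) ` U) \<sqsubseteq>\<^bsub>Q0 D\<^esub> u"
      using tens[OF U(1)] u(1) by (intro Q0.sup_least)
    then show "x \<sqsubseteq>\<^bsub>Q0 D\<^esub> u" using U(2) by simp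
  qed (auto simp: below_def)
qed

text \<open>The value at \<open>x\<close> forced on any join-preserving map that takes the values
  \<open>f r l\<close> on generators. For balanced \<open>f\<close> it is such a map.\<close>

definition extend where
  "extend B f x = \<Squnion>\<^bsub>B\<^esub>((\<lambda>(r, l). f r l) ` below x)"

lemma extend_unique:
  assumes h: "sup_morphism (Q0 D) B h"
    and hf: "\<And>r l. \<lbrakk>r \<in> carrier R; l \<in> carrier L\<rbrakk> \<Longrightarrow> h (ten D r l) = f r l"
    and x: "x \<in> carrier (Q0 D)"
  shows "h x = extend B f x"
proof -
  have "(\<lambda>(r, l). ten D r l) ` below x \<subseteq> carrier (Q0 D)"
    by (auto simp: below_def)
  moreover have "(\<lambda>p. h (case p of (r, l) \<Rightarrow> ten D r l)) ` below x = (\<lambda>(r, l). f r l) ` below x"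
    using below_subset hf by (intro image_cong) auto
  ultimately show ?thesis
    using sup_morphismD(4)[OF h] sup_below[OF x] by (metis extend_def image_image)
qed

lemma Q0_morphism_eqI:
  assumes "sup_morphism (Q0 D) B h" "sup_morphism (Q0 D) B k"
    and "\<And>r l. \<lbrakk>r \<in> carrier R; l \<in> carrier L\<rbrakk> \<Longrightarrow> h (ten D r l) = k (ten D r l)"
    and "x \<in> carrier (Q0 D)"
  shows "h x = k x"
  using extend_unique[OF assms(1,3,4)] extend_unique[OF assms(2) refl assms(4)] by simp

text \<open>The formula is not visibly join-preserving, since \<open>below\<close> of a join may be
  larger than the union of the \<open>below\<close> sets. Instead \<open>f\<close> is factored
  through the two quotients in turn, and \<open>extend_unique\<close> identifies the resulting map
  with \<open>extend B f\<close>.\<close>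

lemma
  assumes f: "balanced B f"
  shows sup_morphism_extend: "sup_morphism (Q0 D) B (extend B f)"
    and extend_ten: "\<lbrakk>r \<in> carrier R; l \<in> carrier L\<rbrakk> \<Longrightarrow> extend B f (ten D r l) = f r l"
proof -
  obtain g where g: "sup_morphism (tensor R L) B g"
    "\<And>r l. \<lbrakk>r \<in> carrier R; l \<in> carrier L\<rbrakk> \<Longrightarrow> g (pure_tensor R L r l) = f r l"
    using RL.tensor_universal[OF balancedD(1)[OF f]] by metis
  have "g x = g y" if "(x, y) \<in> balance_relations" for x y
    using that balancedD(3)[OF f] g(2) by (auto simp: balance_relations_def)
  then have "g x = g y" if "(x, y) \<in> balanced_congruence D" for x y
    using congruence_generated_le_kernel[OF g(1) balance_relations_subset] that
    unfolding balanced_congruence_eq by blast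
  then obtain h where h: "sup_morphism (RtensorL D) B h"
    "\<And>a. a \<in> carrier (tensor R L) \<Longrightarrow> h (balanced_congruence D `` {a}) = g a"
    using sup_quotient_factor[OF RL.complete_lattice_tensor sup_congruence_balanced g(1)]
    unfolding RtensorL_def by metis
  have hm: "sup_morphism (Q0 D) B h" using h(1) by (simp add: sup_morphism_Q0_iff)
  have ht: "h (ten D r l) = f r l" if "r \<in> carrier R" "l \<in> carrier L" for r l
    using that h(2)[of "pure_tensor R L r l"] g(2) RL.pure_tensor_closed by (simp add: ten_def)
  show "sup_morphism (Q0 D) B (extend B f)"
    by (rule sup_morphism_cong[OF hm extend_unique[OF hm ht]])
  show "extend B f (ten D r l) = f r l" if "r \<in> carrier R" "l \<in> carrier L"
    using extend_unique[OF hm ht, of "ten D r l"] ht that by simp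
qed

text \<open>Needed for the product with a fixed element, which is a join of products with the
  generators below that element.\<close>

lemma balanced_sup:
  assumes B: "complete_lattice B" and F: "\<And>i. i \<in> I \<Longrightarrow> balanced B (F i)"
  shows "balanced B (\<lambda>r l. \<Squnion>\<^bsub>B\<^esub>((\<lambda>i. F i r l) ` I))"
  unfolding balanced_def bimorphism_def
proof (intro conjI ballI)
  note F' = balancedD[OF F]
  show "sup_morphism L B (\<lambda>l. \<Squnion>\<^bsub>B\<^esub>((\<lambda>i. F i r l) ` I))" if "r \<in> carrier R" for r
    by (rule sup_morphism_pointwise_sup[OF L.complete_lattice_axioms B bimorphismD(4)[OF F'(1) that]])
  show "sup_morphism R B (\<lambda>r. \<Squnion>\<^bsub>B\<^esub>((\<lambda>i. F i r l) ` I))" if "l \<in> carrier L" for l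
    by (rule sup_morphism_pointwise_sup[OF R.complete_lattice_axioms B bimorphismD(5)[OF F'(1) that]])
  fix r t l assume "r \<in> carrier R" "t \<in> carrier T" "l \<in> carrier L"
  then show "\<Squnion>\<^bsub>B\<^esub>((\<lambda>i. F i (RT D r t) l) ` I) = \<Squnion>\<^bsub>B\<^esub>((\<lambda>i. F i r (TL D t l)) ` I)"
    using F'(3) by (auto intro!: arg_cong[of _ _ "\<lambda>X. \<Squnion>\<^bsub>B\<^esub>X"] image_cong)
qed (rule R.complete_lattice_axioms L.complete_lattice_axioms B)+

lemma balanced_comp:
  assumes f: "balanced B f"
    and a: "sup_morphism R R a" and b: "sup_morphism L L b"
    and ab: "\<And>r t l. \<lbrakk>r \<in> carrier R; t \<in> carrier T; l \<in> carrier L\<rbrakk>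
      \<Longrightarrow> f (a (RT D r t)) (b l) = f (a r) (b (TL D t l))"
  shows "balanced B (\<lambda>r l. f (a r) (b l))"
  unfolding balanced_def
  using bimorphism_transport[OF balancedD(1)[OF f] a b sup_morphism_id[OF balancedD(2)[OF f]]] ab
  by auto

section \<open>The quantale $Q_0$\<close>

text \<open>The scalar moves across because $(rt)(lr') = r(t(lr')) = r((tl)r')$.\<close>

lemma balanced_mult_left:
  assumes "r' \<in> carrier R" "l' \<in> carrier L"
  shows "balanced (Q0 D) (\<lambda>r l. ten D (RT D r (LR D l r')) l')"
  unfolding balanced_def bimorphism_def
proof (intro conjI ballI)
  have ten: "sup_morphism R (Q0 D) (\<lambda>r. ten D r l')"
    using balancedD(1)[OF balanced_ten] assms by (auto dest: bimorphismD(5))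
  show "sup_morphism L (Q0 D) (\<lambda>l. ten D (RT D r (LR D l r')) l')" if "r \<in> carrier R" for r
    by (rule sup_morphism_comp[OF sup_morphism_comp[OF bimorphismD(5)[OF bimorphism_LR assms(1)]
            bimorphismD(4)[OF bimorphism_RT that]] ten])
  show "sup_morphism R (Q0 D) (\<lambda>r. ten D (RT D r (LR D l r')) l')" if "l \<in> carrier L" for l
    by (rule sup_morphism_comp[OF bimorphismD(5)[OF bimorphism_RT] ten]) (use assms that in simp)
  show "ten D (RT D (RT D r t) (LR D l r')) l' = ten D (RT D r (LR D (TL D t l) r')) l'"
    if "r \<in> carrier R" "t \<in> carrier T" "l \<in> carrier L" for r t l
    using that assms by (simp add: LR_TL RT_mult)
qed (rule R.complete_lattice_axioms L.complete_lattice_axioms complete_lattice_Q0)+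

text \<open>Here $r(l(r't)) = (r(lr'))t$, and the scalar then passes to $l'$ by the balance of
  \<otimes> itself.\<close>

lemma balanced_mult_right:
  assumes "r \<in> carrier R" "l \<in> carrier L"
  shows "balanced (Q0 D) (\<lambda>r' l'. ten D (RT D r (LR D l r')) l')"
proof (rule balanced_comp[OF balanced_ten _ sup_morphism_id[OF L.complete_lattice_axioms]])
  show "sup_morphism R R (\<lambda>r'. RT D r (LR D l r'))"
    by (rule sup_morphism_comp[OF bimorphismD(4)[OF bimorphism_LR assms(2)]
          bimorphismD(4)[OF bimorphism_RT assms(1)]])
qed (use assms in \<open>simp add: LR_RT RT_mult ten_balanced\<close>)

text \<open>The double join over the generators below \<open>x\<close> and below \<open>y\<close>
  may be taken in either order. Each order exhibits the product as an \<open>extend\<close> in one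
  of its variables, which is how preservation of joins is obtained for both.\<close>

lemma Q0_mult_eq:
  assumes "x \<in> carrier (Q0 D)" "y \<in> carrier (Q0 D)"
  shows "x \<odot>\<^bsub>Q0 D\<^esub> y = extend (Q0 D)
      (\<lambda>r l. \<Squnion>\<^bsub>Q0 D\<^esub>((\<lambda>p. ten D (RT D r (LR D l (fst p))) (snd p)) ` below y)) x" (is ?l)
    and "x \<odot>\<^bsub>Q0 D\<^esub> y = extend (Q0 D)
      (\<lambda>r' l'. \<Squnion>\<^bsub>Q0 D\<^esub>((\<lambda>p. ten D (RT D (fst p) (LR D (snd p) r')) l') ` below x)) y" (is ?r)
proof -
  let ?f = "\<lambda>p q. ten D (RT D (fst p) (LR D (snd p) (fst q))) (snd q)"
  have set: "{ten D (RT D r (LR D l r')) l' | r l r' l'.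
           r \<in> carrier R \<and> l \<in> carrier L \<and> ten D r l \<sqsubseteq>\<^bsub>RtensorL D\<^esub> x \<and>
           r' \<in> carrier R \<and> l' \<in> carrier L \<and> ten D r' l' \<sqsubseteq>\<^bsub>RtensorL D\<^esub> y}
        = (\<lambda>(p, q). ?f p q) ` (below x \<times> below y)" (is "?A = ?B")
  proof
    show "?A \<subseteq> ?B"
    proof
      fix z assume "z \<in> ?A"
      then obtain r l r' l' where "z = ten D (RT D r (LR D l r')) l'"
        "((r, l), (r', l')) \<in> below x \<times> below y"
        by (auto simp: below_def Q0_fields)
      then show "z \<in> ?B" by (auto intro!: image_eqI[of _ _ "((r, l), (r', l'))"])
    qed
    show "?B \<subseteq> ?A"
    proof
      fix z assume "z \<in> ?B"
      then obtain r l r' l' where "z = ten D (RT D r (LR D l r')) l'"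
        "(r, l) \<in> below x" "(r', l') \<in> below y"
        by auto
      then show "z \<in> ?A" unfolding below_def Q0_fields by blast
    qed
  qed
  have c: "?f p q \<in> carrier (Q0 D)" if "p \<in> below x" "q \<in> below y" for p q
    using that by (auto simp: below_def)
  have eq: "x \<odot>\<^bsub>Q0 D\<^esub> y = \<Squnion>\<^bsub>Q0 D\<^esub>((\<lambda>(p, q). ?f p q) ` (below x \<times> below y))"
    unfolding set[symmetric] sup_Q0 by (simp add: Q0_def)
  show ?l
    unfolding eq extend_def
    by (subst sup_image_Times[OF complete_lattice_Q0 c]) (simp_all add: case_prod_beta)
  show ?r
    unfolding eq extend_def
    by (subst sup_image_Times[OF complete_lattice_Q0 c], assumption+,
        subst sup_swap[OF complete_lattice_Q0 c]) (simp_all add: case_prod_beta)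
qed

lemma bimorphism_Q0: "bimorphism (Q0 D) (Q0 D) (Q0 D) (qmult (Q0 D))"
  unfolding bimorphism_def
proof (intro conjI ballI)
  show "sup_morphism (Q0 D) (Q0 D) (\<lambda>y. x \<odot>\<^bsub>Q0 D\<^esub> y)" if x: "x \<in> carrier (Q0 D)" for x
  proof (rule sup_morphism_cong[OF sup_morphism_extend Q0_mult_eq(2)[OF x, symmetric]])
    show "balanced (Q0 D) (\<lambda>r' l'. \<Squnion>\<^bsub>Q0 D\<^esub>((\<lambda>p. ten D (RT D (fst p) (LR D (snd p) r')) l') ` below x))"
      by (rule balanced_sup[OF complete_lattice_Q0 balanced_mult_right]) (auto simp: below_def)
  qed
  show "sup_morphism (Q0 D) (Q0 D) (\<lambda>x. x \<odot>\<^bsub>Q0 D\<^esub> y)" if y: "y \<in> carrier (Q0 D)" for y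
  proof (rule sup_morphism_cong[OF sup_morphism_extend Q0_mult_eq(1)[OF _ y, symmetric]])
    show "balanced (Q0 D) (\<lambda>r l. \<Squnion>\<^bsub>Q0 D\<^esub>((\<lambda>p. ten D (RT D r (LR D l (fst p))) (snd p)) ` below y))"
      by (rule balanced_sup[OF complete_lattice_Q0 balanced_mult_left]) (auto simp: below_def)
  qed
qed (rule complete_lattice_Q0)+

text \<open>Other generators than \<open>(r, l)\<close> may lie below \<open>ten D r l\<close>, so
  the value is not immediate from the defining join; it comes from \<open>extend_ten\<close>, used
  in one variable and then in the other.\<close>

lemma ten_mult:
  assumes "r \<in> carrier R" "l \<in> carrier L" "r' \<in> carrier R" "l' \<in> carrier L"
  shows "ten D r l \<odot>\<^bsub>Q0 D\<^esub> ten D r' l' = ten D (RT D r (LR D l r')) l'"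
proof -
  have "balanced (Q0 D)
      (\<lambda>r l. \<Squnion>\<^bsub>Q0 D\<^esub>((\<lambda>p. ten D (RT D r (LR D l (fst p))) (snd p)) ` below (ten D r' l')))"
    by (rule balanced_sup[OF complete_lattice_Q0 balanced_mult_left]) (auto simp: below_def)
  then have "ten D r l \<odot>\<^bsub>Q0 D\<^esub> ten D r' l' =
      extend (Q0 D) (\<lambda>r' l'. ten D (RT D r (LR D l r')) l') (ten D r' l')"
    using assms by (simp add: Q0_mult_eq(1) extend_ten) (simp add: extend_def case_prod_beta)
  also have "\<dots> = ten D (RT D r (LR D l r')) l'"
    using assms by (simp add: extend_ten[OF balanced_mult_right])
  finally show ?thesis .
qed

lemma Q0_closed [simp]:
  "\<lbrakk>x \<in> carrier (Q0 D); y \<in> carrier (Q0 D)\<rbrakk> \<Longrightarrow> x \<odot>\<^bsub>Q0 D\<^esub> y \<in> carrier (Q0 D)"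
  by (rule bimorphismD(6)[OF bimorphism_Q0])

lemma quantale_Q0: "quantale (Q0 D)"
  unfolding quantale_def
proof (intro conjI ballI complete_lattice_Q0 bimorphism_Q0)
  note left = bimorphismD(4)[OF bimorphism_Q0]
  note right = bimorphismD(5)[OF bimorphism_Q0]
  \<comment> \<open>Both sides of the associative law preserve joins in each argument, so it
    suffices to check generators; the arguments are freed one at a time, beginning with the
    last.\<close>
  have 1: "(ten D r l \<odot>\<^bsub>Q0 D\<^esub> ten D r' l') \<odot>\<^bsub>Q0 D\<^esub> z = ten D r l \<odot>\<^bsub>Q0 D\<^esub> (ten D r' l' \<odot>\<^bsub>Q0 D\<^esub> z)"
    if "r \<in> carrier R" "l \<in> carrier L" "r' \<in> carrier R" "l' \<in> carrier L" "z \<in> carrier (Q0 D)" for r l r' l' z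
    by (rule Q0_morphism_eqI[OF left sup_morphism_comp[OF left left]])
      (use that in \<open>simp_all add: ten_mult LR_RT RT_mult\<close>)
  have 2: "(ten D r l \<odot>\<^bsub>Q0 D\<^esub> y) \<odot>\<^bsub>Q0 D\<^esub> z = ten D r l \<odot>\<^bsub>Q0 D\<^esub> (y \<odot>\<^bsub>Q0 D\<^esub> z)"
    if "r \<in> carrier R" "l \<in> carrier L" "y \<in> carrier (Q0 D)" "z \<in> carrier (Q0 D)" for r l y z
    by (rule Q0_morphism_eqI[OF sup_morphism_comp[OF left right] sup_morphism_comp[OF right left]])
      (use that 1 in simp_all)
  show "(x \<odot>\<^bsub>Q0 D\<^esub> y) \<odot>\<^bsub>Q0 D\<^esub> z = x \<odot>\<^bsub>Q0 D\<^esub> (y \<odot>\<^bsub>Q0 D\<^esub> z)"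
    if "x \<in> carrier (Q0 D)" "y \<in> carrier (Q0 D)" "z \<in> carrier (Q0 D)" for x y z
    by (rule Q0_morphism_eqI[OF sup_morphism_comp[OF right right] right])
      (use that 2 in simp_all)
qed

section \<open>The quantale $Q_1$\<close>

lemma Q1_iff:
  "x \<in> carrier (Q1 D) \<longleftrightarrow>
    fst x \<in> extensional (carrier L) \<and> snd x \<in> extensional (carrier R) \<and>
    sup_morphism L L (fst x) \<and>
    (\<forall>t\<in>carrier T. \<forall>l\<in>carrier L. fst x (TL D t l) = TL D t (fst x l)) \<and>
    sup_morphism R R (snd x) \<and>
    (\<forall>t\<in>carrier T. \<forall>r\<in>carrier R. snd x (RT D r t) = RT D (snd x r) t) \<and>
    (\<forall>l\<in>carrier L. \<forall>r\<in>carrier R. LR D (fst x l) r = LR D l (snd x r))"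
  using triad by (auto simp: Q1_def left_module_morphism_def right_module_morphism_def triad_def)

lemma Q1D:
  assumes "x \<in> carrier (Q1 D)"
  shows "fst x \<in> extensional (carrier L)" "snd x \<in> extensional (carrier R)"
    "sup_morphism L L (fst x)" "sup_morphism R R (snd x)"
    "\<And>l. l \<in> carrier L \<Longrightarrow> fst x l \<in> carrier L" "\<And>r. r \<in> carrier R \<Longrightarrow> snd x r \<in> carrier R"
    "\<And>t l. \<lbrakk>t \<in> carrier T; l \<in> carrier L\<rbrakk> \<Longrightarrow> fst x (TL D t l) = TL D t (fst x l)"
    "\<And>t r. \<lbrakk>t \<in> carrier T; r \<in> carrier R\<rbrakk> \<Longrightarrow> snd x (RT D r t) = RT D (snd x r) t"
    "\<And>l r. \<lbrakk>l \<in> carrier L; r \<in> carrier R\<rbrakk> \<Longrightarrow> LR D (fst x l) r = LR D l (snd x r)"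
  using assms by (auto simp: Q1_iff dest: sup_morphismD(3))

lemma Q1_eqI:
  assumes "x \<in> carrier (Q1 D)" "y \<in> carrier (Q1 D)"
    and "\<And>l. l \<in> carrier L \<Longrightarrow> fst x l = fst y l" "\<And>r. r \<in> carrier R \<Longrightarrow> snd x r = snd y r"
  shows "x = y"
  using assms Q1D(1,2) by (intro prod_eqI extensionalityI)

lemma Q1_le_iff:
  "x \<sqsubseteq>\<^bsub>Q1 D\<^esub> y \<longleftrightarrow> (\<forall>l\<in>carrier L. fst x l \<sqsubseteq>\<^bsub>L\<^esub> fst y l) \<and> (\<forall>r\<in>carrier R. snd x r \<sqsubseteq>\<^bsub>R\<^esub> snd y r)"
  by (simp add: Q1_def case_prod_beta)

definition Q1_sup where
  "Q1_sup X = (\<lambda>l\<in>carrier L. \<Squnion>\<^bsub>L\<^esub>((\<lambda>x. fst x l) ` X), \<lambda>r\<in>carrier R. \<Squnion>\<^bsub>R\<^esub>((\<lambda>x. snd x r) ` X))"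

text \<open>Equivariance and compatibility with the pairing pass to pointwise joins because the
  actions and the pairing preserve joins in each variable; the components remain morphisms by
  \<open>sup_morphism_pointwise_sup\<close>.\<close>

lemma Q1_sup_closed:
  assumes X: "X \<subseteq> carrier (Q1 D)"
  shows "Q1_sup X \<in> carrier (Q1 D)"
  unfolding Q1_iff
proof (intro conjI ballI)
  note X' = Q1D[OF subsetD[OF X]]
  have cL: "(\<lambda>x. fst x l) ` X \<subseteq> carrier L" if "l \<in> carrier L" for l
    using X'(5) that by auto
  have cR: "(\<lambda>x. snd x r) ` X \<subseteq> carrier R" if "r \<in> carrier R" for r
    using X'(6) that by auto
  show "fst (Q1_sup X) \<in> extensional (carrier L)" "snd (Q1_sup X) \<in> extensional (carrier R)"
    by (simp_all add: Q1_sup_def)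
  show "sup_morphism L L (fst (Q1_sup X))"
    by (rule sup_morphism_cong[OF sup_morphism_pointwise_sup[OF L.complete_lattice_axioms
            L.complete_lattice_axioms X'(3)]]) (simp_all add: Q1_sup_def)
  show "sup_morphism R R (snd (Q1_sup X))"
    by (rule sup_morphism_cong[OF sup_morphism_pointwise_sup[OF R.complete_lattice_axioms
            R.complete_lattice_axioms X'(4)]]) (simp_all add: Q1_sup_def)
  fix t assume t: "t \<in> carrier T"
  show "fst (Q1_sup X) (TL D t l) = TL D t (fst (Q1_sup X) l)" if l: "l \<in> carrier L" for l
  proof -
    have "(\<lambda>x. fst x (TL D t l)) ` X = (\<lambda>x. TL D t (fst x l)) ` X"
      using X'(7) t l by (intro image_cong) auto
    then show ?thesis
      using t l sup_morphismD(4)[OF bimorphismD(4)[OF bimorphism_TL t] cL[OF l]]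
      by (simp add: Q1_sup_def image_image)
  qed
  show "snd (Q1_sup X) (RT D r t) = RT D (snd (Q1_sup X) r) t" if r: "r \<in> carrier R" for r
  proof -
    have "(\<lambda>x. snd x (RT D r t)) ` X = (\<lambda>x. RT D (snd x r) t) ` X"
      using X'(8) t r by (intro image_cong) auto
    then show ?thesis
      using t r sup_morphismD(4)[OF bimorphismD(5)[OF bimorphism_RT t] cR[OF r]]
      by (simp add: Q1_sup_def image_image)
  qed
next
  note X' = Q1D[OF subsetD[OF X]]
  fix l r assume lr: "l \<in> carrier L" "r \<in> carrier R"
  have cL: "(\<lambda>x. fst x l) ` X \<subseteq> carrier L" and cR: "(\<lambda>x. snd x r) ` X \<subseteq> carrier R"
    using X'(5,6) lr by auto
  have "(\<lambda>x. LR D (fst x l) r) ` X = (\<lambda>x. LR D l (snd x r)) ` X"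
    using X'(9) lr by (intro image_cong) auto
  then show "LR D (fst (Q1_sup X) l) r = LR D l (snd (Q1_sup X) r)"
    using lr sup_morphismD(4)[OF bimorphismD(5)[OF bimorphism_LR lr(2)] cL]
      sup_morphismD(4)[OF bimorphismD(4)[OF bimorphism_LR lr(1)] cR]
    by (simp add: Q1_sup_def image_image)
qed

lemma Q1_sup_lub:
  assumes X: "X \<subseteq> carrier (Q1 D)"
  shows "x \<in> X \<Longrightarrow> x \<sqsubseteq>\<^bsub>Q1 D\<^esub> Q1_sup X"
    and "\<lbrakk>u \<in> carrier (Q1 D); \<And>x. x \<in> X \<Longrightarrow> x \<sqsubseteq>\<^bsub>Q1 D\<^esub> u\<rbrakk> \<Longrightarrow> Q1_sup X \<sqsubseteq>\<^bsub>Q1 D\<^esub> u"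
proof -
  note X' = Q1D[OF subsetD[OF X]]
  have cL: "(\<lambda>x. fst x l) ` X \<subseteq> carrier L" if "l \<in> carrier L" for l
    using X'(5) that by auto
  have cR: "(\<lambda>x. snd x r) ` X \<subseteq> carrier R" if "r \<in> carrier R" for r
    using X'(6) that by auto
  show "x \<sqsubseteq>\<^bsub>Q1 D\<^esub> Q1_sup X" if "x \<in> X"
    using that by (auto simp: Q1_le_iff Q1_sup_def intro!: L.sup_upper[OF cL] R.sup_upper[OF cR])
  show "Q1_sup X \<sqsubseteq>\<^bsub>Q1 D\<^esub> u" if u: "u \<in> carrier (Q1 D)" and ub: "\<And>x. x \<in> X \<Longrightarrow> x \<sqsubseteq>\<^bsub>Q1 D\<^esub> u"
    unfolding Q1_le_iff
  proof (intro conjI ballI)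
    show "fst (Q1_sup X) l \<sqsubseteq>\<^bsub>L\<^esub> fst u l" if "l \<in> carrier L" for l
      using cL[OF that] Q1D(5)[OF u that] ub that
      by (auto simp: Q1_sup_def Q1_le_iff intro!: L.sup_least)
    show "snd (Q1_sup X) r \<sqsubseteq>\<^bsub>R\<^esub> snd u r" if "r \<in> carrier R" for r
      using cR[OF that] Q1D(6)[OF u that] ub that
      by (auto simp: Q1_sup_def Q1_le_iff intro!: R.sup_least)
  qed
qed

lemma complete_lattice_Q1: "complete_lattice (Q1 D)"
proof (rule complete_latticeI_sups)
  show "eq (Q1 D) = (=)" by (simp add: Q1_def)
  show "x \<sqsubseteq>\<^bsub>Q1 D\<^esub> x" if "x \<in> carrier (Q1 D)" for x
    using Q1D[OF that] by (simp add: Q1_le_iff)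
  show "x = y" if "x \<in> carrier (Q1 D)" "y \<in> carrier (Q1 D)" "x \<sqsubseteq>\<^bsub>Q1 D\<^esub> y" "y \<sqsubseteq>\<^bsub>Q1 D\<^esub> x" for x y
    using that Q1D(5,6) by (intro Q1_eqI L.le_antisym R.le_antisym) (auto simp: Q1_le_iff)
  show "x \<sqsubseteq>\<^bsub>Q1 D\<^esub> z" if c: "x \<in> carrier (Q1 D)" "y \<in> carrier (Q1 D)" "z \<in> carrier (Q1 D)"
    and le: "x \<sqsubseteq>\<^bsub>Q1 D\<^esub> y" "y \<sqsubseteq>\<^bsub>Q1 D\<^esub> z" for x y z
    unfolding Q1_le_iff
  proof (intro conjI ballI)
    show "fst x l \<sqsubseteq>\<^bsub>L\<^esub> fst z l" if "l \<in> carrier L" for l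
      by (rule L.le_trans[of _ "fst y l"]) (use that c le Q1D(5) in \<open>simp_all add: Q1_le_iff\<close>)
    show "snd x r \<sqsubseteq>\<^bsub>R\<^esub> snd z r" if "r \<in> carrier R" for r
      by (rule R.le_trans[of _ "snd y r"]) (use that c le Q1D(6) in \<open>simp_all add: Q1_le_iff\<close>)
  qed
  fix X assume "X \<subseteq> carrier (Q1 D)"
  then show "\<exists>s\<in>carrier (Q1 D). (\<forall>x\<in>X. x \<sqsubseteq>\<^bsub>Q1 D\<^esub> s) \<and>
      (\<forall>u\<in>carrier (Q1 D). (\<forall>x\<in>X. x \<sqsubseteq>\<^bsub>Q1 D\<^esub> u) \<longrightarrow> s \<sqsubseteq>\<^bsub>Q1 D\<^esub> u)"
    using Q1_sup_closed Q1_sup_lub by (intro bexI[of _ "Q1_sup X"]) auto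
qed

sublocale Q1: complete_lattice "Q1 D" by (rule complete_lattice_Q1)

lemma sup_Q1: "X \<subseteq> carrier (Q1 D) \<Longrightarrow> \<Squnion>\<^bsub>Q1 D\<^esub>X = Q1_sup X"
  by (intro sup_eqI[OF complete_lattice_Q1] Q1_sup_closed Q1_sup_lub)

text \<open>Joins in \<open>Q1 D\<close> are pointwise. Evaluation at a top element later becomes
  the retraction that recovers an element of $L$ or $R$.\<close>

lemma sup_morphism_fst: "l \<in> carrier L \<Longrightarrow> sup_morphism (Q1 D) L (\<lambda>x. fst x l)"
  by (rule sup_morphismI[OF complete_lattice_Q1 L.complete_lattice_axioms])
    (simp_all add: sup_Q1 Q1_sup_def Q1D)

lemma sup_morphism_snd: "r \<in> carrier R \<Longrightarrow> sup_morphism (Q1 D) R (\<lambda>x. snd x r)"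
  by (rule sup_morphismI[OF complete_lattice_Q1 R.complete_lattice_axioms])
    (simp_all add: sup_Q1 Q1_sup_def Q1D)

text \<open>Since joins are pointwise and components are extensional, the evaluations together
  detect preservation of joins.\<close>

lemma sup_morphism_Q1I:
  assumes A: "complete_lattice A" and f: "\<And>a. a \<in> carrier A \<Longrightarrow> f a \<in> carrier (Q1 D)"
    and L: "\<And>l. l \<in> carrier L \<Longrightarrow> sup_morphism A L (\<lambda>a. fst (f a) l)"
    and R: "\<And>r. r \<in> carrier R \<Longrightarrow> sup_morphism A R (\<lambda>a. snd (f a) r)"
  shows "sup_morphism A (Q1 D) f"
proof (rule sup_morphismI[OF A complete_lattice_Q1 f])
  interpret A: complete_lattice A by fact
  fix X assume X: "X \<subseteq> carrier A"
  then have fX: "f ` X \<subseteq> carrier (Q1 D)" using f by auto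
  show "f (\<Squnion>\<^bsub>A\<^esub>X) = \<Squnion>\<^bsub>Q1 D\<^esub>(f ` X)"
  proof (rule Q1_eqI)
    show "f (\<Squnion>\<^bsub>A\<^esub>X) \<in> carrier (Q1 D)" "\<Squnion>\<^bsub>Q1 D\<^esub>(f ` X) \<in> carrier (Q1 D)"
      using X fX f by auto
    show "fst (f (\<Squnion>\<^bsub>A\<^esub>X)) l = fst (\<Squnion>\<^bsub>Q1 D\<^esub>(f ` X)) l" if "l \<in> carrier L" for l
      using sup_morphismD(4)[OF L[OF that] X] that by (simp add: sup_Q1[OF fX] Q1_sup_def image_image)
    show "snd (f (\<Squnion>\<^bsub>A\<^esub>X)) r = snd (\<Squnion>\<^bsub>Q1 D\<^esub>(f ` X)) r" if "r \<in> carrier R" for r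
      using sup_morphismD(4)[OF R[OF that] X] that by (simp add: sup_Q1[OF fX] Q1_sup_def image_image)
  qed
qed

lemma Q1_mult: "x \<odot>\<^bsub>Q1 D\<^esub> y = (compose (carrier L) (fst y) (fst x), compose (carrier R) (snd x) (snd y))"
  by (simp add: Q1_def case_prod_beta)

lemma Q1_mult_simps [simp]:
  "l \<in> carrier L \<Longrightarrow> fst (x \<odot>\<^bsub>Q1 D\<^esub> y) l = fst y (fst x l)"
  "r \<in> carrier R \<Longrightarrow> snd (x \<odot>\<^bsub>Q1 D\<^esub> y) r = snd x (snd y r)"
  by (simp_all add: Q1_mult compose_eq)

lemma Q1_closed [simp]:
  assumes "x \<in> carrier (Q1 D)" "y \<in> carrier (Q1 D)"
  shows "x \<odot>\<^bsub>Q1 D\<^esub> y \<in> carrier (Q1 D)"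
  unfolding Q1_iff
proof (intro conjI ballI)
  note x = Q1D[OF assms(1)] and y = Q1D[OF assms(2)]
  show "fst (x \<odot>\<^bsub>Q1 D\<^esub> y) \<in> extensional (carrier L)" "snd (x \<odot>\<^bsub>Q1 D\<^esub> y) \<in> extensional (carrier R)"
    by (simp_all add: Q1_mult)
  show "sup_morphism L L (fst (x \<odot>\<^bsub>Q1 D\<^esub> y))"
    by (rule sup_morphism_cong[OF sup_morphism_comp[OF x(3) y(3)]]) simp
  show "sup_morphism R R (snd (x \<odot>\<^bsub>Q1 D\<^esub> y))"
    by (rule sup_morphism_cong[OF sup_morphism_comp[OF y(4) x(4)]]) simp
qed (use Q1D[OF assms(1)] Q1D[OF assms(2)] in simp_all)

lemma quantale_Q1: "quantale (Q1 D)"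
  unfolding quantale_def bimorphism_def
proof (intro conjI ballI)
  fix x assume x: "x \<in> carrier (Q1 D)"
  note x' = Q1D[OF x]
  show "sup_morphism (Q1 D) (Q1 D) (\<lambda>y. x \<odot>\<^bsub>Q1 D\<^esub> y)"
  proof (rule sup_morphism_Q1I[OF complete_lattice_Q1])
    show "sup_morphism (Q1 D) L (\<lambda>y. fst (x \<odot>\<^bsub>Q1 D\<^esub> y) l)" if "l \<in> carrier L" for l
      using that sup_morphism_fst[OF x'(5)[OF that]] by simp
    show "sup_morphism (Q1 D) R (\<lambda>y. snd (x \<odot>\<^bsub>Q1 D\<^esub> y) r)" if "r \<in> carrier R" for r
      using that sup_morphism_comp[OF sup_morphism_snd[OF that] x'(4)] by simp
  qed (use x in simp)
  show "sup_morphism (Q1 D) (Q1 D) (\<lambda>y. y \<odot>\<^bsub>Q1 D\<^esub> x)"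
  proof (rule sup_morphism_Q1I[OF complete_lattice_Q1])
    show "sup_morphism (Q1 D) L (\<lambda>y. fst (y \<odot>\<^bsub>Q1 D\<^esub> x) l)" if "l \<in> carrier L" for l
      using that sup_morphism_comp[OF sup_morphism_fst[OF that] x'(3)] by simp
    show "sup_morphism (Q1 D) R (\<lambda>y. snd (y \<odot>\<^bsub>Q1 D\<^esub> x) r)" if "r \<in> carrier R" for r
      using that sup_morphism_snd[OF x'(6)[OF that]] by simp
  qed (use x in simp)
  fix y z assume yz: "y \<in> carrier (Q1 D)" "z \<in> carrier (Q1 D)"
  show "(x \<odot>\<^bsub>Q1 D\<^esub> y) \<odot>\<^bsub>Q1 D\<^esub> z = x \<odot>\<^bsub>Q1 D\<^esub> (y \<odot>\<^bsub>Q1 D\<^esub> z)"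
    by (rule Q1_eqI) (use x yz in \<open>simp_all add: Q1D\<close>)
qed (rule complete_lattice_Q1)+

section \<open>The canonical morphism\<close>

text \<open>The pair prescribed as $\<phi>(r \<otimes> l)$. Its components are the analogues of
  rank-one operators: a fixed vector scaled by the value of the pairing.\<close>

definition rank_one where
  "rank_one r l = (\<lambda>l'\<in>carrier L. TL D (LR D l' r) l, \<lambda>r'\<in>carrier R. RT D r (LR D l r'))"

lemma rank_one_simps [simp]:
  "l' \<in> carrier L \<Longrightarrow> fst (rank_one r l) l' = TL D (LR D l' r) l"
  "r' \<in> carrier R \<Longrightarrow> snd (rank_one r l) r' = RT D r (LR D l r')"
  by (simp_all add: rank_one_def)

lemma rank_one_closed [simp]:
  assumes "r \<in> carrier R" "l \<in> carrier L"
  shows "rank_one r l \<in> carrier (Q1 D)"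
  unfolding Q1_iff
proof (intro conjI ballI)
  show "fst (rank_one r l) \<in> extensional (carrier L)" "snd (rank_one r l) \<in> extensional (carrier R)"
    by (simp_all add: rank_one_def)
  show "sup_morphism L L (fst (rank_one r l))"
    by (rule sup_morphism_cong[OF sup_morphism_comp[OF bimorphismD(5)[OF bimorphism_LR assms(1)]
            bimorphismD(5)[OF bimorphism_TL assms(2)]]]) simp
  show "sup_morphism R R (snd (rank_one r l))"
    by (rule sup_morphism_cong[OF sup_morphism_comp[OF bimorphismD(4)[OF bimorphism_LR assms(2)]
            bimorphismD(4)[OF bimorphism_RT assms(1)]]]) simp
qed (use assms in \<open>simp_all add: LR_TL LR_RT TL_mult RT_mult\<close>)

lemma balanced_rank_one: "balanced (Q1 D) rank_one"
  unfolding balanced_def bimorphism_def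
proof (intro conjI ballI)
  show "sup_morphism L (Q1 D) (rank_one r)" if r: "r \<in> carrier R" for r
  proof (rule sup_morphism_Q1I[OF L.complete_lattice_axioms])
    show "sup_morphism L L (\<lambda>l. fst (rank_one r l) l')" if "l' \<in> carrier L" for l'
      using that r bimorphismD(4)[OF bimorphism_TL] by simp
    show "sup_morphism L R (\<lambda>l. snd (rank_one r l) r')" if "r' \<in> carrier R" for r'
      using that sup_morphism_comp[OF bimorphismD(5)[OF bimorphism_LR that] bimorphismD(4)[OF bimorphism_RT r]]
      by simp
  qed (use r in simp)
  show "sup_morphism R (Q1 D) (\<lambda>r. rank_one r l)" if l: "l \<in> carrier L" for l
  proof (rule sup_morphism_Q1I[OF R.complete_lattice_axioms])
    show "sup_morphism R L (\<lambda>r. fst (rank_one r l) l')" if "l' \<in> carrier L" for l'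
      using that sup_morphism_comp[OF bimorphismD(4)[OF bimorphism_LR that] bimorphismD(5)[OF bimorphism_TL l]]
      by simp
    show "sup_morphism R R (\<lambda>r. snd (rank_one r l) r')" if "r' \<in> carrier R" for r'
      using that l bimorphismD(5)[OF bimorphism_RT] by simp
  qed (use l in simp)
  show "rank_one (RT D r t) l = rank_one r (TL D t l)"
    if "r \<in> carrier R" "t \<in> carrier T" "l \<in> carrier L" for r t l
    by (rule Q1_eqI) (use that in \<open>simp_all add: LR_TL LR_RT TL_mult RT_mult\<close>)
qed (rule complete_lattice_Q1 R.complete_lattice_axioms L.complete_lattice_axioms)+

text \<open>The restriction supplies the extensionality that \<open>canonical_morphism\<close>
  demands.\<close>

definition phi where
  "phi = restrict (extend (Q1 D) rank_one) (carrier (Q0 D))"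

lemma phi_ten: "\<lbrakk>r \<in> carrier R; l \<in> carrier L\<rbrakk> \<Longrightarrow> phi (ten D r l) = rank_one r l"
  by (simp add: phi_def extend_ten[OF balanced_rank_one])

lemma sup_morphism_phi: "sup_morphism (Q0 D) (Q1 D) phi"
  by (rule sup_morphism_cong[OF sup_morphism_extend[OF balanced_rank_one]]) (simp add: phi_def)

lemma rank_one_mult:
  assumes "r \<in> carrier R" "l \<in> carrier L" "r' \<in> carrier R" "l' \<in> carrier L"
  shows "rank_one r l \<odot>\<^bsub>Q1 D\<^esub> rank_one r' l' = rank_one (RT D r (LR D l r')) l'"
  by (rule Q1_eqI) (use assms in \<open>simp_all add: LR_TL LR_RT TL_mult RT_mult\<close>)

text \<open>On generators this is \<open>rank_one_mult\<close>; preservation of joins extends it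
  first to all \<open>y\<close> and then to all \<open>x\<close>.\<close>

lemma phi_mult:
  assumes "x \<in> carrier (Q0 D)" "y \<in> carrier (Q0 D)"
  shows "phi (x \<odot>\<^bsub>Q0 D\<^esub> y) = phi x \<odot>\<^bsub>Q1 D\<^esub> phi y"
proof -
  have bi: "bimorphism (Q1 D) (Q1 D) (Q1 D) (qmult (Q1 D))"
    using quantale_Q1 by (simp add: quantale_def)
  note phi = sup_morphism_phi
  note c = sup_morphismD(3)[OF phi]
  have 1: "phi (ten D r l \<odot>\<^bsub>Q0 D\<^esub> y) = phi (ten D r l) \<odot>\<^bsub>Q1 D\<^esub> phi y"
    if "r \<in> carrier R" "l \<in> carrier L" "y \<in> carrier (Q0 D)" for r l y
    by (rule Q0_morphism_eqI[OF sup_morphism_comp[OF bimorphismD(4)[OF bimorphism_Q0] phi]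
          sup_morphism_comp[OF phi bimorphismD(4)[OF bi]]])
      (use that c in \<open>simp_all add: phi_ten ten_mult rank_one_mult\<close>)
  show ?thesis
    by (rule Q0_morphism_eqI[OF sup_morphism_comp[OF bimorphismD(5)[OF bimorphism_Q0] phi]
          sup_morphism_comp[OF phi bimorphismD(5)[OF bi]]])
      (use assms 1 c in simp_all)
qed

text \<open>Every element is a join of generators, so a morphism is fixed by its values on them, and
  extensionality fixes it off the carrier. Every claim about canonical morphisms thereby becomes a
  claim about \<open>phi\<close>.\<close>

lemma canonical_morphism_iff: "canonical_morphism D \<psi> \<longleftrightarrow> \<psi> = phi"
proof
  assume \<psi>: "canonical_morphism D \<psi>"
  show "\<psi> = phi"
  proof (rule extensionalityI)
    show "\<psi> \<in> extensional (carrier (Q0 D))" using \<psi> by (simp add: canonical_morphism_def)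
    show "\<psi> x = phi x" if "x \<in> carrier (Q0 D)" for x
      using \<psi> by (intro Q0_morphism_eqI[OF _ sup_morphism_phi _ that])
        (auto simp: canonical_morphism_def quantale_morphism_def phi_ten rank_one_def)
  qed (simp add: phi_def)
next
  assume "\<psi> = phi"
  then show "canonical_morphism D \<psi>"
    using quantale_Q0 quantale_Q1 sup_morphism_phi phi_mult
    by (auto simp: canonical_morphism_def quantale_morphism_def phi_ten rank_one_def)
      (simp add: phi_def)
qed

lemma quantale_morphism_phi: "quantale_morphism (Q0 D) (Q1 D) phi"
  using canonical_morphism_iff by (auto simp: canonical_morphism_def)

section \<open>Top elements and strongness\<close>

lemma top_Q0: "\<top>\<^bsub>Q0 D\<^esub> = ten D \<top>\<^bsub>R\<^esub> \<top>\<^bsub>L\<^esub>"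
proof (rule Q0.le_antisym)
  \<comment> \<open>The top is the join of the generators below it, and monotonicity of \<otimes>
    bounds each of them.\<close>
  have "\<Squnion>\<^bsub>Q0 D\<^esub>((\<lambda>(r, l). ten D r l) ` below \<top>\<^bsub>Q0 D\<^esub>) \<sqsubseteq>\<^bsub>Q0 D\<^esub> ten D \<top>\<^bsub>R\<^esub> \<top>\<^bsub>L\<^esub>"
    using bimorphism_mono[OF balancedD(1)[OF balanced_ten]]
    by (intro Q0.sup_least) (auto simp: below_def)
  then show "\<top>\<^bsub>Q0 D\<^esub> \<sqsubseteq>\<^bsub>Q0 D\<^esub> ten D \<top>\<^bsub>R\<^esub> \<top>\<^bsub>L\<^esub>"
    by (simp add: sup_below)
qed simp_all

lemma strong_triadD:
  assumes "strong_triad D"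
  shows "l \<in> carrier L \<Longrightarrow> l \<sqsubseteq>\<^bsub>L\<^esub> TL D (LR D l \<top>\<^bsub>R\<^esub>) \<top>\<^bsub>L\<^esub>"
    "r \<in> carrier R \<Longrightarrow> r \<sqsubseteq>\<^bsub>R\<^esub> RT D \<top>\<^bsub>R\<^esub> (LR D \<top>\<^bsub>L\<^esub> r)"
  using assms by (auto simp: strong_triad_def)

lemma top_Q1:
  assumes strong: "strong_triad D"
  shows "\<top>\<^bsub>Q1 D\<^esub> = rank_one \<top>\<^bsub>R\<^esub> \<top>\<^bsub>L\<^esub>"
proof (rule Q1.le_antisym)
  let ?q = "\<top>\<^bsub>Q1 D\<^esub>"
  have q: "?q \<in> carrier (Q1 D)" by simp
  note q' = Q1D[OF q]
  have "fst ?q l \<sqsubseteq>\<^bsub>L\<^esub> TL D (LR D l \<top>\<^bsub>R\<^esub>) \<top>\<^bsub>L\<^esub>" if l: "l \<in> carrier L" for l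
  proof -
    have "fst ?q l \<sqsubseteq>\<^bsub>L\<^esub> fst ?q (TL D (LR D l \<top>\<^bsub>R\<^esub>) \<top>\<^bsub>L\<^esub>)"
      using l strong by (intro sup_morphism_mono[OF q'(3)] strong_triadD) auto
    also have "\<dots> = TL D (LR D l \<top>\<^bsub>R\<^esub>) (fst ?q \<top>\<^bsub>L\<^esub>)"
      using l by (simp add: q'(7))
    also have "\<dots> \<sqsubseteq>\<^bsub>L\<^esub> TL D (LR D l \<top>\<^bsub>R\<^esub>) \<top>\<^bsub>L\<^esub>"
      using l q'(5) by (intro bimorphism_mono[OF bimorphism_TL]) auto
    finally show ?thesis using l q' by simp
  qed
  moreover have "snd ?q r \<sqsubseteq>\<^bsub>R\<^esub> RT D \<top>\<^bsub>R\<^esub> (LR D \<top>\<^bsub>L\<^esub> r)" if r: "r \<in> carrier R" for r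
  proof -
    have "snd ?q r \<sqsubseteq>\<^bsub>R\<^esub> snd ?q (RT D \<top>\<^bsub>R\<^esub> (LR D \<top>\<^bsub>L\<^esub> r))"
      using r strong by (intro sup_morphism_mono[OF q'(4)] strong_triadD) auto
    also have "\<dots> = RT D (snd ?q \<top>\<^bsub>R\<^esub>) (LR D \<top>\<^bsub>L\<^esub> r)"
      using r by (simp add: q'(8))
    also have "\<dots> \<sqsubseteq>\<^bsub>R\<^esub> RT D \<top>\<^bsub>R\<^esub> (LR D \<top>\<^bsub>L\<^esub> r)"
      using r q'(6) by (intro bimorphism_mono[OF bimorphism_RT]) auto
    finally show ?thesis using r q' by simp
  qed
  ultimately show "?q \<sqsubseteq>\<^bsub>Q1 D\<^esub> rank_one \<top>\<^bsub>R\<^esub> \<top>\<^bsub>L\<^esub>"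
    by (simp add: Q1_le_iff)
qed simp_all

lemma strong_phi_iff: "strong_morphism (Q0 D) (Q1 D) phi \<longleftrightarrow> strong_triad D"
proof
  assume "strong_triad D"
  then show "strong_morphism (Q0 D) (Q1 D) phi"
    by (simp add: strong_morphism_def quantale_morphism_phi top_Q0 top_Q1 phi_ten)
next
  assume "strong_morphism (Q0 D) (Q1 D) phi"
  then have top: "\<top>\<^bsub>Q1 D\<^esub> = rank_one \<top>\<^bsub>R\<^esub> \<top>\<^bsub>L\<^esub>"
    by (simp add: strong_morphism_def top_Q0 phi_ten)
  let ?i = "(\<lambda>l\<in>carrier L. l, \<lambda>r\<in>carrier R. r)"
  have "sup_morphism L L (\<lambda>l\<in>carrier L. l)" "sup_morphism R R (\<lambda>r\<in>carrier R. r)"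
    by (rule sup_morphism_cong[OF sup_morphism_id], simp_all
        add: L.complete_lattice_axioms R.complete_lattice_axioms)+
  then have "?i \<in> carrier (Q1 D)"
    by (simp add: Q1_iff)
  then have "?i \<sqsubseteq>\<^bsub>Q1 D\<^esub> rank_one \<top>\<^bsub>R\<^esub> \<top>\<^bsub>L\<^esub>"
    unfolding top[symmetric] by simp
  then show "strong_triad D"
    by (simp add: Q1_le_iff strong_triad_def)
qed

end

section \<open>Strict triads\<close>

lemma sided_fields:
  "eq (left_sided Q) = eq Q" "eq (right_sided Q) = eq Q" "eq (two_sided Q) = eq Q"
  "le (left_sided Q) = le Q" "le (right_sided Q) = le Q" "le (two_sided Q) = le Q"
  "qmult (two_sided Q) = qmult Q"
  "carrier (left_sided Q) = {q \<in> carrier Q. \<top>\<^bsub>Q\<^esub> \<odot>\<^bsub>Q\<^esub> q \<sqsubseteq>\<^bsub>Q\<^esub> q}"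
  "carrier (right_sided Q) = {q \<in> carrier Q. q \<odot>\<^bsub>Q\<^esub> \<top>\<^bsub>Q\<^esub> \<sqsubseteq>\<^bsub>Q\<^esub> q}"
  "carrier (two_sided Q) = carrier (right_sided Q) \<inter> carrier (left_sided Q)"
  by (simp_all add: left_sided_def right_sided_def two_sided_def)

locale strict_quantum_triad = quantum_triad +
  assumes strict: "strict_triad D"
begin

lemma strong: "strong_triad D"
  and unital_T: "unital_quantale T"
  using strict by (auto simp: strict_triad_def unital_triad_def)

lemma top_LR: "LR D \<top>\<^bsub>L\<^esub> \<top>\<^bsub>R\<^esub> = qunit T"
  using strict by (simp add: strict_triad_def)

lemma is_qunit_T: "is_qunit T (qunit T)"
proof -
  obtain e where e: "is_qunit T e" using unital_T by (auto simp: unital_quantale_def)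
  have "e' = e" if "is_qunit T e'" for e'
    using e that unfolding is_qunit_def by metis
  with e show ?thesis unfolding qunit_def by (rule theI)
qed

lemma unit_simps [simp]:
  "qunit T \<in> carrier T"
  "t \<in> carrier T \<Longrightarrow> qunit T \<odot>\<^bsub>T\<^esub> t = t" "t \<in> carrier T \<Longrightarrow> t \<odot>\<^bsub>T\<^esub> qunit T = t"
  "l \<in> carrier L \<Longrightarrow> TL D (qunit T) l = l" "r \<in> carrier R \<Longrightarrow> RT D r (qunit T) = r"
  using is_qunit_T strict
  by (auto simp: is_qunit_def strict_triad_def unital_triad_def unital_left_module_def
      unital_right_module_def)

text \<open>As $1_L1_R$ is the unit $e$, the top satisfies $1_T = 1_T(1_L1_R) = (1_T1_L)1_R \<le>
  1_L1_R = e$.\<close>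

lemma strictly_two_sided_T: "strictly_two_sided T"
proof -
  have "\<top>\<^bsub>T\<^esub> = LR D (TL D \<top>\<^bsub>T\<^esub> \<top>\<^bsub>L\<^esub>) \<top>\<^bsub>R\<^esub>"
    by (simp add: LR_TL top_LR)
  also have "\<dots> \<sqsubseteq>\<^bsub>T\<^esub> LR D \<top>\<^bsub>L\<^esub> \<top>\<^bsub>R\<^esub>"
    by (rule bimorphism_mono[OF bimorphism_LR]) simp_all
  finally have "\<top>\<^bsub>T\<^esub> \<sqsubseteq>\<^bsub>T\<^esub> qunit T" by (simp add: top_LR)
  then have "qunit T = \<top>\<^bsub>T\<^esub>" by (intro T.le_antisym) simp_all
  then show ?thesis using unital_T by (simp add: strictly_two_sided_def)
qed

lemma top_Q1_eq: "\<top>\<^bsub>Q1 D\<^esub> = rank_one \<top>\<^bsub>R\<^esub> \<top>\<^bsub>L\<^esub>"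
  by (rule top_Q1[OF strong])

section \<open>One-sided and two-sided elements of \<open>Q0 D\<close>\<close>

lemma bimorphism_ten: "bimorphism R L (Q0 D) (ten D)"
  by (rule balancedD(1)[OF balanced_ten])

text \<open>Strongness gives $r \<otimes> l \<le> 1_R(1_Lr) \<otimes> l = 1(r \<otimes> l)$ for each
  generator below \<open>x\<close>; taking joins yields $x \<le> 1x$.\<close>

lemma Q0_left_sided_eq:
  assumes x: "x \<in> carrier (Q0 D)" "\<top>\<^bsub>Q0 D\<^esub> \<odot>\<^bsub>Q0 D\<^esub> x \<sqsubseteq>\<^bsub>Q0 D\<^esub> x"
  shows "\<top>\<^bsub>Q0 D\<^esub> \<odot>\<^bsub>Q0 D\<^esub> x = x"
proof (rule Q0.le_antisym[OF x(2)])
  have "ten D r l \<sqsubseteq>\<^bsub>Q0 D\<^esub> \<top>\<^bsub>Q0 D\<^esub> \<odot>\<^bsub>Q0 D\<^esub> x" if rl: "(r, l) \<in> below x" for r l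
  proof -
    have c: "r \<in> carrier R" "l \<in> carrier L" "ten D r l \<sqsubseteq>\<^bsub>Q0 D\<^esub> x" using rl by (auto simp: below_def)
    then have "ten D r l \<sqsubseteq>\<^bsub>Q0 D\<^esub> \<top>\<^bsub>Q0 D\<^esub> \<odot>\<^bsub>Q0 D\<^esub> ten D r l"
      using strong_triadD(2)[OF strong]
      by (simp add: top_Q0 ten_mult bimorphism_mono[OF bimorphism_ten])
    also have "\<dots> \<sqsubseteq>\<^bsub>Q0 D\<^esub> \<top>\<^bsub>Q0 D\<^esub> \<odot>\<^bsub>Q0 D\<^esub> x"
      using c x by (intro bimorphism_mono[OF bimorphism_Q0]) simp_all
    finally show ?thesis using c x by simp
  qed
  then have "\<Squnion>\<^bsub>Q0 D\<^esub>((\<lambda>(r, l). ten D r l) ` below x) \<sqsubseteq>\<^bsub>Q0 D\<^esub> \<top>\<^bsub>Q0 D\<^esub> \<odot>\<^bsub>Q0 D\<^esub> x"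
    using x by (intro Q0.sup_least) (auto simp: below_def)
  then show "x \<sqsubseteq>\<^bsub>Q0 D\<^esub> \<top>\<^bsub>Q0 D\<^esub> \<odot>\<^bsub>Q0 D\<^esub> x" using x by (simp add: sup_below)
qed (use x in simp_all)

text \<open>Dually, the other half of strongness gives $r \<otimes> l \<le> r \<otimes> (l1_R)1_L =
  (r \<otimes> l)1$.\<close>

lemma Q0_right_sided_eq:
  assumes x: "x \<in> carrier (Q0 D)" "x \<odot>\<^bsub>Q0 D\<^esub> \<top>\<^bsub>Q0 D\<^esub> \<sqsubseteq>\<^bsub>Q0 D\<^esub> x"
  shows "x \<odot>\<^bsub>Q0 D\<^esub> \<top>\<^bsub>Q0 D\<^esub> = x"
proof (rule Q0.le_antisym[OF x(2)])
  have "ten D r l \<sqsubseteq>\<^bsub>Q0 D\<^esub> x \<odot>\<^bsub>Q0 D\<^esub> \<top>\<^bsub>Q0 D\<^esub>" if rl: "(r, l) \<in> below x" for r l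
  proof -
    have c: "r \<in> carrier R" "l \<in> carrier L" "ten D r l \<sqsubseteq>\<^bsub>Q0 D\<^esub> x" using rl by (auto simp: below_def)
    then have "ten D r l \<sqsubseteq>\<^bsub>Q0 D\<^esub> ten D r l \<odot>\<^bsub>Q0 D\<^esub> \<top>\<^bsub>Q0 D\<^esub>"
      using strong_triadD(1)[OF strong]
      by (simp add: top_Q0 ten_mult ten_balanced bimorphism_mono[OF bimorphism_ten])
    also have "\<dots> \<sqsubseteq>\<^bsub>Q0 D\<^esub> x \<odot>\<^bsub>Q0 D\<^esub> \<top>\<^bsub>Q0 D\<^esub>"
      using c x by (intro bimorphism_mono[OF bimorphism_Q0]) simp_all
    finally show ?thesis using c x by simp
  qed
  then have "\<Squnion>\<^bsub>Q0 D\<^esub>((\<lambda>(r, l). ten D r l) ` below x) \<sqsubseteq>\<^bsub>Q0 D\<^esub> x \<odot>\<^bsub>Q0 D\<^esub> \<top>\<^bsub>Q0 D\<^esub>"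
    using x by (intro Q0.sup_least) (auto simp: below_def)
  then show "x \<sqsubseteq>\<^bsub>Q0 D\<^esub> x \<odot>\<^bsub>Q0 D\<^esub> \<top>\<^bsub>Q0 D\<^esub>" using x by (simp add: sup_below)
qed (use x in simp_all)

lemma top_mult_ten:
  "\<lbrakk>r \<in> carrier R; l \<in> carrier L\<rbrakk> \<Longrightarrow>
    \<top>\<^bsub>Q0 D\<^esub> \<odot>\<^bsub>Q0 D\<^esub> ten D r l = ten D \<top>\<^bsub>R\<^esub> (TL D (LR D \<top>\<^bsub>L\<^esub> r) l)"
  "\<lbrakk>r \<in> carrier R; l \<in> carrier L\<rbrakk> \<Longrightarrow>
    ten D r l \<odot>\<^bsub>Q0 D\<^esub> \<top>\<^bsub>Q0 D\<^esub> = ten D (RT D r (LR D l \<top>\<^bsub>R\<^esub>)) \<top>\<^bsub>L\<^esub>"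
  by (simp_all add: top_Q0 ten_mult ten_balanced)

lemma carrier_left_sided_Q0: "carrier (left_sided (Q0 D)) = ten D \<top>\<^bsub>R\<^esub> ` carrier L"
proof
  show "ten D \<top>\<^bsub>R\<^esub> ` carrier L \<subseteq> carrier (left_sided (Q0 D))"
    by (auto simp: sided_fields top_mult_ten top_LR)
  show "carrier (left_sided (Q0 D)) \<subseteq> ten D \<top>\<^bsub>R\<^esub> ` carrier L"
  proof
    fix x assume "x \<in> carrier (left_sided (Q0 D))"
    then have x: "x \<in> carrier (Q0 D)" "\<top>\<^bsub>Q0 D\<^esub> \<odot>\<^bsub>Q0 D\<^esub> x = x"
      using Q0_left_sided_eq by (auto simp: sided_fields)
    \<comment> \<open>Multiplying a generator by the top leaves $1_R \<otimes> (1_Lr)l$. These have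
      the common first factor $1_R$, so their join is again of this form, with the join of the
      second factors as witness.\<close>
    let ?B = "(\<lambda>(r, l). TL D (LR D \<top>\<^bsub>L\<^esub> r) l) ` below x"
    have B: "?B \<subseteq> carrier L" "(\<lambda>(r, l). ten D r l) ` below x \<subseteq> carrier (Q0 D)"
      by (auto simp: below_def)
    have "x = \<top>\<^bsub>Q0 D\<^esub> \<odot>\<^bsub>Q0 D\<^esub> \<Squnion>\<^bsub>Q0 D\<^esub>((\<lambda>(r, l). ten D r l) ` below x)"
      using x by (simp add: sup_below)
    also have "\<dots> = \<Squnion>\<^bsub>Q0 D\<^esub>((\<lambda>y. \<top>\<^bsub>Q0 D\<^esub> \<odot>\<^bsub>Q0 D\<^esub> y) ` (\<lambda>(r, l). ten D r l) ` below x)"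
      by (rule sup_morphismD(4)[OF bimorphismD(4)[OF bimorphism_Q0] B(2)]) simp
    also have "(\<lambda>y. \<top>\<^bsub>Q0 D\<^esub> \<odot>\<^bsub>Q0 D\<^esub> y) ` (\<lambda>(r, l). ten D r l) ` below x = ten D \<top>\<^bsub>R\<^esub> ` ?B"
      unfolding image_image by (intro image_cong) (auto simp: below_def top_mult_ten)
    also have "\<Squnion>\<^bsub>Q0 D\<^esub>(ten D \<top>\<^bsub>R\<^esub> ` ?B) = ten D \<top>\<^bsub>R\<^esub> (\<Squnion>\<^bsub>L\<^esub>?B)"
      by (rule sup_morphismD(4)[OF bimorphismD(4)[OF bimorphism_ten] B(1), symmetric]) simp
    finally show "x \<in> ten D \<top>\<^bsub>R\<^esub> ` carrier L"
      using B by simp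
  qed
qed

lemma carrier_right_sided_Q0: "carrier (right_sided (Q0 D)) = (\<lambda>r. ten D r \<top>\<^bsub>L\<^esub>) ` carrier R"
proof
  show "(\<lambda>r. ten D r \<top>\<^bsub>L\<^esub>) ` carrier R \<subseteq> carrier (right_sided (Q0 D))"
    by (auto simp: sided_fields top_mult_ten top_LR)
  show "carrier (right_sided (Q0 D)) \<subseteq> (\<lambda>r. ten D r \<top>\<^bsub>L\<^esub>) ` carrier R"
  proof
    fix x assume "x \<in> carrier (right_sided (Q0 D))"
    then have x: "x \<in> carrier (Q0 D)" "x \<odot>\<^bsub>Q0 D\<^esub> \<top>\<^bsub>Q0 D\<^esub> = x"
      using Q0_right_sided_eq by (auto simp: sided_fields)
    \<comment> \<open>Dually, the products $(r \<otimes> l)1$ share the second factor $1_L$, and the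
      witness is the join of the first factors $r(l1_R)$.\<close>
    let ?B = "(\<lambda>(r, l). RT D r (LR D l \<top>\<^bsub>R\<^esub>)) ` below x"
    have B: "?B \<subseteq> carrier R" "(\<lambda>(r, l). ten D r l) ` below x \<subseteq> carrier (Q0 D)"
      by (auto simp: below_def)
    have "x = \<Squnion>\<^bsub>Q0 D\<^esub>((\<lambda>(r, l). ten D r l) ` below x) \<odot>\<^bsub>Q0 D\<^esub> \<top>\<^bsub>Q0 D\<^esub>"
      using x by (simp add: sup_below)
    also have "\<dots> = \<Squnion>\<^bsub>Q0 D\<^esub>((\<lambda>y. y \<odot>\<^bsub>Q0 D\<^esub> \<top>\<^bsub>Q0 D\<^esub>) ` (\<lambda>(r, l). ten D r l) ` below x)"
      by (rule sup_morphismD(4)[OF bimorphismD(5)[OF bimorphism_Q0] B(2)]) simp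
    also have "(\<lambda>y. y \<odot>\<^bsub>Q0 D\<^esub> \<top>\<^bsub>Q0 D\<^esub>) ` (\<lambda>(r, l). ten D r l) ` below x = (\<lambda>r. ten D r \<top>\<^bsub>L\<^esub>) ` ?B"
      unfolding image_image by (intro image_cong) (auto simp: below_def top_mult_ten)
    also have "\<Squnion>\<^bsub>Q0 D\<^esub>((\<lambda>r. ten D r \<top>\<^bsub>L\<^esub>) ` ?B) = ten D (\<Squnion>\<^bsub>R\<^esub>?B) \<top>\<^bsub>L\<^esub>"
      by (rule sup_morphismD(4)[OF bimorphismD(5)[OF bimorphism_ten] B(1), symmetric]) simp
    finally show "x \<in> (\<lambda>r. ten D r \<top>\<^bsub>L\<^esub>) ` carrier R"
      using B by simp
  qed
qed

text \<open>A left-sided element $x = 1_R \<otimes> l$ that is also right-sided equals $x1 =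
  1_R(l1_R) \<otimes> 1_L$, so $t = l1_R$. Conversely, balance writes $1_Rt \<otimes> 1_L$ also as
  $1_R \<otimes> t1_L$, which shows both kinds of sidedness.\<close>

lemma carrier_two_sided_Q0:
  "carrier (two_sided (Q0 D)) = (\<lambda>t. ten D (RT D \<top>\<^bsub>R\<^esub> t) \<top>\<^bsub>L\<^esub>) ` carrier T"
proof
  show "(\<lambda>t. ten D (RT D \<top>\<^bsub>R\<^esub> t) \<top>\<^bsub>L\<^esub>) ` carrier T \<subseteq> carrier (two_sided (Q0 D))"
    unfolding sided_fields(10) carrier_left_sided_Q0 carrier_right_sided_Q0
    by (auto simp: ten_balanced) (auto simp: ten_balanced[symmetric])
  show "carrier (two_sided (Q0 D)) \<subseteq> (\<lambda>t. ten D (RT D \<top>\<^bsub>R\<^esub> t) \<top>\<^bsub>L\<^esub>) ` carrier T"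
  proof
    fix x assume x: "x \<in> carrier (two_sided (Q0 D))"
    then obtain l where l: "l \<in> carrier L" "x = ten D \<top>\<^bsub>R\<^esub> l"
      unfolding sided_fields(10) carrier_left_sided_Q0 by auto
    have "x = x \<odot>\<^bsub>Q0 D\<^esub> \<top>\<^bsub>Q0 D\<^esub>"
      using x Q0_right_sided_eq by (auto simp: sided_fields)
    then show "x \<in> (\<lambda>t. ten D (RT D \<top>\<^bsub>R\<^esub> t) \<top>\<^bsub>L\<^esub>) ` carrier T"
      using l by (auto simp: top_mult_ten)
  qed
qed

section \<open>One-sided and two-sided elements of \<open>Q1 D\<close>\<close>

lemma top_mult_Q1:
  assumes x: "x \<in> carrier (Q1 D)"
  shows "\<top>\<^bsub>Q1 D\<^esub> \<odot>\<^bsub>Q1 D\<^esub> x = rank_one \<top>\<^bsub>R\<^esub> (fst x \<top>\<^bsub>L\<^esub>)" "x \<sqsubseteq>\<^bsub>Q1 D\<^esub> \<top>\<^bsub>Q1 D\<^esub> \<odot>\<^bsub>Q1 D\<^esub> x"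
    and "x \<odot>\<^bsub>Q1 D\<^esub> \<top>\<^bsub>Q1 D\<^esub> = rank_one (snd x \<top>\<^bsub>R\<^esub>) \<top>\<^bsub>L\<^esub>" "x \<sqsubseteq>\<^bsub>Q1 D\<^esub> x \<odot>\<^bsub>Q1 D\<^esub> \<top>\<^bsub>Q1 D\<^esub>"
proof -
  note x' = Q1D[OF x]
  show 1: "\<top>\<^bsub>Q1 D\<^esub> \<odot>\<^bsub>Q1 D\<^esub> x = rank_one \<top>\<^bsub>R\<^esub> (fst x \<top>\<^bsub>L\<^esub>)"
    by (rule Q1_eqI) (use x x' in \<open>simp_all add: top_Q1_eq\<close>)
  show 2: "x \<odot>\<^bsub>Q1 D\<^esub> \<top>\<^bsub>Q1 D\<^esub> = rank_one (snd x \<top>\<^bsub>R\<^esub>) \<top>\<^bsub>L\<^esub>"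
    by (rule Q1_eqI) (use x x' in \<open>simp_all add: top_Q1_eq\<close>)
  \<comment> \<open>Strongness is applied at the argument $l$ and the first component is then pulled
    through the scalar $l1_R$. This bounds one component of each product; the other component needs
    a different use of strongness.\<close>
  have "fst x l \<sqsubseteq>\<^bsub>L\<^esub> TL D (LR D l \<top>\<^bsub>R\<^esub>) (fst x \<top>\<^bsub>L\<^esub>)" if "l \<in> carrier L" for l
    using sup_morphism_mono[OF x'(3) that _ strong_triadD(1)[OF strong that]] that by (simp add: x'(7))
  moreover have "snd x r \<sqsubseteq>\<^bsub>R\<^esub> RT D (snd x \<top>\<^bsub>R\<^esub>) (LR D \<top>\<^bsub>L\<^esub> r)" if "r \<in> carrier R" for r
    using sup_morphism_mono[OF x'(4) that _ strong_triadD(2)[OF strong that]] that by (simp add: x'(8))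
  \<comment> \<open>For the remaining components strongness is applied at the values
    \<open>snd x r\<close> and \<open>fst x l\<close>. The compatibility of the two components with
    the pairing then moves the map to the other side, which is why it is used in opposite directions
    for the two goals.\<close>
  ultimately show "x \<sqsubseteq>\<^bsub>Q1 D\<^esub> \<top>\<^bsub>Q1 D\<^esub> \<odot>\<^bsub>Q1 D\<^esub> x" "x \<sqsubseteq>\<^bsub>Q1 D\<^esub> x \<odot>\<^bsub>Q1 D\<^esub> \<top>\<^bsub>Q1 D\<^esub>"
    unfolding 1 2 using strong_triadD[OF strong] x'(5,6)
    by (simp add: Q1_le_iff x'(9), simp add: Q1_le_iff x'(9)[symmetric])
qed

lemma carrier_left_sided_Q1: "carrier (left_sided (Q1 D)) = rank_one \<top>\<^bsub>R\<^esub> ` carrier L"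
proof
  show "rank_one \<top>\<^bsub>R\<^esub> ` carrier L \<subseteq> carrier (left_sided (Q1 D))"
    by (auto simp: sided_fields top_mult_Q1 top_LR)
  show "carrier (left_sided (Q1 D)) \<subseteq> rank_one \<top>\<^bsub>R\<^esub> ` carrier L"
  proof
    fix x assume "x \<in> carrier (left_sided (Q1 D))"
    then have x: "x \<in> carrier (Q1 D)" "\<top>\<^bsub>Q1 D\<^esub> \<odot>\<^bsub>Q1 D\<^esub> x \<sqsubseteq>\<^bsub>Q1 D\<^esub> x" by (auto simp: sided_fields)
    then have "x = rank_one \<top>\<^bsub>R\<^esub> (fst x \<top>\<^bsub>L\<^esub>)"
      using Q1.le_antisym[OF top_mult_Q1(2) x(2)] x(1) Q1D(5) by (simp add: top_mult_Q1(1))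
    then show "x \<in> rank_one \<top>\<^bsub>R\<^esub> ` carrier L"
      using Q1D(5)[OF x(1), of "\<top>\<^bsub>L\<^esub>"] by auto
  qed
qed

lemma carrier_right_sided_Q1: "carrier (right_sided (Q1 D)) = (\<lambda>r. rank_one r \<top>\<^bsub>L\<^esub>) ` carrier R"
proof
  show "(\<lambda>r. rank_one r \<top>\<^bsub>L\<^esub>) ` carrier R \<subseteq> carrier (right_sided (Q1 D))"
    by (auto simp: sided_fields top_mult_Q1 top_LR)
  show "carrier (right_sided (Q1 D)) \<subseteq> (\<lambda>r. rank_one r \<top>\<^bsub>L\<^esub>) ` carrier R"
  proof
    fix x assume "x \<in> carrier (right_sided (Q1 D))"
    then have x: "x \<in> carrier (Q1 D)" "x \<odot>\<^bsub>Q1 D\<^esub> \<top>\<^bsub>Q1 D\<^esub> \<sqsubseteq>\<^bsub>Q1 D\<^esub> x" by (auto simp: sided_fields)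
    then have "x = rank_one (snd x \<top>\<^bsub>R\<^esub>) \<top>\<^bsub>L\<^esub>"
      using Q1.le_antisym[OF top_mult_Q1(4) x(2)] x(1) Q1D(6) by (simp add: top_mult_Q1(3))
    then show "x \<in> (\<lambda>r. rank_one r \<top>\<^bsub>L\<^esub>) ` carrier R"
      using Q1D(6)[OF x(1), of "\<top>\<^bsub>R\<^esub>"] by auto
  qed
qed

lemma rank_one_balanced:
  "\<lbrakk>r \<in> carrier R; t \<in> carrier T; l \<in> carrier L\<rbrakk> \<Longrightarrow> rank_one (RT D r t) l = rank_one r (TL D t l)"
  by (rule balancedD(3)[OF balanced_rank_one])

text \<open>The scalar is again $t = l1_R$, where $x$ is \<open>rank_one\<close> at $1_R$ and
  $l$.\<close>

lemma carrier_two_sided_Q1: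
  "carrier (two_sided (Q1 D)) = (\<lambda>t. rank_one (RT D \<top>\<^bsub>R\<^esub> t) \<top>\<^bsub>L\<^esub>) ` carrier T"
proof
  show "(\<lambda>t. rank_one (RT D \<top>\<^bsub>R\<^esub> t) \<top>\<^bsub>L\<^esub>) ` carrier T \<subseteq> carrier (two_sided (Q1 D))"
    unfolding sided_fields(10) carrier_left_sided_Q1 carrier_right_sided_Q1
    by (auto simp: rank_one_balanced) (auto simp: rank_one_balanced[symmetric])
  show "carrier (two_sided (Q1 D)) \<subseteq> (\<lambda>t. rank_one (RT D \<top>\<^bsub>R\<^esub> t) \<top>\<^bsub>L\<^esub>) ` carrier T"
  proof
    fix x assume x: "x \<in> carrier (two_sided (Q1 D))"
    then obtain l where l: "l \<in> carrier L" "x = rank_one \<top>\<^bsub>R\<^esub> l"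
      unfolding sided_fields(10) carrier_left_sided_Q1 by auto
    have c: "x \<in> carrier (Q1 D)" "x \<odot>\<^bsub>Q1 D\<^esub> \<top>\<^bsub>Q1 D\<^esub> \<sqsubseteq>\<^bsub>Q1 D\<^esub> x"
      using x by (auto simp: sided_fields)
    then have "x = x \<odot>\<^bsub>Q1 D\<^esub> \<top>\<^bsub>Q1 D\<^esub>"
      using top_mult_Q1(4)[OF c(1)] by (intro Q1.le_antisym) auto
    then have "x = rank_one (RT D \<top>\<^bsub>R\<^esub> (LR D l \<top>\<^bsub>R\<^esub>)) \<top>\<^bsub>L\<^esub>"
      using l by (simp add: top_Q1_eq rank_one_mult)
    then show "x \<in> (\<lambda>t. rank_one (RT D \<top>\<^bsub>R\<^esub> t) \<top>\<^bsub>L\<^esub>) ` carrier T"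
      using l by auto
  qed
qed

text \<open>All three use $1_L1_R = e$. In the last one, the first component sends $1_L$ to
  $(1_L(1_Rt))1_L = t1_L$, and pairing this with $1_R$ leaves $t(1_L1_R) = t$.\<close>

lemma rank_one_top_recover:
  "l \<in> carrier L \<Longrightarrow> fst (rank_one \<top>\<^bsub>R\<^esub> l) \<top>\<^bsub>L\<^esub> = l"
  "r \<in> carrier R \<Longrightarrow> snd (rank_one r \<top>\<^bsub>L\<^esub>) \<top>\<^bsub>R\<^esub> = r"
  "t \<in> carrier T \<Longrightarrow> LR D (fst (rank_one (RT D \<top>\<^bsub>R\<^esub> t) \<top>\<^bsub>L\<^esub>) \<top>\<^bsub>L\<^esub>) \<top>\<^bsub>R\<^esub> = t"
  by (simp_all add: top_LR LR_RT LR_TL)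

section \<open>Order embeddings of $L$, $R$ and $T$ into \<open>Q1 D\<close> and
  \<open>Q0 D\<close>\<close>

lemma bimorphism_rank_one: "bimorphism R L (Q1 D) rank_one"
  by (rule balancedD(1)[OF balanced_rank_one])

lemma left_embedding_Q1:
  "bij_betw (rank_one \<top>\<^bsub>R\<^esub>) (carrier L) (carrier (left_sided (Q1 D)))"
  "\<lbrakk>l \<in> carrier L; l' \<in> carrier L\<rbrakk> \<Longrightarrow>
    rank_one \<top>\<^bsub>R\<^esub> l \<sqsubseteq>\<^bsub>Q1 D\<^esub> rank_one \<top>\<^bsub>R\<^esub> l' \<longleftrightarrow> l \<sqsubseteq>\<^bsub>L\<^esub> l'"
  using order_embedding_of_retraction[OF bimorphismD(4)[OF bimorphism_rank_one R.top_closed]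
      sup_morphism_fst[OF L.top_closed] rank_one_top_recover(1)]
  by (simp_all only: bij_betw_def carrier_left_sided_Q1)

lemma right_embedding_Q1:
  "bij_betw (\<lambda>r. rank_one r \<top>\<^bsub>L\<^esub>) (carrier R) (carrier (right_sided (Q1 D)))"
  "\<lbrakk>r \<in> carrier R; r' \<in> carrier R\<rbrakk> \<Longrightarrow>
    rank_one r \<top>\<^bsub>L\<^esub> \<sqsubseteq>\<^bsub>Q1 D\<^esub> rank_one r' \<top>\<^bsub>L\<^esub> \<longleftrightarrow> r \<sqsubseteq>\<^bsub>R\<^esub> r'"
  using order_embedding_of_retraction[OF bimorphismD(5)[OF bimorphism_rank_one L.top_closed]
      sup_morphism_snd[OF R.top_closed] rank_one_top_recover(2)]
  by (simp_all only: bij_betw_def carrier_right_sided_Q1)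

lemma two_embedding_Q1:
  "bij_betw (\<lambda>t. rank_one (RT D \<top>\<^bsub>R\<^esub> t) \<top>\<^bsub>L\<^esub>) (carrier T) (carrier (two_sided (Q1 D)))"
  "\<lbrakk>t \<in> carrier T; t' \<in> carrier T\<rbrakk> \<Longrightarrow>
    rank_one (RT D \<top>\<^bsub>R\<^esub> t) \<top>\<^bsub>L\<^esub> \<sqsubseteq>\<^bsub>Q1 D\<^esub> rank_one (RT D \<top>\<^bsub>R\<^esub> t') \<top>\<^bsub>L\<^esub> \<longleftrightarrow> t \<sqsubseteq>\<^bsub>T\<^esub> t'"
  using order_embedding_of_retraction[OF
      sup_morphism_comp[OF bimorphismD(4)[OF bimorphism_RT R.top_closed]
        bimorphismD(5)[OF bimorphism_rank_one L.top_closed]]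
      sup_morphism_comp[OF sup_morphism_fst[OF L.top_closed] bimorphismD(5)[OF bimorphism_LR R.top_closed]]
      rank_one_top_recover(3)]
  by (simp_all only: bij_betw_def carrier_two_sided_Q1)

text \<open>The retraction onto $L$ is \<open>phi\<close> followed by evaluation of the first
  component at $1_L$; this makes $l \<mapsto> 1_R \<otimes> l$ injective and order-reflecting
  without any comparison of representatives.\<close>

lemma left_embedding_Q0:
  "bij_betw (ten D \<top>\<^bsub>R\<^esub>) (carrier L) (carrier (left_sided (Q0 D)))"
  "\<lbrakk>l \<in> carrier L; l' \<in> carrier L\<rbrakk> \<Longrightarrow> ten D \<top>\<^bsub>R\<^esub> l \<sqsubseteq>\<^bsub>Q0 D\<^esub> ten D \<top>\<^bsub>R\<^esub> l' \<longleftrightarrow> l \<sqsubseteq>\<^bsub>L\<^esub> l'"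
proof -
  have "fst (phi (ten D \<top>\<^bsub>R\<^esub> l)) \<top>\<^bsub>L\<^esub> = l" if "l \<in> carrier L" for l
    using rank_one_top_recover(1)[OF that] that by (simp only: phi_ten R.top_closed)
  note * = order_embedding_of_retraction[OF bimorphismD(4)[OF bimorphism_ten R.top_closed]
      sup_morphism_comp[OF sup_morphism_phi sup_morphism_fst[OF L.top_closed]] this]
  show "bij_betw (ten D \<top>\<^bsub>R\<^esub>) (carrier L) (carrier (left_sided (Q0 D)))"
    using *(1) by (simp only: bij_betw_def carrier_left_sided_Q0)
  show "ten D \<top>\<^bsub>R\<^esub> l \<sqsubseteq>\<^bsub>Q0 D\<^esub> ten D \<top>\<^bsub>R\<^esub> l' \<longleftrightarrow> l \<sqsubseteq>\<^bsub>L\<^esub> l'" if "l \<in> carrier L" "l' \<in> carrier L"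
    using *(2) that by simp
qed

lemma right_embedding_Q0:
  "bij_betw (\<lambda>r. ten D r \<top>\<^bsub>L\<^esub>) (carrier R) (carrier (right_sided (Q0 D)))"
  "\<lbrakk>r \<in> carrier R; r' \<in> carrier R\<rbrakk> \<Longrightarrow> ten D r \<top>\<^bsub>L\<^esub> \<sqsubseteq>\<^bsub>Q0 D\<^esub> ten D r' \<top>\<^bsub>L\<^esub> \<longleftrightarrow> r \<sqsubseteq>\<^bsub>R\<^esub> r'"
proof -
  have "snd (phi (ten D r \<top>\<^bsub>L\<^esub>)) \<top>\<^bsub>R\<^esub> = r" if "r \<in> carrier R" for r
    using rank_one_top_recover(2)[OF that] that by (simp only: phi_ten L.top_closed)
  note * = order_embedding_of_retraction[OF bimorphismD(5)[OF bimorphism_ten L.top_closed]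
      sup_morphism_comp[OF sup_morphism_phi sup_morphism_snd[OF R.top_closed]] this]
  show "bij_betw (\<lambda>r. ten D r \<top>\<^bsub>L\<^esub>) (carrier R) (carrier (right_sided (Q0 D)))"
    using *(1) by (simp only: bij_betw_def carrier_right_sided_Q0)
  show "ten D r \<top>\<^bsub>L\<^esub> \<sqsubseteq>\<^bsub>Q0 D\<^esub> ten D r' \<top>\<^bsub>L\<^esub> \<longleftrightarrow> r \<sqsubseteq>\<^bsub>R\<^esub> r'" if "r \<in> carrier R" "r' \<in> carrier R"
    using *(2) that by simp
qed

text \<open>The retraction onto $T$ composes \<open>phi\<close>, evaluation at $1_L$ and pairing
  with $1_R$, passing from $t$'s image through $t1_L$ back to $t$.\<close>

lemma two_embedding_Q0:
  "bij_betw (\<lambda>t. ten D (RT D \<top>\<^bsub>R\<^esub> t) \<top>\<^bsub>L\<^esub>) (carrier T) (carrier (two_sided (Q0 D)))"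
  "\<lbrakk>t \<in> carrier T; t' \<in> carrier T\<rbrakk> \<Longrightarrow>
    ten D (RT D \<top>\<^bsub>R\<^esub> t) \<top>\<^bsub>L\<^esub> \<sqsubseteq>\<^bsub>Q0 D\<^esub> ten D (RT D \<top>\<^bsub>R\<^esub> t') \<top>\<^bsub>L\<^esub> \<longleftrightarrow> t \<sqsubseteq>\<^bsub>T\<^esub> t'"
proof -
  have "LR D (fst (phi (ten D (RT D \<top>\<^bsub>R\<^esub> t) \<top>\<^bsub>L\<^esub>)) \<top>\<^bsub>L\<^esub>) \<top>\<^bsub>R\<^esub> = t" if "t \<in> carrier T" for t
    using rank_one_top_recover(3)[OF that] that by (simp only: phi_ten triad_closed L.top_closed R.top_closed)
  note * = order_embedding_of_retraction[OF
      sup_morphism_comp[OF bimorphismD(4)[OF bimorphism_RT R.top_closed]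
        bimorphismD(5)[OF bimorphism_ten L.top_closed]]
      sup_morphism_comp[OF sup_morphism_phi sup_morphism_comp[OF sup_morphism_fst[OF L.top_closed]
          bimorphismD(5)[OF bimorphism_LR R.top_closed]]] this]
  show "bij_betw (\<lambda>t. ten D (RT D \<top>\<^bsub>R\<^esub> t) \<top>\<^bsub>L\<^esub>) (carrier T) (carrier (two_sided (Q0 D)))"
    using *(1) by (simp only: bij_betw_def carrier_two_sided_Q0)
  show "ten D (RT D \<top>\<^bsub>R\<^esub> t) \<top>\<^bsub>L\<^esub> \<sqsubseteq>\<^bsub>Q0 D\<^esub> ten D (RT D \<top>\<^bsub>R\<^esub> t') \<top>\<^bsub>L\<^esub> \<longleftrightarrow> t \<sqsubseteq>\<^bsub>T\<^esub> t'"
    if "t \<in> carrier T" "t' \<in> carrier T"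
    using *(2) that by simp
qed

text \<open>The embedding is multiplicative because $1_L(1_Rt') = (1_L1_R)t' = t'$, so the first
  factor of the product is $(1_Rt)t' = 1_R(tt')$.\<close>

lemma two_sided_Q0_isomorphic: "quantale_isomorphic T (two_sided (Q0 D))"
  by (rule quantale_isomorphic_transport[OF quantale_T _ two_embedding_Q0(1)])
    (simp_all add: sided_fields two_embedding_Q0(2) Q0_fields(2) ten_mult LR_RT top_LR RT_mult)

lemma two_sided_Q1_isomorphic: "quantale_isomorphic T (two_sided (Q1 D))"
  by (rule quantale_isomorphic_transport[OF quantale_T _ two_embedding_Q1(1)])
    (simp_all add: sided_fields two_embedding_Q1(2) Q1.eq_is_equal rank_one_mult LR_RT top_LR RT_mult)

end

section \<open>The actions of a solution\<close>

locale triad_solution = quantum_triad D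
  for D :: "('l, 't, 'r) triad" +
  fixes S :: "('q, 'l, 'r) solution"
  assumes solution: "solution D S"
begin

lemma right_module_L: "right_module (Sq S) L (LQ S)"
  and left_module_R: "left_module (Sq S) R (QR S)"
  using solution by (auto simp: solution_def bimodule_def)

lemma LQ_closed [simp]: "\<lbrakk>l \<in> carrier L; q \<in> carrier (Sq S)\<rbrakk> \<Longrightarrow> LQ S l q \<in> carrier L"
  using right_module_L by (auto simp: right_module_def dest: bimorphismD(6))

lemma QR_closed [simp]: "\<lbrakk>r \<in> carrier R; q \<in> carrier (Sq S)\<rbrakk> \<Longrightarrow> QR S q r \<in> carrier R"
  using left_module_R by (auto simp: left_module_def dest: bimorphismD(6))

lemma LQ_TL:
  "\<lbrakk>t \<in> carrier T; l \<in> carrier L; q \<in> carrier (Sq S)\<rbrakk> \<Longrightarrow> LQ S (TL D t l) q = TL D t (LQ S l q)"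
  using solution by (auto simp: solution_def bimodule_def)

lemma QR_RT:
  "\<lbrakk>t \<in> carrier T; r \<in> carrier R; q \<in> carrier (Sq S)\<rbrakk> \<Longrightarrow> QR S q (RT D r t) = RT D (QR S q r) t"
  using solution by (auto simp: solution_def bimodule_def)

lemma LR_LQ:
  "\<lbrakk>q \<in> carrier (Sq S); r \<in> carrier R; l \<in> carrier L\<rbrakk> \<Longrightarrow> LR D (LQ S l q) r = LR D l (QR S q r)"
  using solution by (auto simp: solution_def)

text \<open>The defining join is \<open>extend\<close> of $(r, l) \<mapsto> r \<otimes> lq$, which
  is balanced because $(tl)q = t(lq)$ in the bimodule $L$.\<close>

lemma Q0_ract_ten:
  assumes "q \<in> carrier (Sq S)" "r \<in> carrier R" "l \<in> carrier L"
  shows "Q0_ract D S (ten D r l) q = ten D r (LQ S l q)"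
proof -
  have "sup_morphism L L (\<lambda>l. LQ S l q)"
    using right_module_L assms by (auto simp: right_module_def dest: bimorphismD(5))
  then have "balanced (Q0 D) (\<lambda>r l. ten D r (LQ S l q))"
    using assms by (intro balanced_comp[OF balanced_ten sup_morphism_id[OF R.complete_lattice_axioms]])
      (simp_all add: LQ_TL ten_balanced)
  moreover have "Q0_ract D S x q = extend (Q0 D) (\<lambda>r l. ten D r (LQ S l q)) x" for x
    unfolding Q0_ract_def extend_def by (rule arg_cong[of _ _ "\<lambda>X. \<Squnion>\<^bsub>Q0 D\<^esub>X"]) (auto simp: below_def)
  ultimately show ?thesis using assms by (simp add: extend_ten)
qed

lemma Q0_lact_ten:
  assumes "q \<in> carrier (Sq S)" "r \<in> carrier R" "l \<in> carrier L"
  shows "Q0_lact D S q (ten D r l) = ten D (QR S q r) l"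
proof -
  have "sup_morphism R R (\<lambda>r. QR S q r)"
    using left_module_R assms by (auto simp: left_module_def dest: bimorphismD(4))
  then have "balanced (Q0 D) (\<lambda>r l. ten D (QR S q r) l)"
    using assms by (intro balanced_comp[OF balanced_ten _ sup_morphism_id[OF L.complete_lattice_axioms]])
      (simp_all add: QR_RT ten_balanced)
  moreover have "Q0_lact D S q x = extend (Q0 D) (\<lambda>r l. ten D (QR S q r) l) x" for x
    unfolding Q0_lact_def extend_def by (rule arg_cong[of _ _ "\<lambda>X. \<Squnion>\<^bsub>Q0 D\<^esub>X"]) (auto simp: below_def)
  ultimately show ?thesis using assms by (simp add: extend_ten)
qed

text \<open>The first components agree since $((l'r)l)q = (l'r)(lq)$ by the bimodule law, the second
  since $l(qr') = (lq)r'$.\<close>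

lemma Q1_ract_rank_one:
  assumes "q \<in> carrier (Sq S)" "r \<in> carrier R" "l \<in> carrier L"
  shows "Q1_ract D S (rank_one r l) q = rank_one r (LQ S l q)"
  using assms
  by (auto simp: Q1_ract_def Q1_elem_def Q1_mult rank_one_def compose_def LQ_TL LR_LQ intro!: restrict_ext)

lemma Q1_lact_rank_one:
  assumes "q \<in> carrier (Sq S)" "r \<in> carrier R" "l \<in> carrier L"
  shows "Q1_lact D S q (rank_one r l) = rank_one (QR S q r) l"
  using assms
  by (auto simp: Q1_lact_def Q1_elem_def Q1_mult rank_one_def compose_def QR_RT LR_LQ intro!: restrict_ext)

end

locale strict_triad_solution = triad_solution + strict_quantum_triad
begin

text \<open>The embedding $l \<mapsto> 1_R \<otimes> l$ intertwines the actions because $(1_R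
  \<otimes> l)q = 1_R \<otimes> lq$ changes the second factor only.\<close>

lemma left_sided_Q0_isomorphic:
  "right_module_isomorphic (Sq S) L (LQ S) (left_sided (Q0 D)) (Q0_ract D S)"
  by (rule right_module_isomorphic_transport[OF right_module_L _ left_embedding_Q0(1)])
    (simp_all add: sided_fields left_embedding_Q0(2) Q0_fields(2) Q0_ract_ten)

lemma left_sided_Q1_isomorphic:
  "right_module_isomorphic (Sq S) L (LQ S) (left_sided (Q1 D)) (Q1_ract D S)"
  by (rule right_module_isomorphic_transport[OF right_module_L _ left_embedding_Q1(1)])
    (simp_all add: sided_fields left_embedding_Q1(2) Q1.eq_is_equal Q1_ract_rank_one)

lemma right_sided_Q0_isomorphic:
  "left_module_isomorphic (Sq S) R (QR S) (right_sided (Q0 D)) (Q0_lact D S)"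
  by (rule left_module_isomorphic_transport[OF left_module_R _ right_embedding_Q0(1)])
    (simp_all add: sided_fields right_embedding_Q0(2) Q0_fields(2) Q0_lact_ten)

lemma right_sided_Q1_isomorphic:
  "left_module_isomorphic (Sq S) R (QR S) (right_sided (Q1 D)) (Q1_lact D S)"
  by (rule left_module_isomorphic_transport[OF left_module_R _ right_embedding_Q1(1)])
    (simp_all add: sided_fields right_embedding_Q1(2) Q1.eq_is_equal Q1_lact_rank_one)

end

theorem proposition3p10:
  fixes D :: "('l, 't, 'r) triad"
  assumes "triad D"
  shows "(\<exists>!\<phi>. canonical_morphism D \<phi>) \<and>
    (\<forall>\<phi>. canonical_morphism D \<phi> \<longrightarrow>
       (strong_morphism (Q0 D) (Q1 D) \<phi> \<longleftrightarrow> strong_triad D)) \<and>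
    (strict_triad D \<longrightarrow>
       (\<forall>S :: ('q, 'l, 'r) solution. solution D S \<longrightarrow>
          right_module_isomorphic (Sq S)
            (left_sided (Q0 D)) (Q0_ract D S) (left_sided (Q1 D)) (Q1_ract D S) \<and>
          right_module_isomorphic (Sq S)
            (left_sided (Q1 D)) (Q1_ract D S) (Lm D) (LQ S) \<and>
          left_module_isomorphic (Sq S)
            (right_sided (Q0 D)) (Q0_lact D S) (right_sided (Q1 D)) (Q1_lact D S) \<and>
          left_module_isomorphic (Sq S)
            (right_sided (Q1 D)) (Q1_lact D S) (Rm D) (QR S)) \<and>
       quantale_isomorphic (two_sided (Q0 D)) (two_sided (Q1 D)) \<and>
       quantale_isomorphic (two_sided (Q1 D)) (Tq D) \<and>
       strictly_two_sided (Tq D))"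
proof -
  interpret quantum_triad D by unfold_locales fact
  have solutions: "right_module_isomorphic (Sq S)
            (left_sided (Q0 D)) (Q0_ract D S) (left_sided (Q1 D)) (Q1_ract D S) \<and>
          right_module_isomorphic (Sq S) (left_sided (Q1 D)) (Q1_ract D S) (Lm D) (LQ S) \<and>
          left_module_isomorphic (Sq S)
            (right_sided (Q0 D)) (Q0_lact D S) (right_sided (Q1 D)) (Q1_lact D S) \<and>
          left_module_isomorphic (Sq S) (right_sided (Q1 D)) (Q1_lact D S) (Rm D) (QR S)"
    if "strict_triad D" "solution D S" for S :: "('q, 'l, 'r) solution"
  proof -
    interpret strict_triad_solution D S by unfold_locales fact+
    show ?thesis
      by (intro conjI
          right_module_isomorphic_trans[OF
            right_module_isomorphic_sym[OF left_sided_Q0_isomorphic] left_sided_Q1_isomorphic]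
          left_module_isomorphic_trans[OF
            left_module_isomorphic_sym[OF right_sided_Q0_isomorphic] right_sided_Q1_isomorphic]
          right_module_isomorphic_sym[OF left_sided_Q1_isomorphic]
          left_module_isomorphic_sym[OF right_sided_Q1_isomorphic])
  qed
  \<comment> \<open>These claims are established outside the context of a solution, so that they
    hold whether or not one exists over the type chosen for its elements.\<close>
  have strict: "quantale_isomorphic (two_sided (Q0 D)) (two_sided (Q1 D)) \<and>
      quantale_isomorphic (two_sided (Q1 D)) (Tq D) \<and> strictly_two_sided (Tq D)"
    if "strict_triad D"
  proof -
    interpret strict_quantum_triad D by unfold_locales fact
    show ?thesis
      by (intro conjI strictly_two_sided_T quantale_isomorphic_sym[OF two_sided_Q1_isomorphic]
          quantale_isomorphic_trans[OF
            quantale_isomorphic_sym[OF two_sided_Q0_isomorphic] two_sided_Q1_isomorphic])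
  qed
  show ?thesis
    \<comment> \<open>Rewriting canonical morphisms to \<open>phi\<close> settles existence,
      uniqueness and the strongness criterion together.\<close>
    using solutions strict by (simp add: canonical_morphism_iff strong_phi_iff)
qed

end
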